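(* Let $\rho>3/2$ and let $Q(x)=(q_{jk}(x))_{1\le j,k\le 4}$ be a function on $\mathbb{R}^3$ whose values are $4\times4$ Hermitian matrices, each $q_{jk}$ being measurable with $|q_{jk}(x)|\le C_0\langle x\rangle^{-\rho}$ for all $x\in\mathbb{R}^3$ and some constant $C_0>0$. Let $H=\alpha\cdot D+Q(x)$. If $f\in[L^{2,-s}(\mathbb{R}^3)]^4$ for some $s$ with $0<s\le\min\{3/2,\rho-1\}$ and $Hf=0$ in the distributional sense, then $f\in[H^1(\mathbb{R}^3)]^4$.
   Context: Notation: $\langle x\rangle=\sqrt{1+|x|^2}$, $D=\frac1i\nabla_x=(D_1,D_2,D_3)$, $\alpha\cdot D=\sum_{j=1}^3\alpha_jD_j$, where $\alpha_j=\begin{pmatrix}\mathbf 0&\sigma_j\\ \sigma_j&\mathbf 0\end{pmatrix}$ ($j=1,2,3$) are the $4\times4$ Dirac matrices built from the Pauli matrices $\sigma_1=\begin{pmatrix}0&1\\1&0\end{pmatrix}$, $\sigma_2=\begin{pmatrix}0&-i\\ i&0\end{pmatrix}$, $\sigma_3=\begin{pmatrix}1&0\\0&-1\end{pmatrix}$ and the $2\times 2$ zero matrix $\mathbf 0$. $L^{2,s}(\mathbb{R}^3)=\{u:\langle x\rangle^su\in L^2(\mathbb{R}^3)\}$ for $s\in\mathbb{R}$. $H^1(\mathbb{R}^3)$ is the usual $L^2$-Sobolev space of order 1. *)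

theory Defs
  imports "HOL-Analysis.Analysis"
begin

definition bracket :: "real^3 \<Rightarrow> real" where
  "bracket x = sqrt (1 + (norm x)\<^sup>2)"

text \<open>In the index types 2, 3 and 4 the top index is the numeral 2, 3, 4 (equal to 0),
  as usual with \<^const>\<open>vector\<close>.\<close>

definition pauli :: "3 \<Rightarrow> complex^2^2" where
  "pauli j =
    (if j = 1 then vector [vector [0, 1], vector [1, 0]]
     else if j = 2 then vector [vector [0, -\<i>], vector [\<i>, 0]]
     else vector [vector [1, 0], vector [0, -1]])"

definition dirac_alpha :: "3 \<Rightarrow> complex^4^4" where
  "dirac_alpha j =
    (let S = pauli j in
      vector [vector [0, 0, S$1$1, S$1$2],
              vector [0, 0, S$2$1, S$2$2],
              vector [S$1$1, S$1$2, 0, 0],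
              vector [S$2$1, S$2$2, 0, 0]])"

definition hermitian :: "complex^'n^'n \<Rightarrow> bool" where
  "hermitian A \<longleftrightarrow> (\<forall>j k. A$j$k = cnj (A$k$j))"

text \<open>Function spaces are sets of representatives; nothing below distinguishes functions that
  agree almost everywhere.\<close>

definition L2 :: "(real^3 \<Rightarrow> complex) set" where
  "L2 = {u. u \<in> borel_measurable lebesgue \<and> integrable lebesgue (\<lambda>x. (cmod (u x))\<^sup>2)}"

definition weighted_L2 :: "real \<Rightarrow> (real^3 \<Rightarrow> complex) set" where
  "weighted_L2 s = {u. (\<lambda>x. of_real (bracket x powr s) * u x) \<in> L2}"

definition partial_deriv :: "3 \<Rightarrow> (real^3 \<Rightarrow> complex) \<Rightarrow> real^3 \<Rightarrow> complex" where
  "partial_deriv j \<phi> x = frechet_derivative \<phi> (at x) (axis j 1)"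

definition D_op :: "3 \<Rightarrow> (real^3 \<Rightarrow> complex) \<Rightarrow> real^3 \<Rightarrow> complex" where
  "D_op j \<phi> = (\<lambda>x. (1 / \<i>) * partial_deriv j \<phi> x)"

text \<open>Total differentiability of the iterated partial derivatives of every order makes all of
  them continuous, so this is the class of \<open>C\<^sup>\<infinity>\<close> functions.\<close>

definition smooth :: "(real^3 \<Rightarrow> complex) \<Rightarrow> bool" where
  "smooth \<phi> \<longleftrightarrow> (\<forall>js :: 3 list. fold partial_deriv js \<phi> differentiable_on UNIV)"

definition test_functions :: "(real^3 \<Rightarrow> complex) set" where
  "test_functions = {\<phi>. smooth \<phi> \<and> compact (closure {x. \<phi> x \<noteq> 0})}"

text \<open>Distributions are represented as functionals that are only ever evaluated on
  \<^const>\<open>test_functions\<close>; the pairing is bilinear (no complex conjugation).\<close>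

type_synonym distribution = "(real^3 \<Rightarrow> complex) \<Rightarrow> complex"

definition regular_dist :: "(real^3 \<Rightarrow> complex) \<Rightarrow> distribution" where
  "regular_dist u \<phi> = (LINT x|lebesgue. u x * \<phi> x)"

definition dist_D :: "3 \<Rightarrow> distribution \<Rightarrow> distribution" where
  "dist_D j T \<phi> = - T (D_op j \<phi>)"

definition H1 :: "(real^3 \<Rightarrow> complex) set" where
  "H1 = {u \<in> L2. \<forall>j. \<exists>g\<in>L2. \<forall>\<phi>\<in>test_functions.
            dist_D j (regular_dist u) \<phi> = regular_dist g \<phi>}"

definition spinors :: "(real^3 \<Rightarrow> complex) set \<Rightarrow> (real^3 \<Rightarrow> complex^4) set" where
  "spinors X = {f. \<forall>a. (\<lambda>x. f x $ a) \<in> X}"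

text \<open>The \<open>a\<close>-th component of the distribution \<open>H f = (\<alpha> \<cdot> D) f + Q f\<close>.\<close>

definition dirac_dist ::
    "(real^3 \<Rightarrow> complex^4^4) \<Rightarrow> (real^3 \<Rightarrow> complex^4) \<Rightarrow> 4 \<Rightarrow> distribution" where
  "dirac_dist Q f a \<phi> =
     (\<Sum>j\<in>UNIV. \<Sum>b\<in>UNIV. dirac_alpha j $ a $ b * dist_D j (regular_dist (\<lambda>x. f x $ b)) \<phi>)
     + regular_dist (\<lambda>x. (Q x *v f x) $ a) \<phi>"

definition dirac_null :: "(real^3 \<Rightarrow> complex^4^4) \<Rightarrow> (real^3 \<Rightarrow> complex^4) \<Rightarrow> bool" where
  "dirac_null Q f \<longleftrightarrow> (\<forall>a. \<forall>\<phi>\<in>test_functions. dirac_dist Q f a \<phi> = 0)"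

end

theory Submission
  imports Defs
begin

text \<open>
  Write \<open>g = Q f\<close>; the hypotheses give \<open>f \<in> L\<^sup>2\<^sup>,\<^sup>-\<^sup>3\<^sup>/\<^sup>2\<close> and \<open>g \<in> L\<^sup>2\<^sup>,\<^sup>1\<close>. Let
  \<open>N\<^sub>e(z) = (e\<^sup>2 + \<bar>z\<bar>\<^sup>2)\<^bsup>-1/2\<^esup>\<close>, so that \<open>- \<Delta> N\<^sub>e / 3 = eta e\<close> is, up to a constant, an approximate identity.
  Testing \<open>H f = 0\<close> with \<open>(\<alpha> \<cdot> \<nabla>) N\<^sub>e(\<cdot> - x)\<close> and using \<open>(\<alpha> \<cdot> D)\<^sup>2 = - \<Delta>\<close> represents the mollified
  \<open>f\<close> as an integral of \<open>g\<close> against a kernel bounded by \<open>\<bar>x - y\<bar>\<^bsup>-2\<^esup>\<close>. By Schur's test that operator is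
  bounded from \<open>L\<^sup>2\<^sup>,\<^sup>1\<close> to \<open>L\<^sup>2\<close>, uniformly in \<open>e\<close>, whence \<open>f \<in> L\<^sup>2\<close>. Once \<open>f \<in> L\<^sup>2\<close>, the
  identity \<open>\<parallel>(\<alpha> \<cdot> \<nabla>) u\<parallel> = \<parallel>\<nabla> u\<parallel>\<close> for mollifications \<open>u\<close> of \<open>f\<close> shows that their gradients
  are Cauchy in \<open>L\<^sup>2\<close>, because the mollifications of \<open>g\<close> are; the limit is the weak gradient of \<open>f\<close>.
\<close>

subsection \<open>Integrals over three-dimensional space\<close>

text \<open>Two thresholds shape the argument. As \<open>Q\<close> gains \<open>\<rho>\<close>
  powers of the weight, s <= \<rho> - 1 puts \<open>Q f\<close> in weight 1, the weight that scaling
  demands if a kernel of order |x|^-2 in R^3 is to map into L^2. The bound s <= 3/2 is the limit for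
  justifying the representation: (alpha . grad) N_e has no compact support and decays like |x|^-2,
  so a cutoff at radius n leaves an error of order n^-1 n^-2 n^(3/2) n^(3/2), from the cutoff
  gradient, the decay, the weight of f and the root of the volume. This is bounded but not small;
  the error tends to 0 because it also carries the weighted norm of f over |x| >= n. A second
  obstacle: single second derivatives of N_e decay only like |x|^-3 and cannot in general be paired
  with f. The combination left by the Clifford relations decays like |x|^-5, so decay is required of
  that combination alone. The potential is smooth for e > 0, so no singular integral occurs; bounds
  uniform in e replace a limit of kernels. In the gradient step the symmetry of mixed derivatives is
  obtained by integrating by parts on the mollifier, in place of a Fourier transform.\<close>

lemma Cauchy_Schwarz_nn_integral:
  fixes f g :: "'a \<Rightarrow> ennreal"
  assumes [measurable]: "f \<in> borel_measurable M" "g \<in> borel_measurable M"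
  shows "(\<integral>\<^sup>+x. f x * g x \<partial>M)\<^sup>2 \<le> (\<integral>\<^sup>+x. (f x)\<^sup>2 \<partial>M) * (\<integral>\<^sup>+x. (g x)\<^sup>2 \<partial>M)"
proof -
  define A where "A = (\<integral>\<^sup>+x. (f x)\<^sup>2 \<partial>M)"
  define B where "B = (\<integral>\<^sup>+x. (g x)\<^sup>2 \<partial>M)"
  \<comment> \<open>Arithmetic-geometric mean inequality with a free parameter: it can be integrated
    whether or not the integrals are finite, and \<open>t\<close> is optimised afterwards.\<close>
  have amgm: "2 * (u * v) \<le> ennreal t * u\<^sup>2 + ennreal (1/t) * v\<^sup>2" if "t > 0" for u v :: ennreal and t :: real
  proof (cases u; cases v)
    fix r s assume rs: "0 \<le> r" "u = ennreal r" "0 \<le> s" "v = ennreal s"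
    have "0 \<le> (t * r - s)\<^sup>2 / t" using that by simp
    also have "\<dots> = t * r\<^sup>2 + (1/t) * s\<^sup>2 - 2 * (r * s)"
      using that by (simp add: power2_eq_square field_simps)
    finally have *: "2 * (r * s) \<le> t * r\<^sup>2 + (1/t) * s\<^sup>2" by simp
    have "2 * (u * v) = ennreal (2 * (r * s))"
      using rs by (simp add: ennreal_mult)
    also have "\<dots> \<le> ennreal (t * r\<^sup>2 + (1/t) * s\<^sup>2)" using * by (rule ennreal_leI)
    also have "\<dots> = ennreal t * u\<^sup>2 + ennreal (1/t) * v\<^sup>2"
      using rs that by (simp only: ennreal_plus ennreal_mult ennreal_power[symmetric] zero_le_power zero_le_mult_iff zero_le_divide_1_iff less_imp_le simp_thms)

    finally show ?thesis .
  qed (use that in \<open>auto simp: power2_eq_square ennreal_mult_top ennreal_top_mult\<close>)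
  have main: "2 * (\<integral>\<^sup>+x. f x * g x \<partial>M) \<le> ennreal t * A + ennreal (1/t) * B" if "t > 0" for t
  proof -
    have "2 * (\<integral>\<^sup>+x. f x * g x \<partial>M) = (\<integral>\<^sup>+x. 2 * (f x * g x) \<partial>M)"
      by (simp add: nn_integral_cmult)
    also have "\<dots> \<le> (\<integral>\<^sup>+x. ennreal t * (f x)\<^sup>2 + ennreal (1/t) * (g x)\<^sup>2 \<partial>M)"
      by (intro nn_integral_mono amgm that)
    also have "\<dots> = ennreal t * A + ennreal (1/t) * B"
      unfolding A_def B_def by (simp add: nn_integral_add nn_integral_cmult)
    finally show ?thesis .
  qed
  show ?thesis
  proof (cases "A = 0 \<or> B = 0")
    case True
    then have "AE x in M. f x * g x = 0"
    proof
      assume "A = 0"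
      then have "AE x in M. (f x)\<^sup>2 = 0" unfolding A_def by (subst (asm) nn_integral_0_iff_AE) auto
      then show ?thesis by eventually_elim auto
    next
      assume "B = 0"
      then have "AE x in M. (g x)\<^sup>2 = 0" unfolding B_def by (subst (asm) nn_integral_0_iff_AE) auto
      then show ?thesis by eventually_elim auto
    qed
    then have "(\<integral>\<^sup>+x. f x * g x \<partial>M) = 0" by (subst nn_integral_0_iff_AE) auto
    then show ?thesis by simp
  next
    case False
    show ?thesis
    proof (cases "A = \<infinity> \<or> B = \<infinity>")
      case True
      then show ?thesis using False unfolding A_def[symmetric] B_def[symmetric]
        by (auto simp: ennreal_mult_top ennreal_top_mult)
    next
      case fin: False
      obtain a where a: "A = ennreal a" "a \<ge> 0" using fin by (cases A) auto
      obtain b where b: "B = ennreal b" "b \<ge> 0" using fin by (cases B) auto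
      have ab: "a > 0" "b > 0" using False a b by (auto simp: less_le)
      \<comment> \<open>The minimiser of t a + b / t; both summands then equal sqrt (a b).\<close>
      define t where "t = sqrt (b / a)"
      have t: "t > 0" using ab by (simp add: t_def)
      have ta: "t * a = sqrt (a * b)" "(1/t) * b = sqrt (a * b)"
        using ab by (auto simp: t_def real_sqrt_divide real_sqrt_mult field_simps)
      have "ennreal (1/t) * B = ennreal ((1/t) * b)"
        using t ab unfolding b by (intro ennreal_mult[symmetric]) auto
      moreover have "ennreal t * A = ennreal (t * a)"
        using t ab unfolding a by (intro ennreal_mult[symmetric]) auto
      moreover have "ennreal (t * a) + ennreal ((1/t) * b) = ennreal (t * a + (1/t) * b)"
        using t ab by (intro ennreal_plus[symmetric]) auto
      ultimately have "2 * (\<integral>\<^sup>+x. f x * g x \<partial>M) \<le> ennreal (t * a + (1/t) * b)"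
        using main[OF t] by metis
      also have "\<dots> = 2 * ennreal (sqrt (a * b))"
        unfolding ta mult_2[symmetric] using ab by (subst ennreal_mult) auto
      finally have "(\<integral>\<^sup>+x. f x * g x \<partial>M) \<le> ennreal (sqrt (a * b))"
        by (subst (asm) ennreal_mult_le_mult_iff) auto
      then have "(\<integral>\<^sup>+x. f x * g x \<partial>M)\<^sup>2 \<le> (ennreal (sqrt (a * b)))\<^sup>2"
        by (intro power_mono) auto
      also have "\<dots> = A * B" using ab by (simp add: a b ennreal_power ennreal_mult)
      finally show ?thesis by (simp add: A_def B_def)
    qed
  qed
qed

section \<open>Translation, reflection and dilation of Lebesgue measure\<close>

lemma lborel_distr_shift: "distr lborel borel (\<lambda>y. y - x :: real^3) = lborel"
  using lborel_affine[of 1 "-x"] by (simp add: density_1)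

lemma lborel_distr_reflect: "distr lborel borel (\<lambda>y. x - y :: real^3) = lborel"
proof -
  have "(lborel :: (real^3) measure) = density (distr lborel borel (\<lambda>y. x + (-1) *\<^sub>R y)) (\<lambda>_. 1)"
    using lborel_affine[of "-1" x] by simp
  then show ?thesis by (simp add: density_1)
qed

lemma nn_integral_shift:
  fixes F :: "real^3 \<Rightarrow> ennreal"
  assumes "F \<in> borel_measurable borel"
  shows "(\<integral>\<^sup>+y. F (y - x) \<partial>lborel) = (\<integral>\<^sup>+y. F y \<partial>lborel)"
  using assms by (subst (2) lborel_distr_shift[symmetric, of x]) (simp add: nn_integral_distr)

lemma nn_integral_reflect:
  fixes F :: "real^3 \<Rightarrow> ennreal"
  assumes "F \<in> borel_measurable borel"
  shows "(\<integral>\<^sup>+y. F (x - y) \<partial>lborel) = (\<integral>\<^sup>+y. F y \<partial>lborel)"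
  using assms by (subst (2) lborel_distr_reflect[symmetric, of x]) (simp add: nn_integral_distr)

lemma integral_shift:
  fixes F :: "real^3 \<Rightarrow> 'b::{banach, second_countable_topology}"
  assumes "F \<in> borel_measurable borel"
  shows "(LINT y|lborel. F (y - x)) = (LINT y|lborel. F y)"
  using assms by (subst (2) lborel_distr_shift[symmetric, of x]) (simp add: integral_distr)

lemma integrable_shift:
  fixes F :: "real^3 \<Rightarrow> 'b::{banach, second_countable_topology}"
  assumes "integrable lborel F"
  shows "integrable lborel (\<lambda>y. F (y - x))"
proof -
  have "integrable (distr lborel borel (\<lambda>y. y - x)) F"
    using assms by (simp add: lborel_distr_shift)
  from integrable_distr[OF _ this] show ?thesis by simp
qed

lemma nn_integral_dilate:
  fixes F :: "real^3 \<Rightarrow> ennreal"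
  assumes [measurable]: "F \<in> borel_measurable borel" and e: "e > 0"
  shows "(\<integral>\<^sup>+y. F y \<partial>lborel) = ennreal (e^3) * (\<integral>\<^sup>+y. F (e *\<^sub>R y) \<partial>lborel)"
proof -
  have "(\<integral>\<^sup>+y. F y \<partial>lborel) = (\<integral>\<^sup>+y. F y \<partial>density (distr lborel borel (\<lambda>y. 0 + e *\<^sub>R y)) (\<lambda>_. ennreal (\<bar>e\<bar>^DIM(real^3))))"
    using lborel_affine[of e "0::real^3"] e by simp
  also have "\<dots> = (\<integral>\<^sup>+y. ennreal (e^3) * F (e *\<^sub>R y) \<partial>lborel)"
    using e by (simp add: nn_integral_density nn_integral_distr)
  finally show ?thesis by (simp add: nn_integral_cmult)
qed

lemma ennreal_le_suminf: "f k \<le> suminf f" for f :: "nat \<Rightarrow> ennreal"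
  using sum_le_suminf[of f "{k}"] by simp

lemma emeasure_ball3: "r \<ge> 0 \<Longrightarrow> emeasure lborel (ball (x::real^3) r) = ennreal (unit_ball_vol 3 * r^3)"
  by (simp add: emeasure_ball)

section \<open>Power weights and the Riesz kernel\<close>

text \<open>Dyadic shells: where 2^k r <= |x| < 2^(k+1) r the integrand is at most its value at the
  inner radius, and the shell is enlarged to the ball of the outer radius, which costs the factor 8.
  The shells then sum to a geometric series of ratio 2^(3-b).\<close>

lemma nn_integral_norm_powr_outside:
  assumes "b > 3" "r > 0"
  shows "(\<integral>\<^sup>+x. ennreal (norm (x::real^3) powr (-b)) * indicator {x. r \<le> norm x} x \<partial>lborel)
      \<le> ennreal (8 * unit_ball_vol 3 / (1 - 2 powr (3-b)) * r powr (3-b))"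
proof -
  define w where "w = 2 powr (3-b)"
  have w: "0 < w" "w < 1" using assms by (auto simp: w_def powr_less_one)
  have pw: "ennreal (norm x powr (-b)) * indicator {x. r \<le> norm x} x
     \<le> (\<Sum>k. ennreal ((2^k * r) powr (-b)) * indicator (ball 0 (2^Suc k * r)) x)" (is "?L x \<le> (\<Sum>k. ?g k x)") for x :: "real^3"
  proof (cases "r \<le> norm x")
    case True
    have "\<exists>n. norm x < 2^n * r"
    proof -
      obtain n where "norm x / r < 2^n" using real_arch_pow[of 2 "norm x / r"] by auto
      then show ?thesis using assms by (auto simp: field_simps)
    qed
    define n where "n = (LEAST n. norm x < 2^n * r)"
    have n1: "norm x < 2^n * r" unfolding n_def by (rule LeastI_ex) fact
    have "n \<noteq> 0" using n1 True by (intro notI) simp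
    then obtain k where k: "n = Suc k" by (cases n) auto
    have "\<not> norm x < 2^k * r" using not_less_Least[of k "\<lambda>n. norm x < 2^n * r"] k by (auto simp: n_def)
    then have n2: "2^k * r \<le> norm x" by simp
    have "norm x powr (-b) \<le> (2^k * r) powr (-b)"
      using n2 assms by (intro powr_mono2') auto
    then have "?L x \<le> ?g k x" using n1 True by (simp add: k ennreal_leI)
    also have "\<dots> \<le> (\<Sum>k. ?g k x)" by (rule ennreal_le_suminf)
    finally show ?thesis .
  qed simp
  have "(\<integral>\<^sup>+x. ?L x \<partial>lborel) \<le> (\<integral>\<^sup>+x. (\<Sum>k. ?g k x) \<partial>lborel)" by (intro nn_integral_mono pw)
  also have "\<dots> = (\<Sum>k. \<integral>\<^sup>+x. ?g k x \<partial>lborel)" by (rule nn_integral_suminf, intro borel_measurable_times_ennreal borel_measurable_const borel_measurable_indicator) simp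
  also have "\<dots> = (\<Sum>k. ennreal (8 * unit_ball_vol 3 * r powr (3-b) * w^k))"
  proof (intro suminf_cong)
    fix k
    have "(\<integral>\<^sup>+x. ?g k x \<partial>lborel) = ennreal ((2^k * r) powr (-b)) * ennreal (unit_ball_vol 3 * (2^Suc k * r)^3)"
      using assms by (subst nn_integral_cmult_indicator) (auto simp: emeasure_ball3)
    also have "\<dots> = ennreal ((2^k * r) powr (-b) * (unit_ball_vol 3 * (2^Suc k * r)^3))"
      using assms by (subst ennreal_mult) auto
    also have "(2^k * r) powr (-b) * (unit_ball_vol 3 * (2^Suc k * r)^3) = 8 * unit_ball_vol 3 * ((2^k * r) powr (-b) * (2^k * r) powr 3)"
      using assms by (simp add: powr_numeral power_mult_distrib)
    also have "(2^k * r) powr (-b) * (2^k * r) powr 3 = (2^k * r) powr (3-b)"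
      by (simp add: powr_add[symmetric])
    also have "\<dots> = w^k * r powr (3-b)"
      using assms by (simp add: powr_mult w_def powr_powr powr_realpow[symmetric] mult.commute)
    finally show "(\<integral>\<^sup>+x. ?g k x \<partial>lborel) = ennreal (8 * unit_ball_vol 3 * r powr (3-b) * w^k)"
      by (simp add: mult_ac)
  qed
  also have "\<dots> = ennreal (\<Sum>k. 8 * unit_ball_vol 3 * r powr (3-b) * w^k)"
    using w by (intro suminf_ennreal2) (auto intro!: summable_mult)
  also have "(\<Sum>k. 8 * unit_ball_vol 3 * r powr (3-b) * w^k) = 8 * unit_ball_vol 3 * r powr (3-b) * (1 / (1-w))"
    using w by (subst suminf_mult) (auto simp: suminf_geometric)
  finally show ?thesis by (simp add: w_def mult_ac)
qed

text \<open>The shells now shrink towards the origin, with ratio 2^(b-3). The factor 2^b appears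
  because the integrand is bounded by its value at the inner radius while the volume is that of the
  outer ball.\<close>

lemma nn_integral_norm_powr_inside:
  assumes "0 < b" "b < 3" "r > 0"
  shows "(\<integral>\<^sup>+x. ennreal (norm (x::real^3) powr (-b)) * indicator {x. norm x < r} x \<partial>lborel)
      \<le> ennreal (2 powr b * unit_ball_vol 3 / (1 - 2 powr (b-3)) * r powr (3-b))"
proof -
  define w where "w = 2 powr (b-3)"
  have w: "0 < w" "w < 1" using assms by (auto simp: w_def powr_less_one)
  have pw: "ennreal (norm x powr (-b)) * indicator {x. norm x < r} x
     \<le> (\<Sum>k. ennreal ((r / 2^Suc k) powr (-b)) * indicator (ball 0 (r / 2^k)) x)" (is "?L x \<le> (\<Sum>k. ?g k x)") for x :: "real^3"
  \<comment> \<open>At the origin \<open>powr\<close> returns 0, so the singular point satisfies the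
    bound trivially.\<close>
  proof (cases "norm x < r \<and> x \<noteq> 0")
    case True
    have "\<exists>n. r / 2^n \<le> norm x"
    proof -
      obtain n where "r / norm x < 2^n" using real_arch_pow[of 2 "r / norm x"] by auto
      then show ?thesis using True by (intro exI[of _ n]) (auto simp: field_simps)
    qed
    define n where "n = (LEAST n. r / 2^n \<le> norm x)"
    have n1: "r / 2^n \<le> norm x" unfolding n_def by (rule LeastI_ex) fact
    have "n \<noteq> 0" using n1 True by (intro notI) simp
    then obtain k where k: "n = Suc k" by (cases n) auto
    have "\<not> r / 2^k \<le> norm x" using not_less_Least[of k "\<lambda>n. r / 2^n \<le> norm x"] k by (auto simp: n_def)
    then have n2: "norm x < r / 2^k" by simp
    have "norm x powr (-b) \<le> (r / 2^Suc k) powr (-b)"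
      using n1 assms by (intro powr_mono2') (auto simp: k)
    then have "?L x \<le> ?g k x" using n2 True by (simp add: k ennreal_leI)
    also have "\<dots> \<le> (\<Sum>k. ?g k x)" by (rule ennreal_le_suminf)
    finally show ?thesis .
  qed (use assms in auto)
  have "(\<integral>\<^sup>+x. ?L x \<partial>lborel) \<le> (\<integral>\<^sup>+x. (\<Sum>k. ?g k x) \<partial>lborel)" by (intro nn_integral_mono pw)
  also have "\<dots> = (\<Sum>k. \<integral>\<^sup>+x. ?g k x \<partial>lborel)" by (rule nn_integral_suminf, intro borel_measurable_times_ennreal borel_measurable_const borel_measurable_indicator) simp
  also have "\<dots> = (\<Sum>k. ennreal (2 powr b * unit_ball_vol 3 * r powr (3-b) * w^k))"
  proof (intro suminf_cong)
    fix k
    define q where "q = r / 2^k"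
    have q: "q > 0" "r / 2^Suc k = q / 2" using assms by (auto simp: q_def)
    have "(\<integral>\<^sup>+x. ?g k x \<partial>lborel) = ennreal ((q/2) powr (-b)) * ennreal (unit_ball_vol 3 * q^3)"
      using q by (subst nn_integral_cmult_indicator) (auto simp: emeasure_ball3 q_def mult.commute)
    also have "\<dots> = ennreal ((q/2) powr (-b) * (unit_ball_vol 3 * q^3))"
      using q by (subst ennreal_mult) auto
    also have "(q/2) powr (-b) * (unit_ball_vol 3 * q^3) = 2 powr b * unit_ball_vol 3 * (q powr (-b) * q powr 3)"
      using q by (simp add: powr_numeral powr_divide powr_minus field_simps)
    also have "q powr (-b) * q powr 3 = q powr (3-b)"
      by (simp add: powr_add[symmetric])
    also have "\<dots> = w^k * r powr (3-b)"
    proof -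
      have "w^k * r powr (3-b) = 2 powr (k * (b-3)) * r powr (3-b)"
        by (simp add: w_def powr_powr powr_realpow[symmetric] mult.commute)
      also have "\<dots> = (2 powr k) powr (-(3-b)) * r powr (3-b)" by (simp add: powr_powr)
      also have "\<dots> = q powr (3-b)"
        using assms by (simp add: q_def powr_divide powr_realpow powr_minus field_simps del: minus_diff_eq)
      finally show ?thesis ..
    qed
    finally show "(\<integral>\<^sup>+x. ?g k x \<partial>lborel) = ennreal (2 powr b * unit_ball_vol 3 * r powr (3-b) * w^k)"
      by (simp add: mult_ac)
  qed
  also have "\<dots> = ennreal (\<Sum>k. 2 powr b * unit_ball_vol 3 * r powr (3-b) * w^k)"
    using w by (intro suminf_ennreal2) (auto intro!: summable_mult)
  also have "(\<Sum>k. 2 powr b * unit_ball_vol 3 * r powr (3-b) * w^k) = 2 powr b * unit_ball_vol 3 * r powr (3-b) * (1 / (1-w))"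
    using w by (subst suminf_mult) (auto simp: suminf_geometric)
  finally show ?thesis by (simp add: w_def mult_ac)
qed

lemma AE_lborel_neq: "AE x in lborel. (x::real^3) \<noteq> a"
  using AE_lborel_singleton[of a] by simp

text \<open>The integral converges at the origin because b < 3 and at infinity because 2 + b > 3;
  scaling dictates the power 3 - 2 - b of |y|. With m = |y| there are three regions: |x| >= 2 m,
  where |x - y| >= |x| / 2; the points with |x| < 2 m and |x - y| >= m / 2; and those with |x - y| <
  m / 2, where |x| >= m / 2.\<close>

lemma nn_integral_riesz_kernel:
  assumes b: "1 < b" "b < 3"
  shows "\<exists>C\<ge>0. \<forall>y::real^3. y \<noteq> 0 \<longrightarrow>
    (\<integral>\<^sup>+x. ennreal (norm (x - y) powr (-2)) * ennreal (norm x powr (-b)) \<partial>lborel)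
      \<le> ennreal (C * norm y powr (1 - b))"
proof -
  define K1 where "K1 = 8 * unit_ball_vol 3 / (1 - 2 powr (3 - (2 + b)))"
  define K2 where "K2 = 2 powr b * unit_ball_vol 3 / (1 - 2 powr (b - 3))"
  define K3 where "K3 = 2 powr 2 * unit_ball_vol 3 / (1 - 2 powr (2 - 3 :: real))"
  have K: "K1 \<ge> 0" "K2 \<ge> 0" "K3 \<ge> 0"
    using b powr_less_one[of 2 "3 - (2 + b)"] powr_less_one[of 2 "b - 3"] powr_less_one[of 2 "2 - 3 :: real"]
    by (auto simp: K1_def K2_def K3_def intro!: divide_nonneg_nonneg)
  \<comment> \<open>One summand for each of the three regions, rescaled to the common power
    m^(1-b).\<close>
  define C where "C = 4 * (K1 * 2 powr (1 - b)) + 4 * (K2 * 2 powr (3 - b)) + 3 * 2 powr b * K3"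
  have "C \<ge> 0" using K by (auto simp: C_def)
  moreover have "(\<integral>\<^sup>+x. ennreal (norm (x - y) powr (-2)) * ennreal (norm x powr (-b)) \<partial>lborel)
      \<le> ennreal (C * norm y powr (1 - b))" if y: "y \<noteq> 0" for y :: "real^3"
  proof -
    define m where "m = norm y"
    have m: "m > 0" using y by (simp add: m_def)
    let ?f1 = "\<lambda>x::real^3. ennreal (norm x powr (-(2+b))) * indicator {x. 2 * m \<le> norm x} x"
    let ?f2 = "\<lambda>x::real^3. ennreal (norm x powr (-b)) * indicator {x. norm x < 2 * m} x"
    let ?f3 = "\<lambda>x::real^3. ennreal (norm x powr (-2)) * indicator {x. norm x < 3 * m} x"
    have pw: "ennreal (norm (x - y) powr (-2)) * ennreal (norm x powr (-b))
      \<le> ennreal 4 * ?f1 x + ennreal ((m/2) powr (-2)) * ?f2 x + ennreal ((m/2) powr (-b)) * ?f3 (x - y)"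
      (is "?L \<le> ?A + ?B + ?C") for x :: "real^3"
    proof -
      have tri: "norm x \<le> norm (x - y) + m" "m \<le> norm (x - y) + norm x" "norm (x - y) \<le> norm x + m"
        unfolding m_def using norm_triangle_ineq[of "x - y" y] norm_triangle_ineq4[of x "x - y"]
          norm_triangle_ineq4[of x y] by auto
      show ?thesis
      proof (cases "2 * m \<le> norm x")
        case True
        have "norm (x - y) powr (-2) \<le> (norm x / 2) powr (-2)"
          using True tri m by (intro powr_mono2') auto
        also have "\<dots> = 4 * norm x powr (-2)"
          using True m by (simp add: powr_divide powr_minus powr_numeral field_simps)
        finally have "norm (x - y) powr (-2) * norm x powr (-b) \<le> 4 * norm x powr (-2) * norm x powr (-b)"
          by (intro mult_right_mono) auto
        also have "\<dots> = 4 * norm x powr (-(2+b))"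
          by (simp add: powr_add[symmetric] mult.assoc)
        finally have "?L \<le> ennreal (4 * norm x powr (-(2+b)))"
          by (subst ennreal_mult[symmetric]) (auto intro: ennreal_leI)
        also have "\<dots> = ?A" using True by (subst ennreal_mult) auto
        also have "\<dots> \<le> ?A + ?B + ?C" by (simp add: add_increasing2)
        finally show ?thesis .
      next
        case False
        show ?thesis
        proof (cases "norm (x - y) \<ge> m/2")
          case True
          have "norm (x - y) powr (-2) \<le> (m/2) powr (-2)"
            using True m by (intro powr_mono2') auto
          then have "?L \<le> ?B" using False by (auto intro!: mult_right_mono ennreal_leI)
          also have "\<dots> \<le> ?A + ?B + ?C" by (simp add: add_increasing2 add_increasing)
          finally show ?thesis .
        next
          case F2: False
          have "norm x powr (-b) \<le> (m/2) powr (-b)"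
            using F2 m tri b by (intro powr_mono2') auto
          then have "?L \<le> ?C" using F2 m by (subst mult.commute) (auto intro!: mult_right_mono ennreal_leI)
          also have "\<dots> \<le> ?A + ?B + ?C" by (simp add: add_increasing2 add_increasing)
          finally show ?thesis .
        qed
      qed
    qed
    have m2: "2 * m > 0" "3 * m > 0" using m by auto
    have i1: "(\<integral>\<^sup>+x. ?f1 x \<partial>lborel) \<le> ennreal (K1 * 2 powr (1-b) * m powr (1-b))"
      using nn_integral_norm_powr_outside[of "2+b" "2*m"] b m by (simp add: K1_def powr_mult mult.assoc)
    have i2: "(\<integral>\<^sup>+x. ?f2 x \<partial>lborel) \<le> ennreal (K2 * 2 powr (3-b) * m powr (3-b))"
      using nn_integral_norm_powr_inside[of "b" "2*m"] b m by (simp add: K2_def powr_mult mult.assoc)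
    have i3: "(\<integral>\<^sup>+x. ?f3 x \<partial>lborel) \<le> ennreal (K3 * 3 * m)"
      using nn_integral_norm_powr_inside[of "2" "3*m"] m by (simp add: K3_def mult.assoc)
    have i3': "(\<integral>\<^sup>+x. ?f3 (x - y) \<partial>lborel) = (\<integral>\<^sup>+x. ?f3 x \<partial>lborel)"
      by (rule nn_integral_shift) measurable
    have e2: "(m/2) powr (-2) * (K2 * 2 powr (3-b) * m powr (3-b)) = 4 * (K2 * 2 powr (3-b)) * m powr (1-b)"
    proof -
      have "(m/2) powr (-2) = 4 * m powr (-2)"
        using m by (simp add: powr_divide powr_minus powr_numeral field_simps)
      moreover have "m powr (-2) * m powr (3-b) = m powr (1-b)" by (simp add: powr_add[symmetric])
      ultimately show ?thesis by (simp add: mult_ac)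
    qed
    have e3: "(m/2) powr (-b) * (K3 * 3 * m) = 3 * 2 powr b * K3 * m powr (1-b)"
    proof -
      have "(m/2) powr (-b) = 2 powr b * m powr (-b)"
        using m by (simp add: powr_divide powr_minus field_simps)
      moreover have "m powr (-b) * m = m powr (1-b)"
        using m powr_add[of m "-b" 1] by simp
      ultimately show ?thesis by (simp add: mult_ac)
    qed
    have "(\<integral>\<^sup>+x. ennreal (norm (x - y) powr (-2)) * ennreal (norm x powr (-b)) \<partial>lborel)
      \<le> (\<integral>\<^sup>+x. (ennreal 4 * ?f1 x + ennreal ((m/2) powr (-2)) * ?f2 x) + ennreal ((m/2) powr (-b)) * ?f3 (x - y) \<partial>lborel)"
      by (intro nn_integral_mono pw)
    also have "\<dots> = ennreal 4 * (\<integral>\<^sup>+x. ?f1 x \<partial>lborel) + ennreal ((m/2) powr (-2)) * (\<integral>\<^sup>+x. ?f2 x \<partial>lborel)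
        + ennreal ((m/2) powr (-b)) * (\<integral>\<^sup>+x. ?f3 (x - y) \<partial>lborel)"
      by (subst nn_integral_add, measurable, subst nn_integral_add, measurable,
          subst (1 2 3) nn_integral_cmult, measurable)
    also have "\<dots> \<le> ennreal 4 * ennreal (K1 * 2 powr (1-b) * m powr (1-b))
        + ennreal ((m/2) powr (-2)) * ennreal (K2 * 2 powr (3-b) * m powr (3-b))
        + ennreal ((m/2) powr (-b)) * ennreal (K3 * 3 * m)"
      unfolding i3' using i1 i2 i3 by (intro add_mono mult_left_mono) auto
    also have "\<dots> = ennreal (4 * (K1 * 2 powr (1-b) * m powr (1-b))
        + (m/2) powr (-2) * (K2 * 2 powr (3-b) * m powr (3-b)) + (m/2) powr (-b) * (K3 * 3 * m))"
      using K m by (simp only: ennreal_mult[symmetric] ennreal_plus[symmetric] zero_le_mult_iff powr_ge_zero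
         less_imp_le zero_le_numeral add_nonneg_nonneg simp_thms)
    also have "4 * (K1 * 2 powr (1-b) * m powr (1-b))
        + (m/2) powr (-2) * (K2 * 2 powr (3-b) * m powr (3-b)) + (m/2) powr (-b) * (K3 * 3 * m) = C * m powr (1-b)"
      unfolding e2 e3 C_def by (simp add: algebra_simps)
    finally show ?thesis by (simp add: m_def)
  qed
  ultimately show ?thesis by blast
qed

lemma ennreal_powr_sq: "r \<ge> 0 \<Longrightarrow> (ennreal (r powr a))\<^sup>2 = ennreal (r powr (2 * a))"
  by (simp add: ennreal_power powr_powr mult.commute flip: powr_numeral)

text \<open>Schur's test, with the weight \<open>\<bar>y\<bar>\<close> to the power \<open>-5/2\<close>.\<close>

lemma schur_bound:
  "\<exists>C\<ge>0. \<forall>G \<in> borel_measurable (borel :: (real^3) measure).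
    (\<integral>\<^sup>+x. (\<integral>\<^sup>+y. G y * ennreal (norm (x - y) powr (-2)) \<partial>lborel)\<^sup>2 \<partial>lborel)
      \<le> ennreal C * (\<integral>\<^sup>+y. (G y)\<^sup>2 * ennreal ((norm y)\<^sup>2) \<partial>lborel)"
proof -
  \<comment> \<open>The Riesz lemma is applied twice: the exponent 5/2 gives -3/2, and 3/2 again
    lies between 1 and 3 and gives -1/2. Any exponent strictly between 2 and 3 would do; the
    leftover powers 5/2 and -1/2 of |y| multiply to |y|^2.\<close>
  obtain C1 where C1: "C1 \<ge> 0" "\<And>y::real^3. y \<noteq> 0 \<Longrightarrow>
    (\<integral>\<^sup>+x. ennreal (norm (x - y) powr (-2)) * ennreal (norm x powr (-5/2)) \<partial>lborel)
      \<le> ennreal (C1 * norm y powr (-3/2))"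
    using nn_integral_riesz_kernel[of "5/2"] by auto
  obtain C2 where C2: "C2 \<ge> 0" "\<And>y::real^3. y \<noteq> 0 \<Longrightarrow>
    (\<integral>\<^sup>+x. ennreal (norm (x - y) powr (-2)) * ennreal (norm x powr (-3/2)) \<partial>lborel)
      \<le> ennreal (C2 * norm y powr (-1/2))"
    using nn_integral_riesz_kernel[of "3/2"] by auto
  have "(\<integral>\<^sup>+x. (\<integral>\<^sup>+y. G y * ennreal (norm (x - y) powr (-2)) \<partial>lborel)\<^sup>2 \<partial>lborel)
      \<le> ennreal (C1 * C2) * (\<integral>\<^sup>+y. (G y)\<^sup>2 * ennreal ((norm y)\<^sup>2) \<partial>lborel)"
    if [measurable]: "G \<in> borel_measurable borel" for G :: "real^3 \<Rightarrow> ennreal"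
  proof -
    have regroup: "(g * a * c) * (b * c) = g * (a * b) * (c * c)" for a b c g :: ennreal
      by (simp only: mult_ac)
    have sq: "(ennreal (norm z powr (5/4)))\<^sup>2 = ennreal (norm z powr (5/2))"
      "(ennreal (norm z powr (-5/4)))\<^sup>2 = ennreal (norm z powr (-5/2))"
      "(ennreal (norm z powr (-1)))\<^sup>2 = ennreal (norm z powr (-2))" for z :: "real^3"
      using ennreal_powr_sq[of "norm z" "5/4"] ennreal_powr_sq[of "norm z" "-5/4"] ennreal_powr_sq[of "norm z" "-1"]
      by simp_all
    let ?k = "\<lambda>x y::real^3. ennreal (norm (x - y) powr (-2))"
    have step: "(\<integral>\<^sup>+y. G y * ?k x y \<partial>lborel)\<^sup>2
        \<le> ennreal C1 * (\<integral>\<^sup>+y. ennreal (norm x powr (-3/2)) * ((G y)\<^sup>2 * ennreal (norm y powr (5/2)) * ?k x y) \<partial>lborel)"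
      if x: "x \<noteq> 0" for x :: "real^3"
    proof -
      \<comment> \<open>Insert |y|^(5/4) |y|^(-5/4) and give half of the kernel to each factor, in
        preparation for Cauchy-Schwarz. The insertion is an identity off y = 0, where
        \<open>powr\<close> would return 0.\<close>
      have split: "(\<integral>\<^sup>+y. G y * ?k x y \<partial>lborel) =
        (\<integral>\<^sup>+y. (G y * ennreal (norm y powr (5/4)) * ennreal (norm (x - y) powr (-1)))
            * (ennreal (norm y powr (-5/4)) * ennreal (norm (x - y) powr (-1))) \<partial>lborel)"
      proof (rule nn_integral_cong_AE)
        show "AE y in lborel. G y * ?k x y = (G y * ennreal (norm y powr (5/4)) * ennreal (norm (x - y) powr (-1)))
            * (ennreal (norm y powr (-5/4)) * ennreal (norm (x - y) powr (-1)))"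
          using AE_lborel_neq[of 0]
        proof eventually_elim
          case (elim y)
          have "ennreal (norm y powr (5/4)) * ennreal (norm y powr (-5/4)) = 1"
            using elim by (subst ennreal_mult[symmetric]) (auto simp: powr_add[symmetric])
          moreover have "ennreal (norm (x - y) powr (-1)) * ennreal (norm (x - y) powr (-1)) = ?k x y"
            using powr_add[of "norm (x - y)" "-1" "-1"] by (subst ennreal_mult[symmetric]) auto
          ultimately show ?case 
            using regroup[of "G y" "ennreal (norm y powr (5/4))" "ennreal (norm (x - y) powr (-1))" "ennreal (norm y powr (-5/4))"]
            by simp
        qed
      qed
      have "(\<integral>\<^sup>+y. G y * ?k x y \<partial>lborel)\<^sup>2 \<le> (\<integral>\<^sup>+y. (G y * ennreal (norm y powr (5/4)) * ennreal (norm (x - y) powr (-1)))\<^sup>2 \<partial>lborel)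
          * (\<integral>\<^sup>+y. (ennreal (norm y powr (-5/4)) * ennreal (norm (x - y) powr (-1)))\<^sup>2 \<partial>lborel)"
        unfolding split by (rule Cauchy_Schwarz_nn_integral) measurable
      also have "\<dots> = (\<integral>\<^sup>+y. (G y)\<^sup>2 * ennreal (norm y powr (5/2)) * ?k x y \<partial>lborel)
          * (\<integral>\<^sup>+y. ennreal (norm (y - x) powr (-2)) * ennreal (norm y powr (-5/2)) \<partial>lborel)"
        by (simp only: power_mult_distrib sq norm_minus_commute[of _ x] mult.commute[of "ennreal (norm _ powr (-5/2))"])
      also have "\<dots> \<le> (\<integral>\<^sup>+y. (G y)\<^sup>2 * ennreal (norm y powr (5/2)) * ?k x y \<partial>lborel) * ennreal (C1 * norm x powr (-3/2))"
        by (intro mult_left_mono C1 x) auto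
      also have "\<dots> = ennreal C1 * (ennreal (norm x powr (-3/2)) * (\<integral>\<^sup>+y. (G y)\<^sup>2 * ennreal (norm y powr (5/2)) * ?k x y \<partial>lborel))"
        using C1 by (subst ennreal_mult) (auto simp: mult_ac)
      also have "(ennreal (norm x powr (-3/2)) * (\<integral>\<^sup>+y. (G y)\<^sup>2 * ennreal (norm y powr (5/2)) * ?k x y \<partial>lborel))
         = (\<integral>\<^sup>+y. ennreal (norm x powr (-3/2)) * ((G y)\<^sup>2 * ennreal (norm y powr (5/2)) * ?k x y) \<partial>lborel)"
        by (rule nn_integral_cmult[symmetric]) measurable
      finally show ?thesis .
    qed
    have "(\<integral>\<^sup>+x. (\<integral>\<^sup>+y. G y * ?k x y \<partial>lborel)\<^sup>2 \<partial>lborel)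
      \<le> (\<integral>\<^sup>+x. ennreal C1 * (\<integral>\<^sup>+y. ennreal (norm x powr (-3/2)) * ((G y)\<^sup>2 * ennreal (norm y powr (5/2)) * ?k x y) \<partial>lborel) \<partial>lborel)"
      by (rule nn_integral_mono_AE, rule eventually_mono[OF AE_lborel_neq[of 0]], rule step)
    also have "\<dots> = ennreal C1 * (\<integral>\<^sup>+x. (\<integral>\<^sup>+y. ennreal (norm x powr (-3/2)) * ((G y)\<^sup>2 * ennreal (norm y powr (5/2)) * ?k x y) \<partial>lborel) \<partial>lborel)"
      by (rule nn_integral_cmult) measurable
    finally have outer: "(\<integral>\<^sup>+x. (\<integral>\<^sup>+y. G y * ?k x y \<partial>lborel)\<^sup>2 \<partial>lborel) \<le> \<dots>" .
    have "(\<integral>\<^sup>+x. (\<integral>\<^sup>+y. ennreal (norm x powr (-3/2)) * ((G y)\<^sup>2 * ennreal (norm y powr (5/2)) * ?k x y) \<partial>lborel) \<partial>lborel)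
      = (\<integral>\<^sup>+y. (\<integral>\<^sup>+x. ennreal (norm x powr (-3/2)) * ((G y)\<^sup>2 * ennreal (norm y powr (5/2)) * ?k x y) \<partial>lborel) \<partial>lborel)"
      by (rule lborel_pair.Fubini'[symmetric]) measurable
    also have "\<dots> \<le> (\<integral>\<^sup>+y. ennreal C2 * ((G y)\<^sup>2 * ennreal ((norm y)\<^sup>2)) \<partial>lborel)"
    proof (rule nn_integral_mono_AE, use AE_lborel_neq[of 0] in eventually_elim)
      case (elim y)
      have "(\<integral>\<^sup>+x. ennreal (norm x powr (-3/2)) * ((G y)\<^sup>2 * ennreal (norm y powr (5/2)) * ?k x y) \<partial>lborel)
        = (\<integral>\<^sup>+x. ((G y)\<^sup>2 * ennreal (norm y powr (5/2))) * (?k x y * ennreal (norm x powr (-3/2))) \<partial>lborel)"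
        by (simp add: mult_ac)
      also have "\<dots> = ((G y)\<^sup>2 * ennreal (norm y powr (5/2))) * (\<integral>\<^sup>+x. ?k x y * ennreal (norm x powr (-3/2)) \<partial>lborel)"
        by (rule nn_integral_cmult) measurable
      also have "\<dots> \<le> ((G y)\<^sup>2 * ennreal (norm y powr (5/2))) * ennreal (C2 * norm y powr (-1/2))"
        by (intro mult_left_mono C2 elim) auto
      also have "\<dots> = (G y)\<^sup>2 * ennreal (norm y powr (5/2) * (C2 * norm y powr (-1/2)))"
        using C2 by (subst (2) ennreal_mult) (auto simp: mult_ac)
      also have "norm y powr (5/2) * (C2 * norm y powr (-1/2)) = C2 * (norm y)\<^sup>2"
        using elim by (simp add: powr_add[symmetric] flip: powr_numeral)
      also have "(G y)\<^sup>2 * ennreal (C2 * (norm y)\<^sup>2) = ennreal C2 * ((G y)\<^sup>2 * ennreal ((norm y)\<^sup>2))"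
        using C2 by (subst ennreal_mult) (auto simp: mult_ac)
      finally show ?case .
    qed
    also have "\<dots> = ennreal C2 * (\<integral>\<^sup>+y. ((G y)\<^sup>2 * ennreal ((norm y)\<^sup>2)) \<partial>lborel)"
      by (rule nn_integral_cmult) measurable
    finally have inner: "(\<integral>\<^sup>+x. (\<integral>\<^sup>+y. ennreal (norm x powr (-3/2)) * ((G y)\<^sup>2 * ennreal (norm y powr (5/2)) * ?k x y) \<partial>lborel) \<partial>lborel)
       \<le> ennreal C2 * (\<integral>\<^sup>+y. ((G y)\<^sup>2 * ennreal ((norm y)\<^sup>2)) \<partial>lborel)" .
    show ?thesis
      unfolding ennreal_mult[OF \<open>C1 \<ge> 0\<close> \<open>C2 \<ge> 0\<close>] mult.assoc
      by (rule order.trans[OF outer mult_left_mono[OF inner]]) simp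
  qed
  then show ?thesis using C1 C2 by (intro exI[of _ "C1 * C2"]) auto
qed

text \<open>With K = S^2, one factor \<open>S\<close> goes to each side of Cauchy-Schwarz;
  integrating in \<open>x\<close> and using reflection invariance produces the mass of
  \<open>K\<close> a second time.\<close>

lemma young_nn_integral:
  fixes K U :: "real^3 \<Rightarrow> ennreal"
  assumes [measurable]: "K \<in> borel_measurable borel" "U \<in> borel_measurable borel"
  shows "(\<integral>\<^sup>+x. (\<integral>\<^sup>+y. K (y - x) * U y \<partial>lborel)\<^sup>2 \<partial>lborel)
      \<le> (\<integral>\<^sup>+z. K z \<partial>lborel)\<^sup>2 * (\<integral>\<^sup>+y. (U y)\<^sup>2 \<partial>lborel)"
proof -
  have ex: "\<exists>S :: real^3 \<Rightarrow> ennreal. S \<in> borel_measurable borel \<and> (\<forall>z. (S z)\<^sup>2 = K z)"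
  proof (intro exI[of _ "\<lambda>z. if K z = top then top else ennreal (sqrt (enn2real (K z)))"] conjI allI)
    fix z show "(if K z = top then top else ennreal (sqrt (enn2real (K z))))\<^sup>2 = K z"
      by (cases "K z") (auto simp: ennreal_power ennreal_top_mult power2_eq_square simp flip: ennreal_mult)
  qed measurable
  then obtain S where S[measurable]: "S \<in> borel_measurable borel" and S2: "\<And>z. (S z)\<^sup>2 = K z" by blast
  have "(\<integral>\<^sup>+y. K (y - x) * U y \<partial>lborel)\<^sup>2 \<le> (\<integral>\<^sup>+z. K z \<partial>lborel) * (\<integral>\<^sup>+y. K (y - x) * (U y)\<^sup>2 \<partial>lborel)" for x
  proof -
    have "(\<integral>\<^sup>+y. K (y - x) * U y \<partial>lborel)\<^sup>2 = (\<integral>\<^sup>+y. S (y - x) * (S (y - x) * U y) \<partial>lborel)\<^sup>2"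
      by (simp add: S2[symmetric] power2_eq_square mult.assoc)
    also have "\<dots> \<le> (\<integral>\<^sup>+y. (S (y - x))\<^sup>2 \<partial>lborel) * (\<integral>\<^sup>+y. (S (y - x) * U y)\<^sup>2 \<partial>lborel)"
      by (rule Cauchy_Schwarz_nn_integral) measurable
    also have "\<dots> = (\<integral>\<^sup>+y. K (y - x) \<partial>lborel) * (\<integral>\<^sup>+y. K (y - x) * (U y)\<^sup>2 \<partial>lborel)"
      by (simp add: S2 power_mult_distrib)
    also have "(\<integral>\<^sup>+y. K (y - x) \<partial>lborel) = (\<integral>\<^sup>+z. K z \<partial>lborel)"
      by (rule nn_integral_shift) measurable
    finally show ?thesis .
  qed
  then have "(\<integral>\<^sup>+x. (\<integral>\<^sup>+y. K (y - x) * U y \<partial>lborel)\<^sup>2 \<partial>lborel)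
    \<le> (\<integral>\<^sup>+x. (\<integral>\<^sup>+z. K z \<partial>lborel) * (\<integral>\<^sup>+y. K (y - x) * (U y)\<^sup>2 \<partial>lborel) \<partial>lborel)"
    by (intro nn_integral_mono)
  also have "\<dots> = (\<integral>\<^sup>+z. K z \<partial>lborel) * (\<integral>\<^sup>+x. (\<integral>\<^sup>+y. K (y - x) * (U y)\<^sup>2 \<partial>lborel) \<partial>lborel)"
    by (rule nn_integral_cmult) measurable
  also have "(\<integral>\<^sup>+x. (\<integral>\<^sup>+y. K (y - x) * (U y)\<^sup>2 \<partial>lborel) \<partial>lborel)
     = (\<integral>\<^sup>+y. (\<integral>\<^sup>+x. K (y - x) * (U y)\<^sup>2 \<partial>lborel) \<partial>lborel)"
    by (rule lborel_pair.Fubini'[symmetric]) measurable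
  also have "\<dots> = (\<integral>\<^sup>+y. (\<integral>\<^sup>+z. K z \<partial>lborel) * (U y)\<^sup>2 \<partial>lborel)"
    by (simp add: nn_integral_multc nn_integral_reflect)
  also have "\<dots> = (\<integral>\<^sup>+z. K z \<partial>lborel) * (\<integral>\<^sup>+y. (U y)\<^sup>2 \<partial>lborel)"
    by (rule nn_integral_cmult) measurable
  finally show ?thesis by (simp add: power2_eq_square mult.assoc)
qed

subsection \<open>Square-integrable functions and mollification\<close>

text \<open>Kept squared and in \<open>ennreal\<close>: for measurable functions finiteness is
  membership in L^2, and no root of a norm has to be taken.\<close>

definition sqnorm :: "(real^3 \<Rightarrow> complex) \<Rightarrow> ennreal" where
  "sqnorm u = (\<integral>\<^sup>+x. ennreal ((cmod (u x))\<^sup>2) \<partial>lborel)"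

text \<open>Convolution with the reflected kernel. The argument \<open>y - x\<close> makes the
  kernel, as a function of \<open>y\<close>, the translate of \<open>k\<close> to the point
  \<open>x\<close>, that is, the test function to be inserted into the weak equation.\<close>

definition corr :: "(real^3 \<Rightarrow> complex) \<Rightarrow> (real^3 \<Rightarrow> complex) \<Rightarrow> real^3 \<Rightarrow> complex" where
  "corr k u x = (LINT y|lborel. k (y - x) * u y)"

lemma corr_measurable [measurable]:
  assumes [measurable]: "k \<in> borel_measurable borel" "u \<in> borel_measurable borel"
  shows "corr k u \<in> borel_measurable borel"
  unfolding corr_def[abs_def] by measurable

text \<open>Stands in for the triangle inequality when norms are kept squared.\<close>

lemma norm_add_sq_le: "(norm (a + b))\<^sup>2 \<le> 2 * (norm a)\<^sup>2 + 2 * (norm (b::'a::real_normed_vector))\<^sup>2"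
proof -
  have "(norm (a + b))\<^sup>2 \<le> (norm a + norm b)\<^sup>2" by (intro power_mono norm_triangle_ineq) auto
  also have "\<dots> \<le> 2 * (norm a)\<^sup>2 + 2 * (norm b)\<^sup>2"
    using sum_squares_bound[of "norm a" "norm b"] by (simp add: power2_sum)
  finally show ?thesis .
qed

lemma sqnorm_add:
  assumes [measurable]: "u \<in> borel_measurable borel" "v \<in> borel_measurable borel"
  shows "sqnorm (\<lambda>x. u x + v x) \<le> 2 * sqnorm u + 2 * sqnorm v"
proof -
  have "sqnorm (\<lambda>x. u x + v x) \<le> (\<integral>\<^sup>+x. 2 * ennreal ((cmod (u x))\<^sup>2) + 2 * ennreal ((cmod (v x))\<^sup>2) \<partial>lborel)"
    unfolding sqnorm_def
  proof (rule nn_integral_mono)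
    fix x
    have "ennreal ((cmod (u x + v x))\<^sup>2) \<le> ennreal (2 * (cmod (u x))\<^sup>2 + 2 * (cmod (v x))\<^sup>2)"
      by (intro ennreal_leI norm_add_sq_le)
    also have "\<dots> = 2 * ennreal ((cmod (u x))\<^sup>2) + 2 * ennreal ((cmod (v x))\<^sup>2)"
      by (simp add: ennreal_mult)
    finally show "ennreal ((cmod (u x + v x))\<^sup>2) \<le> 2 * ennreal ((cmod (u x))\<^sup>2) + 2 * ennreal ((cmod (v x))\<^sup>2)" .
  qed
  also have "\<dots> = 2 * sqnorm u + 2 * sqnorm v"
    unfolding sqnorm_def by (simp add: nn_integral_add nn_integral_cmult)
  finally show ?thesis .
qed

lemma sqnorm_minus_commute: "sqnorm (\<lambda>x. u x - v x) = sqnorm (\<lambda>x. v x - u x)"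
  by (simp add: sqnorm_def norm_minus_commute)

lemma sqnorm_diff_triangle:
  assumes [measurable]: "u \<in> borel_measurable borel" "v \<in> borel_measurable borel" "w \<in> borel_measurable borel"
  shows "sqnorm (\<lambda>x. u x - w x) \<le> 2 * sqnorm (\<lambda>x. u x - v x) + 2 * sqnorm (\<lambda>x. v x - w x)"
  using sqnorm_add[of "\<lambda>x. u x - v x" "\<lambda>x. v x - w x"] by simp

lemma sqnorm_cmult:
  assumes [measurable]: "u \<in> borel_measurable borel"
  shows "sqnorm (\<lambda>x. c * u x) = ennreal ((cmod c)\<^sup>2) * sqnorm u"
  unfolding sqnorm_def by (simp add: norm_mult power_mult_distrib ennreal_mult nn_integral_cmult)

lemma sqnorm_mono: "(\<And>x. cmod (u x) \<le> cmod (v x)) \<Longrightarrow> sqnorm u \<le> sqnorm v"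
  unfolding sqnorm_def by (intro nn_integral_mono ennreal_leI power_mono) auto

text \<open>A non-integrable function has Bochner integral 0, so the bound needs no case distinction
  by its users.\<close>

lemma norm_integral_le_nn_integral:
  fixes f :: "'a \<Rightarrow> 'b::{banach, second_countable_topology}"
  shows "ennreal (norm (integral\<^sup>L M f)) \<le> (\<integral>\<^sup>+x. ennreal (norm (f x)) \<partial>M)"
  using integral_norm_bound_ennreal[of M f] not_integrable_integral_eq[of M f]
  by (cases "integrable M f") auto

lemma norm_corr_le:
  "ennreal (cmod (corr k u x)) \<le> (\<integral>\<^sup>+y. ennreal (cmod (k (y - x))) * ennreal (cmod (u y)) \<partial>lborel)"
  using norm_integral_le_nn_integral[of lborel "\<lambda>y. k (y - x) * u y"]
  by (simp add: corr_def norm_mult ennreal_mult)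

lemma sqnorm_corr_le:
  assumes [measurable]: "k \<in> borel_measurable borel" "u \<in> borel_measurable borel"
  shows "sqnorm (corr k u) \<le> (\<integral>\<^sup>+z. ennreal (cmod (k z)) \<partial>lborel)\<^sup>2 * sqnorm u"
proof -
  have "sqnorm (corr k u) \<le> (\<integral>\<^sup>+x. (\<integral>\<^sup>+y. ennreal (cmod (k (y - x))) * ennreal (cmod (u y)) \<partial>lborel)\<^sup>2 \<partial>lborel)"
    unfolding sqnorm_def
  proof (rule nn_integral_mono)
    fix x
    have "ennreal ((cmod (corr k u x))\<^sup>2) = (ennreal (cmod (corr k u x)))\<^sup>2" by (simp add: ennreal_power)
    also have "\<dots> \<le> (\<integral>\<^sup>+y. ennreal (cmod (k (y - x))) * ennreal (cmod (u y)) \<partial>lborel)\<^sup>2"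
      by (intro power_mono norm_corr_le) auto
    finally show "ennreal ((cmod (corr k u x))\<^sup>2) \<le> (\<integral>\<^sup>+y. ennreal (cmod (k (y - x))) * ennreal (cmod (u y)) \<partial>lborel)\<^sup>2" .
  qed
  also have "\<dots> \<le> (\<integral>\<^sup>+z. ennreal (cmod (k z)) \<partial>lborel)\<^sup>2 * (\<integral>\<^sup>+y. (ennreal (cmod (u y)))\<^sup>2 \<partial>lborel)"
    by (rule young_nn_integral) measurable
  also have "(\<integral>\<^sup>+y. (ennreal (cmod (u y)))\<^sup>2 \<partial>lborel) = sqnorm u"
    by (simp add: sqnorm_def ennreal_power)
  finally show ?thesis .
qed

lemma integrable_mult_sqnorm:
  assumes [measurable]: "u \<in> borel_measurable borel" "v \<in> borel_measurable borel"
    and fin: "sqnorm u < \<infinity>" "sqnorm v < \<infinity>"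
  shows "integrable lborel (\<lambda>x. u x * v x)"
proof (rule Bochner_Integration.integrable_bound)
  have "integrable lborel (\<lambda>x. (cmod (u x))\<^sup>2)" "integrable lborel (\<lambda>x. (cmod (v x))\<^sup>2)"
    using fin by (auto simp: integrable_iff_bounded sqnorm_def)
  then show "integrable lborel (\<lambda>x. (cmod (u x))\<^sup>2 + (cmod (v x))\<^sup>2)" by auto
  show "AE x in lborel. norm (u x * v x) \<le> norm ((cmod (u x))\<^sup>2 + (cmod (v x))\<^sup>2)"
  proof (rule AE_I2)
    fix x
    have "2 * (cmod (u x) * cmod (v x)) \<le> (cmod (u x))\<^sup>2 + (cmod (v x))\<^sup>2"
      using sum_squares_bound[of "cmod (u x)" "cmod (v x)"] by simp
    moreover have "0 \<le> cmod (u x) * cmod (v x)" by simp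
    ultimately have "cmod (u x) * cmod (v x) \<le> (cmod (u x))\<^sup>2 + (cmod (v x))\<^sup>2" by linarith
    then show "norm (u x * v x) \<le> norm ((cmod (u x))\<^sup>2 + (cmod (v x))\<^sup>2)"
      by (simp add: norm_mult)
  qed
qed measurable

lemma sqnorm_integrable_mult_le:
  assumes [measurable]: "u \<in> borel_measurable borel" "v \<in> borel_measurable borel"
  shows "ennreal ((cmod (LINT x|lborel. u x * v x))\<^sup>2) \<le> sqnorm u * sqnorm v"
proof -
  have "ennreal ((cmod (LINT x|lborel. u x * v x))\<^sup>2) = (ennreal (cmod (LINT x|lborel. u x * v x)))\<^sup>2"
    by (simp add: ennreal_power)
  also have "\<dots> \<le> (\<integral>\<^sup>+x. ennreal (cmod (u x * v x)) \<partial>lborel)\<^sup>2"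
    by (intro power_mono norm_integral_le_nn_integral) auto
  also have "\<dots> = (\<integral>\<^sup>+x. ennreal (cmod (u x)) * ennreal (cmod (v x)) \<partial>lborel)\<^sup>2"
    by (simp add: norm_mult ennreal_mult)
  also have "\<dots> \<le> (\<integral>\<^sup>+x. (ennreal (cmod (u x)))\<^sup>2 \<partial>lborel) * (\<integral>\<^sup>+x. (ennreal (cmod (v x)))\<^sup>2 \<partial>lborel)"
    by (rule Cauchy_Schwarz_nn_integral) measurable
  also have "\<dots> = sqnorm u * sqnorm v" by (simp add: sqnorm_def ennreal_power)
  finally show ?thesis .
qed

section \<open>Density, translations and completeness in L^2\<close>

text \<open>First \<open>u\<close> is truncated both in value and in space; then the truncated
  function is approximated by applying the same truncations to continuous functions converging to
  \<open>u\<close> almost everywhere. The truncations supply the dominating function in both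
  limits.\<close>

lemma sqnorm_Cc_dense:
  assumes u[measurable]: "u \<in> borel_measurable borel" and fin: "sqnorm u < \<infinity>" and e: "e > 0"
  shows "\<exists>v R. continuous_on UNIV v \<and> (\<forall>x. norm x \<ge> R \<longrightarrow> v x = 0) \<and> sqnorm (\<lambda>x. u x - v x) \<le> ennreal e"
proof -
  \<comment> \<open>\<open>T m\<close> is the continuous radial projection of the plane onto the
    disc of radius \<open>m\<close>; \<open>h m\<close> below is a continuous spatial cutoff, equal
    to 1 for norm at most \<open>m\<close> and 0 from \<open>m + 1\<close> on.\<close>
  define T where "T = (\<lambda>m z. of_real (m / max m (cmod z)) * z :: complex)"
  define h where "h = (\<lambda>m (x::real^3). max 0 (min 1 (m + 1 - norm x)))"
  have T_le: "cmod (T m z) \<le> cmod z" "cmod (T m z) \<le> m" if "m > 0" for m z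
  proof -
    have "cmod (T m z) = m / max m (cmod z) * cmod z"
      using that by (simp add: T_def norm_mult norm_divide abs_of_pos max.strict_coboundedI1)
    then show "cmod (T m z) \<le> cmod z" "cmod (T m z) \<le> m"
      using that by (auto simp: max_def field_simps intro: mult_right_mono)
  qed
  have T_id: "T m z = z" if "m > 0" "cmod z \<le> m" for m z
    using that by (simp add: T_def max_absorb1)
  have T_cont: "continuous_on UNIV (T m)" if "m > 0" for m
    unfolding T_def using that by (intro continuous_intros) (auto simp: max_def)
  have T_meas[measurable]: "T m \<in> borel_measurable borel" if "m > 0" for m
    using T_cont[OF that] by (rule borel_measurable_continuous_onI)
  have h_cont: "continuous_on UNIV (h m)" for m unfolding h_def by (intro continuous_intros)
  have h_meas[measurable]: "h m \<in> borel_measurable borel" for m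
    using h_cont by (rule borel_measurable_continuous_onI)
  have h01: "0 \<le> h m x" "h m x \<le> 1" for m x by (auto simp: h_def)
  have h0: "h m x = 0" if "norm x \<ge> m + 1" for m x using that by (auto simp: h_def)
  let ?v = "\<lambda>m x. of_real (h (real (Suc m)) x) * T (real (Suc m)) (u x)"
  have "(\<lambda>m. \<integral>\<^sup>+x. ennreal ((cmod (u x - ?v m x))\<^sup>2) \<partial>lborel) \<longlonglongrightarrow> (\<integral>\<^sup>+x. 0 \<partial>(lborel :: (real^3) measure))"
  proof (rule nn_integral_dominated_convergence[where w="\<lambda>x. 4 * ennreal ((cmod (u x))\<^sup>2)"])
    show "(\<integral>\<^sup>+x. 4 * ennreal ((cmod (u x))\<^sup>2) \<partial>lborel) < \<infinity>"
      using fin by (subst nn_integral_cmult) (auto simp: sqnorm_def ennreal_mult_less_top)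
    show "AE x in lborel. ennreal ((cmod (u x - ?v m x))\<^sup>2) \<le> 4 * ennreal ((cmod (u x))\<^sup>2)" for m
    proof (rule AE_I2)
      fix x
      have "cmod (?v m x) \<le> 1 * cmod (u x)"
        unfolding norm_mult using T_le[of "real (Suc m)"] h01 by (intro mult_mono) auto
      then have "cmod (u x - ?v m x) \<le> 2 * cmod (u x)"
        using norm_triangle_ineq4[of "u x" "?v m x"] by simp
      then have "(cmod (u x - ?v m x))\<^sup>2 \<le> (2 * cmod (u x))\<^sup>2" by (intro power_mono) auto
      then have "ennreal ((cmod (u x - ?v m x))\<^sup>2) \<le> ennreal (4 * (cmod (u x))\<^sup>2)"
        by (intro ennreal_leI) (simp add: power_mult_distrib)
      then show "ennreal ((cmod (u x - ?v m x))\<^sup>2) \<le> 4 * ennreal ((cmod (u x))\<^sup>2)"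
        by (simp add: ennreal_mult)
    qed
    show "AE x in lborel. (\<lambda>m. ennreal ((cmod (u x - ?v m x))\<^sup>2)) \<longlonglongrightarrow> 0"
    proof (rule AE_I2)
      fix x
      obtain M :: nat where M: "norm x + cmod (u x) \<le> real M" using real_arch_simple by blast
      have "ennreal ((cmod (u x - ?v m x))\<^sup>2) = 0" if "m \<ge> M" for m
      proof -
        have "real M \<le> real m" using that by simp
        then have "norm x \<le> real (Suc m)" "cmod (u x) \<le> real (Suc m)"
          using M norm_ge_zero[of x] norm_ge_zero[of "u x"] by linarith+
        then have "h (real (Suc m)) x = 1" "T (real (Suc m)) (u x) = u x"
          using T_id[of "real (Suc m)"] by (auto simp: h_def)
        then show ?thesis by simp
      qed
      then have "eventually (\<lambda>m. ennreal ((cmod (u x - ?v m x))\<^sup>2) = 0) sequentially"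
        by (auto simp: eventually_sequentially)
      then show "(\<lambda>m. ennreal ((cmod (u x - ?v m x))\<^sup>2)) \<longlonglongrightarrow> 0" by (rule tendsto_eventually)
    qed
  qed measurable
  then have "(\<lambda>m. sqnorm (\<lambda>x. u x - ?v m x)) \<longlonglongrightarrow> 0" by (simp add: sqnorm_def)
  then have "eventually (\<lambda>m. sqnorm (\<lambda>x. u x - ?v m x) < ennreal (e/4)) sequentially"
    using e by (intro order_tendstoD) auto
  then obtain m where m: "sqnorm (\<lambda>x. u x - ?v m x) < ennreal (e/4)"
    by (auto simp: eventually_sequentially)
  \<comment> \<open>Measurability in the form \<open>measurable_on\<close> provides continuous
    functions \<open>g n\<close> that converge to \<open>u\<close> off a negligible set; nothing is
    known about their size, hence the truncation in \<open>?w\<close>.\<close>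
  have "u \<in> borel_measurable lebesgue" using u by (simp add: measurable_completion)
  then have "u measurable_on UNIV" by (rule lebesgue_measurable_imp_measurable_on) simp
  then obtain N g where N: "negligible N" and g: "\<And>n. continuous_on UNIV (g n)"
    and lim: "\<And>x. x \<notin> N \<Longrightarrow> (\<lambda>n. g n x) \<longlonglongrightarrow> u x"
    unfolding measurable_on_def by auto
  have [measurable]: "g n \<in> borel_measurable borel" for n using g by (rule borel_measurable_continuous_onI)
  let ?w = "\<lambda>n x. of_real (h (real (Suc m)) x) * T (real (Suc m)) (g n x)"
  have w_cont: "continuous_on UNIV (?w n)" for n
  proof -
    have "continuous_on UNIV (\<lambda>x. T (real (Suc m)) (g n x))"
      by (rule continuous_on_compose2[OF T_cont g]) auto
    then show ?thesis by (intro continuous_on_mult continuous_on_of_real h_cont)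
  qed
  have [measurable]: "ball (0::real^3) R \<in> sets borel" for R by simp
  have "(\<lambda>n. \<integral>\<^sup>+x. ennreal ((cmod (?v m x - ?w n x))\<^sup>2) \<partial>lborel) \<longlonglongrightarrow> (\<integral>\<^sup>+x. 0 \<partial>(lborel :: (real^3) measure))"
  proof (rule nn_integral_dominated_convergence[where w="\<lambda>x. ennreal ((2 * real (Suc m))\<^sup>2) * indicator (ball 0 (real m + 2)) x"])
    show "(\<integral>\<^sup>+x. ennreal ((2 * real (Suc m))\<^sup>2) * indicator (ball (0::real^3) (real m + 2)) x \<partial>lborel) < \<infinity>"
      by (subst nn_integral_cmult_indicator) (auto simp: emeasure_ball3 ennreal_mult_less_top)
    show "AE x in lborel. ennreal ((cmod (?v m x - ?w n x))\<^sup>2) \<le> ennreal ((2 * real (Suc m))\<^sup>2) * indicator (ball 0 (real m + 2)) x" for n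
    proof (rule AE_I2)
      fix x :: "real^3"
      show "ennreal ((cmod (?v m x - ?w n x))\<^sup>2) \<le> ennreal ((2 * real (Suc m))\<^sup>2) * indicator (ball 0 (real m + 2)) x"
      proof (cases "norm x < real m + 2")
        case True
        have "cmod (?v m x) \<le> 1 * real (Suc m)" "cmod (?w n x) \<le> 1 * real (Suc m)"
          unfolding norm_mult using T_le[of "real (Suc m)"] h01 by (intro mult_mono; auto)+
        then have "cmod (?v m x - ?w n x) \<le> 2 * real (Suc m)"
          using norm_triangle_ineq4[of "?v m x" "?w n x"] by linarith
        then show ?thesis using True by (auto intro!: ennreal_leI power_mono)
      next
        case False
        then have "h (real (Suc m)) x = 0" by (intro h0) auto
        then show ?thesis by simp
      qed
    qed
    have "AE x in lebesgue. x \<notin> N"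
      using N by (intro AE_not_in) (simp add: negligible_iff_null_sets)
    then have "AE x in lborel. x \<notin> N" by (simp add: AE_completion_iff)
    then show "AE x in lborel. (\<lambda>n. ennreal ((cmod (?v m x - ?w n x))\<^sup>2)) \<longlonglongrightarrow> 0"
    proof eventually_elim
      case (elim x)
      have "isCont (T (real (Suc m))) (u x)" using T_cont[of "real (Suc m)"] by (simp add: continuous_on_eq_continuous_at)
      from isCont_tendsto_compose[OF this lim[OF elim]]
      have "(\<lambda>n. ?w n x) \<longlonglongrightarrow> ?v m x" by (intro tendsto_intros)
      then have "(\<lambda>n. (cmod (?v m x - ?w n x))\<^sup>2) \<longlonglongrightarrow> (cmod (?v m x - ?v m x))\<^sup>2"
        by (intro tendsto_power tendsto_norm tendsto_diff tendsto_const)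
      from tendsto_ennrealI[OF this] show ?case by simp
    qed
  qed auto
  then have "(\<lambda>n. sqnorm (\<lambda>x. ?v m x - ?w n x)) \<longlonglongrightarrow> 0" by (simp add: sqnorm_def)
  then have "eventually (\<lambda>n. sqnorm (\<lambda>x. ?v m x - ?w n x) < ennreal (e/4)) sequentially"
    using e by (intro order_tendstoD) auto
  then obtain n where n: "sqnorm (\<lambda>x. ?v m x - ?w n x) < ennreal (e/4)"
    by (auto simp: eventually_sequentially)
  have "sqnorm (\<lambda>x. u x - ?w n x) \<le> 2 * sqnorm (\<lambda>x. u x - ?v m x) + 2 * sqnorm (\<lambda>x. ?v m x - ?w n x)"
    by (rule sqnorm_diff_triangle) measurable
  also have "\<dots> \<le> 2 * ennreal (e/4) + 2 * ennreal (e/4)"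
    using m n by (intro add_mono mult_left_mono) auto
  also have "\<dots> = ennreal (e/2) + ennreal (e/2)" using e ennreal_mult[of 2 "e/4"] by simp
  also have "\<dots> = ennreal e" using e ennreal_plus[of "e/2" "e/2"] by simp
  finally show ?thesis using w_cont[of n] h0 by (intro exI[of _ "?w n"] exI[of _ "real (Suc m) + 1"]) auto
qed

definition modulus :: "(real^3 \<Rightarrow> complex) \<Rightarrow> real^3 \<Rightarrow> ennreal" where
  "modulus u z = sqnorm (\<lambda>x. u (x + z) - u x)"

lemma sqnorm_shift:
  assumes [measurable]: "u \<in> borel_measurable borel"
  shows "sqnorm (\<lambda>x. u (x + z)) = sqnorm u"
  using nn_integral_shift[of "\<lambda>x. ennreal ((cmod (u x))\<^sup>2)" "-z"] by (simp add: sqnorm_def)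

lemma modulus_le:
  assumes [measurable]: "u \<in> borel_measurable borel"
  shows "modulus u z \<le> 4 * sqnorm u"
proof -
  have "modulus u z \<le> 2 * sqnorm (\<lambda>x. u (x + z)) + 2 * sqnorm (\<lambda>x. - u x)"
    unfolding modulus_def using sqnorm_add[of "\<lambda>x. u (x + z)" "\<lambda>x. - u x"] by simp
  also have "sqnorm (\<lambda>x. - u x) = sqnorm u" by (simp add: sqnorm_def)
  finally show ?thesis by (simp add: sqnorm_shift distrib_right[symmetric])
qed

lemma modulus_measurable [measurable]:
  assumes [measurable]: "u \<in> borel_measurable borel"
  shows "modulus u \<in> borel_measurable borel"
  unfolding modulus_def[abs_def] sqnorm_def by measurable

text \<open>Translation is continuous on continuous functions of compact support, by uniform
  continuity, and this passes to \<open>u\<close> by density because translation preserves the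
  norm.\<close>

lemma modulus_tendsto_0:
  assumes [measurable]: "u \<in> borel_measurable borel" and fin: "sqnorm u < \<infinity>" and e: "e > 0"
  shows "\<exists>d>0. \<forall>z. norm z < d \<longrightarrow> modulus u z \<le> ennreal e"
proof -
  obtain v R where v: "continuous_on UNIV v" "\<And>x. norm x \<ge> R \<Longrightarrow> v x = 0"
     and uv: "sqnorm (\<lambda>x. u x - v x) \<le> ennreal (e / 16)"
    using sqnorm_Cc_dense[OF assms(1) fin, of "e/16"] e by auto
  have [measurable]: "v \<in> borel_measurable borel" using v(1) by (rule borel_measurable_continuous_onI)
  \<comment> \<open>The margin 2 ensures that for norm z < 1 both \<open>x\<close> and
    \<open>x + z\<close> lie outside the support of \<open>v\<close> as soon as norm x >= B.\<close>
  define B where "B = max R 0 + 2"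
  define V where "V = unit_ball_vol 3 * B^3"
  have B: "B > 0" "B \<ge> R + 2" by (auto simp: B_def)
  have V: "V > 0" using B by (simp add: V_def)
  \<comment> \<open>Chosen so that q^2 V = e / 8. With the errors e / 16 of the two approximations,
    the final sum is 7 e / 8.\<close>
  define q where "q = sqrt (e / (8 * V))"
  have q: "q > 0" using e V by (simp add: q_def)
  have "uniformly_continuous_on (cball 0 (B + 2)) v"
    by (rule compact_uniformly_continuous[OF continuous_on_subset[OF v(1)]]) auto
  from this[unfolded uniformly_continuous_on_def, rule_format, OF q]
  obtain d where d: "d > 0" "\<And>x x'. x \<in> cball 0 (B + 2) \<Longrightarrow> x' \<in> cball 0 (B + 2) \<Longrightarrow> dist x' x < d \<Longrightarrow> dist (v x') (v x) < q"
    by metis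
  have "modulus u z \<le> ennreal e" if z: "norm z < min d 1" for z
  proof -
    have "sqnorm (\<lambda>x. v (x + z) - v x) \<le> (\<integral>\<^sup>+x. ennreal (q\<^sup>2) * indicator (ball (0::real^3) B) x \<partial>lborel)"
      unfolding sqnorm_def
    proof (rule nn_integral_mono)
      fix x :: "real^3"
      show "ennreal ((cmod (v (x + z) - v x))\<^sup>2) \<le> ennreal (q\<^sup>2) * indicator (ball 0 B) x"
      proof (cases "norm x < B")
        case True
        have "norm (x + z) \<le> B + 2" using norm_triangle_ineq[of x z] True z by simp
        then have "dist (v (x + z)) (v x) < q"
          using True z mem_cball_0[of x "B + 2"] mem_cball_0[of "x + z" "B + 2"]
          by (intro d(2)) (simp_all add: dist_norm del: mem_cball)
        then show ?thesis using True q by (auto simp: dist_norm intro!: ennreal_leI power_mono)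
      next
        case False
        then have "norm (x + z) \<ge> R" using norm_triangle_ineq4[of "x + z" z] z B by simp
        then show ?thesis using False B v(2)[of x] v(2)[of "x + z"] by simp
      qed
    qed
    also have "\<dots> = ennreal (q\<^sup>2) * ennreal V"
      using B by (subst nn_integral_cmult_indicator) (auto simp: emeasure_ball3 V_def)
    also have "\<dots> = ennreal (e / 8)"
      using V e by (subst ennreal_mult[symmetric]) (auto simp: q_def)
    finally have 1: "sqnorm (\<lambda>x. v (x + z) - v x) \<le> ennreal (e / 8)" .
    have 2: "sqnorm (\<lambda>x. u (x + z) - v (x + z)) \<le> ennreal (e / 16)"
      using uv sqnorm_shift[of "\<lambda>x. u x - v x" z] by simp
    have 3: "sqnorm (\<lambda>x. v x - u x) \<le> ennreal (e / 16)"
      using uv sqnorm_minus_commute[of u v] by simp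
    have tri: "sqnorm (\<lambda>x. u (x + z) - v x) \<le> 2 * sqnorm (\<lambda>x. u (x + z) - v (x + z)) + 2 * sqnorm (\<lambda>x. v (x + z) - v x)"
      by (rule sqnorm_diff_triangle) measurable
    have "modulus u z \<le> 2 * sqnorm (\<lambda>x. u (x + z) - v x) + 2 * sqnorm (\<lambda>x. v x - u x)"
      unfolding modulus_def by (rule sqnorm_diff_triangle) measurable
    also have "\<dots> \<le> 2 * (2 * sqnorm (\<lambda>x. u (x + z) - v (x + z)) + 2 * sqnorm (\<lambda>x. v (x + z) - v x)) + 2 * sqnorm (\<lambda>x. v x - u x)"
      using tri by (intro add_mono mult_left_mono) auto
    also have "\<dots> \<le> 2 * (2 * ennreal (e / 16) + 2 * ennreal (e / 8)) + 2 * ennreal (e / 16)"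
      using 1 2 3 by (intro add_mono mult_left_mono) auto
    also have "\<dots> = ennreal (2 * (2 * (e / 16) + 2 * (e / 8)) + 2 * (e / 16))"
      using e unfolding ennreal_numeral[symmetric]
      by (simp only: ennreal_mult[symmetric] ennreal_plus[symmetric] zero_le_numeral divide_nonneg_nonneg
        mult_nonneg_nonneg add_nonneg_nonneg less_imp_le)
    also have "\<dots> \<le> ennreal e" using e by (intro ennreal_leI) simp
    finally show ?thesis .
  qed
  then show ?thesis using d(1) by (intro exI[of _ "min d 1"]) auto
qed

text \<open>The difference is an average of u(x + z) - u(x) against \<open>k\<close>. Cauchy-Schwarz
  with respect to the measure with density |k| takes the role of Minkowski's integral inequality,
  and Fubini turns the inner integral into \<open>modulus\<close>.\<close>

lemma sqnorm_corr_diff_le: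
  assumes [measurable]: "u \<in> borel_measurable borel" and k: "integrable lborel k"
  shows "sqnorm (\<lambda>x. corr k u x - (LINT z|lborel. k z) * u x)
    \<le> (\<integral>\<^sup>+z. ennreal (cmod (k z)) \<partial>lborel) * (\<integral>\<^sup>+z. ennreal (cmod (k z)) * modulus u z \<partial>lborel)"
proof -
  have km[measurable]: "k \<in> borel_measurable borel" using borel_measurable_integrable[OF k] by simp
  define S where "S = (\<lambda>z. ennreal (sqrt (cmod (k z))))"
  have [measurable]: "S \<in> borel_measurable borel" unfolding S_def by measurable
  have S2: "(S z)\<^sup>2 = ennreal (cmod (k z))" for z by (simp add: S_def ennreal_power)
  have pw: "ennreal (cmod (corr k u x - (LINT z|lborel. k z) * u x))
      \<le> (\<integral>\<^sup>+z. ennreal (cmod (k z)) * ennreal (cmod (u (x + z) - u x)) \<partial>lborel)" for x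
  proof -
    have c: "corr k u x = (LINT z|lborel. k z * u (x + z))"
      using integral_shift[of "\<lambda>z. k z * u (x + z)" x] by (simp add: corr_def)
    have kc: "integrable lborel (\<lambda>z. k z * u x)" using k by simp
    show ?thesis
    proof (cases "integrable lborel (\<lambda>z. k z * u (x + z))")
      case True
      have "corr k u x - (LINT z|lborel. k z) * u x = (LINT z|lborel. k z * u (x + z)) - (LINT z|lborel. k z * u x)"
        by (simp add: c)
      also have "\<dots> = (LINT z|lborel. k z * (u (x + z) - u x))"
        using True kc by (simp add: right_diff_distrib)
      finally show ?thesis
        using norm_integral_le_nn_integral[of lborel "\<lambda>z. k z * (u (x + z) - u x)"]
        by (simp add: norm_mult ennreal_mult)
    next
      \<comment> \<open>Without integrability the left side has only a default value, but the right
        side is infinite.\<close>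
      case False
      have "\<not> integrable lborel (\<lambda>z. k z * (u (x + z) - u x))"
      proof
        assume "integrable lborel (\<lambda>z. k z * (u (x + z) - u x))"
        from Bochner_Integration.integrable_add[OF this kc] False show False by (simp add: algebra_simps)
      qed
      then have "(\<integral>\<^sup>+z. ennreal (cmod (k z)) * ennreal (cmod (u (x + z) - u x)) \<partial>lborel) = \<infinity>"
        by (simp add: integrable_iff_bounded norm_mult ennreal_mult not_less top_unique)
      then show ?thesis by simp
    qed
  qed
  have sq: "ennreal ((cmod (corr k u x - (LINT z|lborel. k z) * u x))\<^sup>2)
      \<le> (\<integral>\<^sup>+z. ennreal (cmod (k z)) \<partial>lborel) * (\<integral>\<^sup>+z. ennreal (cmod (k z)) * ennreal ((cmod (u (x + z) - u x))\<^sup>2) \<partial>lborel)" for x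
  proof -
    have "ennreal ((cmod (corr k u x - (LINT z|lborel. k z) * u x))\<^sup>2) = (ennreal (cmod (corr k u x - (LINT z|lborel. k z) * u x)))\<^sup>2"
      by (simp add: ennreal_power)
    also have "\<dots> \<le> (\<integral>\<^sup>+z. ennreal (cmod (k z)) * ennreal (cmod (u (x + z) - u x)) \<partial>lborel)\<^sup>2"
      by (intro power_mono pw) auto
    also have "\<dots> = (\<integral>\<^sup>+z. S z * (S z * ennreal (cmod (u (x + z) - u x))) \<partial>lborel)\<^sup>2"
      by (simp add: S2[symmetric] power2_eq_square mult.assoc)
    also have "\<dots> \<le> (\<integral>\<^sup>+z. (S z)\<^sup>2 \<partial>lborel) * (\<integral>\<^sup>+z. (S z * ennreal (cmod (u (x + z) - u x)))\<^sup>2 \<partial>lborel)"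
      by (rule Cauchy_Schwarz_nn_integral) measurable
    finally show ?thesis by (simp add: S2 power_mult_distrib ennreal_power)
  qed
  have "sqnorm (\<lambda>x. corr k u x - (LINT z|lborel. k z) * u x)
    \<le> (\<integral>\<^sup>+x. (\<integral>\<^sup>+z. ennreal (cmod (k z)) \<partial>lborel) * (\<integral>\<^sup>+z. ennreal (cmod (k z)) * ennreal ((cmod (u (x + z) - u x))\<^sup>2) \<partial>lborel) \<partial>lborel)"
    unfolding sqnorm_def by (intro nn_integral_mono sq)
  also have "\<dots> = (\<integral>\<^sup>+z. ennreal (cmod (k z)) \<partial>lborel) * (\<integral>\<^sup>+x. (\<integral>\<^sup>+z. ennreal (cmod (k z)) * ennreal ((cmod (u (x + z) - u x))\<^sup>2) \<partial>lborel) \<partial>lborel)"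
    by (rule nn_integral_cmult) measurable
  also have "(\<integral>\<^sup>+x. (\<integral>\<^sup>+z. ennreal (cmod (k z)) * ennreal ((cmod (u (x + z) - u x))\<^sup>2) \<partial>lborel) \<partial>lborel)
     = (\<integral>\<^sup>+z. (\<integral>\<^sup>+x. ennreal (cmod (k z)) * ennreal ((cmod (u (x + z) - u x))\<^sup>2) \<partial>lborel) \<partial>lborel)"
    by (rule lborel_pair.Fubini'[symmetric]) measurable
  also have "\<dots> = (\<integral>\<^sup>+z. ennreal (cmod (k z)) * modulus u z \<partial>lborel)"
    by (simp add: modulus_def sqnorm_def nn_integral_cmult)
  finally show ?thesis .
qed

text \<open>A rapidly converging subsequence converges almost everywhere, and Fatou's lemma
  identifies its pointwise limit as the limit in norm of the whole sequence.\<close>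

lemma Riesz_Fischer:
  assumes [measurable]: "\<And>n. u n \<in> borel_measurable borel"
    and fin: "\<And>n. sqnorm (u n) < \<infinity>"
    and Cauchy: "\<And>e. e > 0 \<Longrightarrow> \<exists>N. \<forall>m\<ge>N. \<forall>n\<ge>N. sqnorm (\<lambda>x. u m x - u n x) \<le> ennreal e"
  shows "\<exists>G. G \<in> borel_measurable borel \<and> sqnorm G < \<infinity> \<and> (\<lambda>n. sqnorm (\<lambda>x. u n x - G x)) \<longlonglongrightarrow> 0"
proof -
  \<comment> \<open>The rate 8^-k leaves room for the weights 4^k below: the weighted squares of the
    increments still have a finite total integral, so almost everywhere the increments are
    O(2^-k).\<close>
  have "\<exists>N. \<forall>m\<ge>N. \<forall>n\<ge>N. sqnorm (\<lambda>x. u m x - u n x) \<le> ennreal ((1/8)^k)" for k :: nat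
    by (rule Cauchy) simp
  then obtain N where N: "\<And>k m n. m \<ge> N k \<Longrightarrow> n \<ge> N k \<Longrightarrow> sqnorm (\<lambda>x. u m x - u n x) \<le> ennreal ((1/8)^k)"
    by metis
  \<comment> \<open>Cumulative sums dominate \<open>N k\<close> at steps \<open>k\<close> and
    \<open>Suc k\<close>, and also \<open>k\<close> itself.\<close>
  define r where "r = (\<lambda>k. \<Sum>i\<le>k. N i + 1)"
  have rN: "r k \<ge> N k" "r (Suc k) \<ge> N k" "r k \<ge> k" for k
  proof -
    show "r k \<ge> N k" unfolding r_def by (cases k) auto
    then show "r (Suc k) \<ge> N k" by (simp add: r_def)
    show "r k \<ge> k" by (induction k) (auto simp: r_def)
  qed
  define d where "d = (\<lambda>k x. u (r (Suc k)) x - u (r k) x)"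
  have [measurable]: "d k \<in> borel_measurable borel" for k unfolding d_def by measurable
  have dk: "sqnorm (d k) \<le> ennreal ((1/8)^k)" for k
    unfolding d_def by (rule N) (use rN in auto)
  have "(\<integral>\<^sup>+x. (\<Sum>k. ennreal (4^k) * ennreal ((cmod (d k x))\<^sup>2)) \<partial>lborel) = (\<Sum>k. \<integral>\<^sup>+x. ennreal (4^k) * ennreal ((cmod (d k x))\<^sup>2) \<partial>lborel)"
    by (rule nn_integral_suminf) measurable
  also have "\<dots> = (\<Sum>k. ennreal (4^k) * sqnorm (d k))"
    by (simp add: sqnorm_def nn_integral_cmult)
  also have "\<dots> \<le> (\<Sum>k. ennreal ((1/2)^k))"
  proof (rule suminf_le)
    fix k
    have "ennreal (4^k) * sqnorm (d k) \<le> ennreal (4^k) * ennreal ((1/8)^k)" by (intro mult_left_mono dk) simp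
    also have "\<dots> = ennreal ((1/2)^k)" by (subst ennreal_mult[symmetric]) (auto simp: power_mult_distrib[symmetric])
    finally show "ennreal (4^k) * sqnorm (d k) \<le> ennreal ((1/2)^k)" .
  qed auto
  also have "\<dots> = ennreal (\<Sum>k. (1/2)^k)" by (rule suminf_ennreal2) auto
  finally have "(\<integral>\<^sup>+x. (\<Sum>k. ennreal (4^k) * ennreal ((cmod (d k x))\<^sup>2)) \<partial>lborel) \<noteq> \<infinity>"
    by (auto simp: top_unique)
  then have AEfin: "AE x in lborel. (\<Sum>k. ennreal (4^k) * ennreal ((cmod (d k x))\<^sup>2)) \<noteq> \<infinity>"
    by (intro nn_integral_PInf_AE) auto
  have conv: "convergent (\<lambda>k. u (r k) x)" if x: "(\<Sum>k. ennreal (4^k) * ennreal ((cmod (d k x))\<^sup>2)) \<noteq> \<infinity>" for x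
  proof -
    obtain C where C: "C \<ge> 0" "(\<Sum>k. ennreal (4^k) * ennreal ((cmod (d k x))\<^sup>2)) = ennreal C"
      using x by (cases "\<Sum>k. ennreal (4^k) * ennreal ((cmod (d k x))\<^sup>2)") auto
    have bd: "cmod (d k x) \<le> sqrt C * (1/2)^k" for k
    proof -
      have "ennreal (4^k * (cmod (d k x))\<^sup>2) \<le> ennreal C"
        using ennreal_le_suminf[of "\<lambda>k. ennreal (4^k) * ennreal ((cmod (d k x))\<^sup>2)" k] C
        by (simp add: ennreal_mult)
      then have "4^k * (cmod (d k x))\<^sup>2 \<le> C" using C by simp
      then have "(2^k * cmod (d k x))\<^sup>2 \<le> C"
        using power_mult_distrib[of "2::real" 2 k] by (simp add: power2_eq_square mult_ac)
      then have "2^k * cmod (d k x) \<le> sqrt C" by (rule real_le_rsqrt)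
      then show ?thesis by (simp add: power_divide field_simps)
    qed
    have "summable (\<lambda>k. sqrt C * (1/2)^k)" by (intro summable_mult summable_geometric) simp
    then have sm: "summable (\<lambda>k. d k x)" by (rule summable_comparison_test'[where N=0]) (rule bd)
    have "(\<lambda>n. u (r 0) x + (\<Sum>k<n. d k x)) \<longlonglongrightarrow> u (r 0) x + suminf (\<lambda>k. d k x)"
      by (rule tendsto_add[OF tendsto_const summable_LIMSEQ[OF sm]])
    moreover have "u (r 0) x + (\<Sum>k<n. d k x) = u (r n) x" for n
      unfolding d_def by (subst sum_lessThan_telescope) simp
    ultimately show ?thesis by (auto simp: convergent_def)
  qed
  define G where "G = (\<lambda>x. lim (\<lambda>k. u (r k) x))"
  have Gm[measurable]: "G \<in> borel_measurable borel" unfolding G_def by measurable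
  have lim: "AE x in lborel. (\<lambda>k. u (r k) x) \<longlonglongrightarrow> G x"
    using AEfin
  proof eventually_elim
    case (elim x)
    from conv[OF this] show ?case unfolding G_def by (simp add: convergent_LIMSEQ_iff)
  qed
  have bound: "sqnorm (\<lambda>x. u n x - G x) \<le> ennreal e" if N': "\<forall>m\<ge>M. \<forall>n\<ge>M. sqnorm (\<lambda>x. u m x - u n x) \<le> ennreal e" and n: "n \<ge> M" for n e M
  proof -
    \<comment> \<open>Fatou along the subsequence carries the Cauchy bound over to \<open>G\<close>,
      before \<open>G\<close> is known to be square integrable.\<close>
    have "sqnorm (\<lambda>x. u n x - G x) = (\<integral>\<^sup>+x. liminf (\<lambda>k. ennreal ((cmod (u n x - u (r k) x))\<^sup>2)) \<partial>lborel)"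
      unfolding sqnorm_def
    proof (rule nn_integral_cong_AE, use lim in eventually_elim)
      case (elim x)
      then have "(\<lambda>k. (cmod (u n x - u (r k) x))\<^sup>2) \<longlonglongrightarrow> (cmod (u n x - G x))\<^sup>2"
        by (intro tendsto_power tendsto_norm tendsto_diff tendsto_const)
      then show ?case by (intro lim_imp_Liminf[symmetric] tendsto_ennrealI) simp_all
    qed
    also have "\<dots> \<le> liminf (\<lambda>k. sqnorm (\<lambda>x. u n x - u (r k) x))"
      unfolding sqnorm_def by (rule nn_integral_liminf) measurable
    also have "\<dots> \<le> ennreal e"
    proof (rule Liminf_le)
      show "eventually (\<lambda>k. sqnorm (\<lambda>x. u n x - u (r k) x) \<le> ennreal e) sequentially"
        unfolding eventually_sequentially using N' n rN(3) by (meson le_trans)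
    qed simp
    finally show ?thesis .
  qed
  have "(\<lambda>n. sqnorm (\<lambda>x. u n x - G x)) \<longlonglongrightarrow> 0"
  proof (rule tendsto_zero_ennreal)
    fix e :: real assume e: "0 < e"
    then obtain M where M: "\<forall>m\<ge>M. \<forall>n\<ge>M. sqnorm (\<lambda>x. u m x - u n x) \<le> ennreal (e/2)" using Cauchy[of "e/2"] by auto
    have "ennreal (e/2) < ennreal e" using e by (simp add: ennreal_less_iff)
    then show "eventually (\<lambda>n. sqnorm (\<lambda>x. u n x - G x) < ennreal e) sequentially"
      using bound[OF M] by (auto simp: eventually_sequentially intro!: exI[of _ M] intro: le_less_trans)
  qed
  moreover have "sqnorm G < \<infinity>"
  proof -
    obtain M where M: "\<forall>m\<ge>M. \<forall>n\<ge>M. sqnorm (\<lambda>x. u m x - u n x) \<le> ennreal 1" using Cauchy[of 1] by auto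
    have "sqnorm (\<lambda>x. G x - 0) \<le> 2 * sqnorm (\<lambda>x. G x - u M x) + 2 * sqnorm (\<lambda>x. u M x - 0)"
      by (rule sqnorm_diff_triangle) measurable
    also have "\<dots> \<le> 2 * ennreal 1 + 2 * sqnorm (u M)"
      using bound[OF M, of M] sqnorm_minus_commute[of G "u M"] by (intro add_mono mult_left_mono) auto
    also have "\<dots> < \<infinity>" using fin[of M] by (auto simp: ennreal_mult_less_top)
    finally show ?thesis by simp
  qed
  ultimately show ?thesis using Gm by blast
qed

subsection \<open>Smooth functions and cutoffs\<close>

text \<open>The total derivative together with named components: the calculus rules below then
  compute all partial derivatives at once, and continuity comes for free.\<close>

definition has_grad :: "(real^3 \<Rightarrow> complex) \<Rightarrow> (3 \<Rightarrow> real^3 \<Rightarrow> complex) \<Rightarrow> bool" where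
  "has_grad u D \<longleftrightarrow> (\<forall>x. (u has_derivative (\<lambda>h. \<Sum>j\<in>UNIV. of_real (h $ j) * D j x)) (at x))"

lemma has_grad_partial_deriv: "has_grad u D \<Longrightarrow> partial_deriv j u = D j"
proof
  fix x assume "has_grad u D"
  then have "frechet_derivative u (at x) = (\<lambda>h. \<Sum>j\<in>UNIV. of_real (h $ j) * D j x)"
    by (intro frechet_derivative_at[symmetric]) (auto simp: has_grad_def)
  then have "partial_deriv j u x = (\<Sum>i\<in>UNIV. of_real (axis j 1 $ i) * D i x)"
    by (simp add: partial_deriv_def)
  also have "\<dots> = (\<Sum>i\<in>UNIV. if i = j then D i x else 0)"
    by (intro sum.cong) (auto simp: axis_def)
  finally show "partial_deriv j u x = D j x" by simp
qed

lemma has_grad_continuous: "has_grad u D \<Longrightarrow> continuous_on UNIV u"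
  unfolding has_grad_def by (meson continuous_at_imp_continuous_on has_derivative_continuous)

lemma has_grad_const: "has_grad (\<lambda>x. c) (\<lambda>j x. 0)"
  by (simp add: has_grad_def)

lemma has_grad_coord: "has_grad (\<lambda>x. of_real (x $ i)) (\<lambda>j x. if j = i then 1 else 0)"
proof -
  have "((\<lambda>x::real^3. complex_of_real (x $ i)) has_derivative (\<lambda>h. of_real (h $ i))) (at x)" for x
    by (intro bounded_linear_imp_has_derivative bounded_linear_compose[OF bounded_linear_of_real] bounded_linear_vec_nth)
  moreover have "(\<Sum>j\<in>UNIV. complex_of_real (h $ j) * (if j = i then 1 else 0)) = of_real (h $ i)" for h :: "real^3"
    by (simp add: if_distrib cong: if_cong)
  ultimately show ?thesis by (simp add: has_grad_def)
qed

lemma has_grad_add: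
  assumes "has_grad u D" "has_grad v E"
  shows "has_grad (\<lambda>x. u x + v x) (\<lambda>j x. D j x + E j x)"
  unfolding has_grad_def
proof
  fix x
  have "((\<lambda>x. u x + v x) has_derivative (\<lambda>h. (\<Sum>j\<in>UNIV. of_real (h $ j) * D j x) + (\<Sum>j\<in>UNIV. of_real (h $ j) * E j x))) (at x)"
    using assms by (intro has_derivative_add) (auto simp: has_grad_def)
  then show "((\<lambda>x. u x + v x) has_derivative (\<lambda>h. \<Sum>j\<in>UNIV. of_real (h $ j) * (D j x + E j x))) (at x)"
    by (simp add: distrib_left sum.distrib)
qed

lemma has_grad_mult:
  assumes "has_grad u D" "has_grad v E"
  shows "has_grad (\<lambda>x. u x * v x) (\<lambda>j x. u x * E j x + D j x * v x)"
  unfolding has_grad_def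
proof
  fix x
  have "((\<lambda>x. u x * v x) has_derivative (\<lambda>h. u x * (\<Sum>j\<in>UNIV. of_real (h $ j) * E j x) + (\<Sum>j\<in>UNIV. of_real (h $ j) * D j x) * v x)) (at x)"
    using assms by (intro has_derivative_mult) (auto simp: has_grad_def)
  moreover have "u x * (\<Sum>j\<in>UNIV. of_real (h $ j) * E j x) + (\<Sum>j\<in>UNIV. of_real (h $ j) * D j x) * v x
     = (\<Sum>j\<in>UNIV. of_real (h $ j) * (u x * E j x + D j x * v x))" for h :: "real^3"
    unfolding sum_distrib_left sum_distrib_right sum.distrib[symmetric]
    by (intro sum.cong) (auto simp: algebra_simps)
  ultimately show "((\<lambda>x. u x * v x) has_derivative (\<lambda>h. \<Sum>j\<in>UNIV. of_real (h $ j) * (u x * E j x + D j x * v x))) (at x)"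
    by simp
qed

lemma has_grad_cmult: "has_grad u D \<Longrightarrow> has_grad (\<lambda>x. c * u x) (\<lambda>j x. c * D j x)"
  using has_grad_mult[OF has_grad_const[of c]] by simp

lemma has_grad_uminus: "has_grad u D \<Longrightarrow> has_grad (\<lambda>x. - u x) (\<lambda>j x. - D j x)"
  using has_grad_cmult[of u D "-1"] by simp

lemma has_grad_diff:
  "has_grad u D \<Longrightarrow> has_grad v E \<Longrightarrow> has_grad (\<lambda>x. u x - v x) (\<lambda>j x. D j x - E j x)"
  using has_grad_add[of u D "\<lambda>x. - v x" "\<lambda>j x. - E j x"] has_grad_uminus[of v E] by simp

lemma has_grad_affine:
  assumes "has_grad u D"
  shows "has_grad (\<lambda>x. u (c *\<^sub>R x + a)) (\<lambda>j x. of_real c * D j (c *\<^sub>R x + a))"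
  unfolding has_grad_def
proof
  fix x
  have "((\<lambda>x. c *\<^sub>R x + a) has_derivative (\<lambda>h. c *\<^sub>R h)) (at x)"
    by (auto intro!: derivative_eq_intros)
  moreover have "(u has_derivative (\<lambda>h. \<Sum>j\<in>UNIV. of_real (h $ j) * D j (c *\<^sub>R x + a))) (at (c *\<^sub>R x + a))"
    using assms by (simp add: has_grad_def)
  ultimately have "((\<lambda>x. u (c *\<^sub>R x + a)) has_derivative (\<lambda>h. \<Sum>j\<in>UNIV. of_real ((c *\<^sub>R h) $ j) * D j (c *\<^sub>R x + a))) (at x)"
    by (rule has_derivative_compose)
  then show "((\<lambda>x. u (c *\<^sub>R x + a)) has_derivative (\<lambda>h. \<Sum>j\<in>UNIV. of_real (h $ j) * (of_real c * D j (c *\<^sub>R x + a)))) (at x)"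
    by (simp add: mult_ac)
qed

lemma has_grad_compose_real:
  assumes F: "\<And>x. (F has_real_derivative F' (q x)) (at (q x))"
    and q: "has_grad (\<lambda>x. of_real (q x)) D"
  shows "has_grad (\<lambda>x. of_real (F (q x))) (\<lambda>j x. of_real (F' (q x)) * D j x)"
  unfolding has_grad_def
proof
  fix x
  let ?L = "\<lambda>h. \<Sum>j\<in>UNIV. of_real (h $ j) * D j x"
  have L: "((\<lambda>x. complex_of_real (q x)) has_derivative ?L) (at x)" using q by (simp add: has_grad_def)
  from bounded_linear.has_derivative[OF bounded_linear_Re this]
  have qd: "(q has_derivative (\<lambda>h. Re (?L h))) (at x)" by simp
  have "((\<lambda>x. complex_of_real (q x)) has_derivative (\<lambda>h. complex_of_real (Re (?L h)))) (at x)"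
    by (rule bounded_linear.has_derivative[OF bounded_linear_of_real qd])
  \<comment> \<open>Uniqueness of the derivative shows that \<open>?L\<close> takes real values
    although the components \<open>D j x\<close> are given as complex numbers; this permits the
    detour through the real chain rule.\<close>
  then have Leq: "(\<lambda>h. complex_of_real (Re (?L h))) = ?L" by (rule has_derivative_unique[OF _ L])
  have "(F has_derivative (\<lambda>t. t * F' (q x))) (at (q x))" 
    using F[of x] unfolding has_field_derivative_def by (rule has_derivative_eq_rhs) (auto simp: mult.commute)
  from has_derivative_compose[OF qd this]
  have "((\<lambda>x. F (q x)) has_derivative (\<lambda>h. Re (?L h) * F' (q x))) (at x)" by simp
  then have "((\<lambda>x. complex_of_real (F (q x))) has_derivative (\<lambda>h. complex_of_real (Re (?L h) * F' (q x)))) (at x)"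
    by (rule bounded_linear.has_derivative[OF bounded_linear_of_real])
  then have "((\<lambda>x. complex_of_real (F (q x))) has_derivative (\<lambda>h. complex_of_real (Re (?L h)) * of_real (F' (q x)))) (at x)"
    by simp
  moreover have "complex_of_real (Re (?L h)) * of_real (F' (q x)) = (\<Sum>j\<in>UNIV. of_real (h $ j) * (of_real (F' (q x)) * D j x))" for h
    using fun_cong[OF Leq, of h] by (simp add: sum_distrib_left sum_distrib_right mult_ac)
  ultimately show "((\<lambda>x. complex_of_real (F (q x))) has_derivative (\<lambda>h. \<Sum>j\<in>UNIV. of_real (h $ j) * (of_real (F' (q x)) * D j x))) (at x)"
    by simp
qed

text \<open>A class of functions closed under partial derivatives, hence consisting of smooth functions.\<close>

inductive elem :: "(real^3 \<Rightarrow> complex) \<Rightarrow> bool" where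
  elem_const: "elem (\<lambda>x. c)"
| elem_coord: "elem (\<lambda>x. of_real (x $ i))"
| elem_add: "elem u \<Longrightarrow> elem v \<Longrightarrow> elem (\<lambda>x. u x + v x)"
| elem_mult: "elem u \<Longrightarrow> elem v \<Longrightarrow> elem (\<lambda>x. u x * v x)"
| elem_comp: "elem (\<lambda>x. of_real (q x)) \<Longrightarrow>
    (\<And>n x. (F n has_real_derivative F (Suc n) (q x)) (at (q x))) \<Longrightarrow> elem (\<lambda>x. of_real (F n (q x)))"

text \<open>The induction closes because \<open>elem_comp\<close> carries a whole sequence of
  successive derivatives: the derivative of \<open>F n (q x)\<close> involves
  \<open>F (Suc n) (q x)\<close>, which belongs to the class by the same rule.\<close>

lemma elem_has_grad: "elem u \<Longrightarrow> \<exists>D. has_grad u D \<and> (\<forall>j. elem (D j))"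
proof (induction rule: elem.induct)
  case (elem_const c)
  show ?case by (intro exI[of _ "\<lambda>j x. 0"] conjI has_grad_const allI elem.elem_const)
next
  case (elem_coord i)
  show ?case by (intro exI[of _ "\<lambda>j x. if j = i then 1 else 0"] conjI has_grad_coord allI elem.elem_const)
next
  case (elem_add u v)
  then obtain D E where "has_grad u D" "has_grad v E" and e: "\<And>j. elem (D j)" "\<And>j. elem (E j)" by blast
  note g = has_grad_add[OF this(1,2)]
  show ?case
    by (rule exI, rule conjI, rule g) (intro allI elem.elem_add e)
next
  case (elem_mult u v)
  then obtain D E where "has_grad u D" "has_grad v E" and e: "\<And>j. elem (D j)" "\<And>j. elem (E j)" by blast
  note g = has_grad_mult[OF this(1,2)]
  show ?case
    by (rule exI, rule conjI, rule g) (intro allI elem.elem_add elem.elem_mult elem_mult.hyps e)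
next
  case (elem_comp q F n)
  then obtain D where D: "has_grad (\<lambda>x. of_real (q x)) D" "\<And>j. elem (D j)" by blast
  have g: "has_grad (\<lambda>x. of_real (F n (q x))) (\<lambda>j x. of_real (F (Suc n) (q x)) * D j x)"
    by (rule has_grad_compose_real[OF elem_comp.hyps(2) D(1)])
  show ?case
    by (rule exI, rule conjI, rule g) (intro allI elem.elem_mult D elem.elem_comp[of q F] elem_comp.hyps)
qed

lemma elem_smooth: "elem u \<Longrightarrow> smooth u"
proof -
  have "fold partial_deriv js u differentiable_on UNIV" if "elem u" for js u
    using that
  proof (induction js arbitrary: u)
    case Nil
    then obtain D where "has_grad u D" using elem_has_grad by blast
    then show ?case by (auto simp: has_grad_def differentiable_on_def differentiable_def)
  next
    case (Cons j js)
    then obtain D where "has_grad u D" "elem (D j)" using elem_has_grad by blast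
    then show ?case using Cons.IH by (simp add: has_grad_partial_deriv)
  qed
  then show "elem u \<Longrightarrow> smooth u" by (simp add: smooth_def)
qed

lemma elem_affine: "elem u \<Longrightarrow> elem (\<lambda>x. u (c *\<^sub>R x + a))"
proof (induction rule: elem.induct)
  case (elem_coord i)
  have "elem (\<lambda>x. of_real c * of_real (x $ i) + of_real (a $ i))"
    by (intro elem.intros)
  then show ?case by simp
next
  case (elem_comp q F n)
  then show ?case using elem.elem_comp[of "\<lambda>x. q (c *\<^sub>R x + a)" F n] by simp
qed (auto intro: elem.intros)

lemma elem_shift: "elem u \<Longrightarrow> elem (\<lambda>x. u (x - a))"
  using elem_affine[of u 1 "-a"] by simp

lemma elem_cmult: "elem u \<Longrightarrow> elem (\<lambda>x. c * u x)"
  by (intro elem.intros)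

lemma elem_sum: "finite A \<Longrightarrow> (\<And>i. i \<in> A \<Longrightarrow> elem (u i)) \<Longrightarrow> elem (\<lambda>x. \<Sum>i\<in>A. u i x)"
  by (induction A rule: finite_induct) (auto intro: elem.intros)

lemma norm_sq_vec3: "(norm x)\<^sup>2 = (\<Sum>i\<in>UNIV. (x $ i)\<^sup>2)" for x :: "real^3"
  unfolding power2_norm_eq_inner inner_vec_def by (simp add: power2_eq_square)

lemma elem_norm_sq: "elem (\<lambda>x. of_real ((norm x)\<^sup>2))"
proof -
  have "elem (\<lambda>x. \<Sum>i\<in>UNIV. of_real (x $ i) * of_real (x $ i))"
    by (intro elem_sum elem.intros) auto
  then show ?thesis unfolding norm_sq_vec3 by (simp add: power2_eq_square)
qed

lemma elem_powr:
  assumes "elem (\<lambda>x. of_real (q x))" "\<And>x. q x > 0"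
  shows "elem (\<lambda>x. of_real (q x powr a))"
proof -
  \<comment> \<open>The successive derivatives of t^a, with falling factorials as
    coefficients.\<close>
  have "((\<lambda>t. (\<Prod>i<n. a - real i) * t powr (a - real n)) has_real_derivative (\<Prod>i<Suc n. a - real i) * q x powr (a - real (Suc n))) (at (q x))" for n x
    using assms(2)[of x] by (auto intro!: derivative_eq_intros simp: algebra_simps)
  from elem_comp[where F="\<lambda>n t. (\<Prod>i<n. a - real i) * t powr (a - real n)" and n=0, OF assms(1) this]
  show ?thesis by simp
qed

section \<open>A smooth cutoff function\<close>

text \<open>The classical function exp(-1/t), continued by 0, with a polynomial in 1/t as a factor
  so that the family is closed under differentiation.\<close>

definition flat :: "real poly \<Rightarrow> real \<Rightarrow> real" where
  "flat p t = (if t > 0 then poly p (1/t) * exp (- (1/t)) else 0)"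

lemma flat_limit: "((\<lambda>t. flat p t) \<longlongrightarrow> 0) (at_right 0)"
proof -
  have "((\<lambda>s. poly p s * exp (- s)) \<longlongrightarrow> 0) at_top"
  proof -
    have "((\<lambda>s. \<Sum>i\<le>degree p. coeff p i * (s ^ i / exp s)) \<longlongrightarrow> (\<Sum>i\<le>degree p. coeff p i * 0)) at_top"
      by (intro tendsto_sum tendsto_mult tendsto_const tendsto_power_div_exp_0)
    then show ?thesis
      by (simp add: poly_altdef sum_distrib_right exp_minus field_simps sum_divide_distrib)
  qed
  from filterlim_compose[OF this filterlim_inverse_at_top_right]
  have "((\<lambda>t. poly p (inverse t) * exp (- inverse t)) \<longlongrightarrow> 0) (at_right 0)" .
  then show ?thesis
    by (rule Lim_transform_eventually) (auto simp: flat_def eventually_at_filter inverse_eq_divide intro!: always_eventually)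
qed

text \<open>Differentiating p(1/t) exp(-1/t) gives t^-2 (p - p')(1/t) exp(-1/t), and
  \<open>[:0, 0, 1:]\<close> is the factor t^-2. At 0 the difference quotients tend to 0 from both
  sides.\<close>

lemma flat_deriv:
  "(flat p has_real_derivative flat ([:0, 0, 1:] * (p - pderiv p)) t) (at t)"
proof -
  consider "t > 0" | "t < 0" | "t = 0" by linarith
  then show ?thesis
  proof cases
    case 1
    have "((\<lambda>t. poly p (1/t) * exp (- (1/t))) has_real_derivative flat ([:0, 0, 1:] * (p - pderiv p)) t) (at t)"
      using 1 by (auto intro!: derivative_eq_intros DERIV_chain2[OF poly_DERIV] simp: flat_def field_simps power2_eq_square)
    then show ?thesis
      by (rule DERIV_cong_ev[THEN iffD1, rotated -1])
         (use 1 eventually_nhds_in_open[of "{0<..}" t] in \<open>auto simp: flat_def elim!: eventually_mono\<close>)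
  next
    case 2
    have "((\<lambda>t. 0) has_real_derivative flat ([:0, 0, 1:] * (p - pderiv p)) t) (at t)"
      using 2 by (simp add: flat_def)
    then show ?thesis
      by (rule DERIV_cong_ev[THEN iffD1, rotated -1])
         (use 2 eventually_nhds_in_open[of "{..<0}" t] in \<open>auto simp: flat_def elim!: eventually_mono\<close>)
  next
    case 3
    \<comment> \<open>Division by \<open>h\<close> amounts to multiplying \<open>p\<close> by the
      variable, so \<open>flat_limit\<close> applies to the quotient as well.\<close>
    have R: "((\<lambda>h. flat p h / h) \<longlongrightarrow> 0) (at_right 0)"
      using flat_limit[of "[:0, 1:] * p"]
      by (rule Lim_transform_eventually) (auto simp: flat_def eventually_at_filter intro!: always_eventually)
    have L: "((\<lambda>h. flat p h / h) \<longlongrightarrow> 0) (at_left 0)"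
      by (rule tendsto_eventually) (auto simp: flat_def eventually_at_filter intro!: always_eventually)
    have "((\<lambda>h. flat p h / h) \<longlongrightarrow> 0) (at 0)"
      using L R by (simp add: filterlim_split_at)
    then show ?thesis using 3 by (simp add: DERIV_def flat_def)
  qed
qed

lemma elem_flat:
  assumes "elem (\<lambda>x. of_real (q x))"
  shows "elem (\<lambda>x. of_real (flat 1 (q x)))"
proof -
  define P where "P = rec_nat (1 :: real poly) (\<lambda>_ p. [:0, 0, 1:] * (p - pderiv p))"
  have "P 0 = 1" "\<And>n. P (Suc n) = [:0, 0, 1:] * (P n - pderiv (P n))" by (auto simp: P_def)
  then show ?thesis using elem_comp[where F="\<lambda>n. flat (P n)" and n=0, OF assms] flat_deriv by simp
qed

lemma cutoff_exists:
  "\<exists>cut D C. elem cut \<and> has_grad cut D \<and> (\<forall>x. norm x \<le> 1 \<longrightarrow> cut x = 1) \<and> (\<forall>x. norm x \<ge> 2 \<longrightarrow> cut x = 0)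
     \<and> (\<forall>x. cmod (cut x) \<le> 1) \<and> C \<ge> 0 \<and> (\<forall>j x. cmod (D j x) \<le> C)
     \<and> (\<forall>j x. norm x < 1 \<or> norm x > 2 \<longrightarrow> D j x = 0) \<and> (\<forall>j. continuous_on UNIV (D j))"
proof -
  \<comment> \<open>\<open>a\<close> is positive exactly for norm x < 2 and \<open>b\<close> exactly
    for norm x > 1, so the sum never vanishes and a / (a + b) is 1 on the unit ball and 0 outside
    the ball of radius 2.\<close>
  define a where "a = (\<lambda>x::real^3. flat 1 (4 - (norm x)\<^sup>2))"
  define b where "b = (\<lambda>x::real^3. flat 1 ((norm x)\<^sup>2 - 1))"
  have ea: "elem (\<lambda>x. of_real (a x))" unfolding a_def
  proof (rule elem_flat)
    have "elem (\<lambda>x. 4 + (-1) * of_real ((norm x)\<^sup>2))" by (intro elem_norm_sq elem.intros)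
    then show "elem (\<lambda>x. of_real (4 - (norm x)\<^sup>2))" by simp
  qed
  have eb: "elem (\<lambda>x. of_real (b x))" unfolding b_def
  proof (rule elem_flat)
    have "elem (\<lambda>x. of_real ((norm x)\<^sup>2) + (-1))" by (intro elem_norm_sq elem.intros)
    then show "elem (\<lambda>x. of_real ((norm x)\<^sup>2 - 1))" by simp
  qed
  have nn: "a x \<ge> 0" "b x \<ge> 0" for x by (auto simp: a_def b_def flat_def)
  have sq1: "norm x > 1 \<longleftrightarrow> (norm x)\<^sup>2 > 1" "norm x < 2 \<longleftrightarrow> (norm x)\<^sup>2 < 4" for x :: "real^3"
    using abs_square_less_1[of "norm x"] abs_square_le_1[of "norm x"] power2_less_imp_less[of "norm x" 2] power_strict_mono[of "norm x" 2 2] by auto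
  have ab: "a x > 0 \<longleftrightarrow> norm x < 2" "b x > 0 \<longleftrightarrow> norm x > 1" for x
    using sq1[of x] by (auto simp: a_def b_def flat_def)
  have pos: "a x + b x > 0" for x using nn[of x] ab[of x] by (cases "norm x < 2") (auto intro: add_pos_nonneg add_nonneg_pos)
  \<comment> \<open>The quotient is written with \<open>powr (-1)\<close> so that it falls under the
    closure rules of \<open>elem\<close>.\<close>
  define cut where "cut = (\<lambda>x. complex_of_real (a x) * of_real ((a x + b x) powr (-1)))"
  have cut: "cut x = of_real (a x / (a x + b x))" for x
    using pos[of x] by (simp add: cut_def powr_neg_one)
  have e: "elem cut" unfolding cut_def
    by (intro elem.elem_mult ea elem_powr pos) (use elem.elem_add[OF ea eb] in simp)
  then obtain D where D: "has_grad cut D" "\<And>j. elem (D j)" using elem_has_grad by blast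
  have c: "continuous_on UNIV (D j)" for j using D(2)[of j] elem_has_grad has_grad_continuous by blast
  have one: "cut x = 1" if "norm x \<le> 1" for x
  proof -
    have "b x = 0" using ab(2)[of x] nn(2)[of x] that by auto
    then show ?thesis using pos[of x] by (simp add: cut)
  qed
  have zero: "cut x = 0" if "norm x \<ge> 2" for x
  proof -
    have "a x = 0" using ab(1)[of x] nn(1)[of x] that by auto
    then show ?thesis by (simp add: cut)
  qed
  have D0: "D j x = 0" if "norm x < 1 \<or> norm x > 2" for j x
  proof -
    obtain S k where S: "open S" "x \<in> S" "\<And>y. y \<in> S \<Longrightarrow> cut y = k"
    proof (cases "norm x < 1")
      case True
      then show ?thesis using that[of "ball 0 1" 1] one by auto
    next
      case False
      with \<open>norm x < 1 \<or> norm x > 2\<close> have "x \<in> - cball 0 2" by simp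
      then show ?thesis using that[of "- cball 0 2" 0] zero by auto
    qed
    have "(cut has_derivative (\<lambda>h. 0)) (at x)"
      by (rule has_derivative_transform_within_open[OF has_derivative_const[of k] S(1,2)]) (use S(3) in auto)
    then have "partial_deriv j cut x = 0"
      by (simp add: partial_deriv_def frechet_derivative_at[symmetric])
    then show ?thesis using D(1) by (simp add: has_grad_partial_deriv)
  qed
  have "\<exists>C. \<forall>x\<in>cball 0 2. cmod (D j x) \<le> C" for j
  proof -
    have "compact (D j ` cball 0 2)"
      by (rule compact_continuous_image[OF continuous_on_subset[OF c]]) auto
    then have "bounded (D j ` cball 0 2)" by (rule compact_imp_bounded)
    then show ?thesis by (auto simp: bounded_iff)
  qed
  then obtain K where K: "\<And>j x. x \<in> cball 0 2 \<Longrightarrow> cmod (D j x) \<le> K j" by metis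
  define C where "C = (\<Sum>j\<in>UNIV. \<bar>K j\<bar>)"
  have C0: "C \<ge> 0" by (auto simp: C_def intro: sum_nonneg)
  have CD: "cmod (D j x) \<le> C" for j x
  proof (cases "norm x \<le> 2")
    case True
    have "cmod (D j x) \<le> \<bar>K j\<bar>" using K[of x j] True by simp
    also have "\<dots> \<le> C" unfolding C_def by (rule member_le_sum) auto
    finally show ?thesis .
  qed (use D0 C0 in auto)
  have "cmod (cut x) \<le> 1" for x
    using nn[of x] pos[of x] unfolding cut norm_of_real by (simp add: abs_of_nonneg field_simps)
  with e D c one zero D0 C0 CD show ?thesis by (intro exI[of _ cut] exI[of _ D] exI[of _ C]) auto
qed

subsection \<open>Decay, the Plummer potential and the Dirac matrices\<close>

text \<open>Integrating \<open>w(x + e\<^sub>j) - w(x)\<close> over the whole space gives \<open>0\<close> by translation invariance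
  and, by Fubini, the integral of the derivative.\<close>

lemma integral_partial_eq_0:
  assumes w: "has_grad w D" and int: "integrable lborel w" "integrable lborel (D j)"
    and c: "continuous_on UNIV (D j)"
  shows "(LINT x|lborel. D j x) = 0"
proof -
  let ?e = "axis j 1 :: real^3"
  let ?I = "{0..1::real}"
  have [measurable]: "D j \<in> borel_measurable borel" using c by (rule borel_measurable_continuous_onI)
  have [measurable]: "w \<in> borel_measurable borel" using has_grad_continuous[OF w] by (rule borel_measurable_continuous_onI)
  have line: "(LINT t|lborel. indicator ?I t *\<^sub>R D j (x + t *\<^sub>R ?e)) = w (x + ?e) - w x" for x
  proof -
    have "((\<lambda>t. w (x + t *\<^sub>R ?e)) has_vector_derivative D j (x + t *\<^sub>R ?e)) (at t within ?I)" for t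
    proof -
      have "((\<lambda>t. x + t *\<^sub>R ?e) has_derivative (\<lambda>s. s *\<^sub>R ?e)) (at t)"
        by (auto intro!: derivative_eq_intros)
      moreover have "(w has_derivative (\<lambda>h. \<Sum>i\<in>UNIV. of_real (h $ i) * D i (x + t *\<^sub>R ?e))) (at (x + t *\<^sub>R ?e))"
        using w by (simp add: has_grad_def)
      ultimately have "((\<lambda>t. w (x + t *\<^sub>R ?e)) has_derivative (\<lambda>s. \<Sum>i\<in>UNIV. of_real ((s *\<^sub>R ?e) $ i) * D i (x + t *\<^sub>R ?e))) (at t)"
        by (rule has_derivative_compose)
      moreover have "(\<Sum>i\<in>UNIV. of_real ((s *\<^sub>R ?e) $ i) * D i (x + t *\<^sub>R ?e)) = s *\<^sub>R D j (x + t *\<^sub>R ?e)" for s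
      proof -
        have "(\<Sum>i\<in>UNIV. of_real ((s *\<^sub>R ?e) $ i) * D i (x + t *\<^sub>R ?e))
          = (\<Sum>i\<in>UNIV. if i = j then s *\<^sub>R D j (x + t *\<^sub>R ?e) else 0)"
          by (intro sum.cong) (auto simp: axis_def scaleR_conv_of_real[where 'a=complex])
        then show ?thesis by simp
      qed
      ultimately show ?thesis
        unfolding has_vector_derivative_def by (auto intro: has_derivative_at_withinI)
    qed
    moreover have "continuous_on ?I (\<lambda>t. D j (x + t *\<^sub>R ?e))"
      by (rule continuous_on_compose2[OF c]) (auto intro!: continuous_intros)
    ultimately have "(LINT t|lborel. indicator ?I t *\<^sub>R D j (x + t *\<^sub>R ?e)) = w (x + 1 *\<^sub>R ?e) - w (x + 0 *\<^sub>R ?e)"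
      by (intro integral_FTC_atLeastAtMost) auto
    then show ?thesis by simp
  qed
  have shift: "integrable lborel (\<lambda>x. h (x + a))" "(LINT x|lborel. h (x + a)) = (LINT x|lborel. h x)"
    if "integrable lborel h" for h :: "real^3 \<Rightarrow> complex" and a
    using integrable_shift[OF that, of "-a"] integral_shift[of h "-a"] borel_measurable_integrable[OF that] by simp_all
  \<comment> \<open>Absolute integrability on [0,1] x R^3: by translation invariance the inner
    integral of |D j| is the same for every \<open>t\<close> in the interval.\<close>
  have prod: "integrable (lborel \<Otimes>\<^sub>M lborel) (\<lambda>(t, x). indicator ?I t *\<^sub>R D j (x + t *\<^sub>R ?e))"
  proof (rule lborel_pair.Fubini_integrable)
    have eq: "(LINT x|lborel. norm (indicator ?I t *\<^sub>R D j (x + t *\<^sub>R ?e))) = indicator ?I t *\<^sub>R (LINT x|lborel. norm (D j x))" for t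
    proof -
      have "(LINT x|lborel. norm (D j (x + t *\<^sub>R ?e))) = (LINT x|lborel. norm (D j x))"
        using integral_shift[of "\<lambda>x. norm (D j x)" "- (t *\<^sub>R ?e)"] by simp
      then show ?thesis by simp
    qed
    show "integrable lborel (\<lambda>t. LINT x|lborel. norm (case (t, x) of (t, x) \<Rightarrow> indicator ?I t *\<^sub>R D j (x + t *\<^sub>R ?e)))"
      unfolding prod.case eq by (intro integrable_scaleR_left integrable_real_indicator) simp_all
    show "AE t in lborel. integrable lborel (\<lambda>x. case (t, x) of (t, x) \<Rightarrow> indicator ?I t *\<^sub>R D j (x + t *\<^sub>R ?e))"
      using shift(1)[OF int(2)] by auto
  qed measurable
  have "0 = (LINT x|lborel. w (x + ?e) - w x)"
    using shift[OF int(1), of ?e] int(1) by simp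
  also have "\<dots> = (LINT x|lborel. LINT t|lborel. indicator ?I t *\<^sub>R D j (x + t *\<^sub>R ?e))"
    by (simp only: line)
  also have "\<dots> = (LINT t|lborel. LINT x|lborel. indicator ?I t *\<^sub>R D j (x + t *\<^sub>R ?e))"
    by (rule lborel_pair.Fubini_integral[OF prod])
  also have "\<dots> = (LINT t|lborel. indicator ?I t *\<^sub>R (LINT x|lborel. D j x))"
    using shift(2)[OF int(2)] by simp
  also have "\<dots> = (LINT x|lborel. D j x)" by simp
  finally show ?thesis by simp
qed

section \<open>Polynomial decay\<close>

lemma bracket_ge: "1 \<le> bracket x" "norm x \<le> bracket x" "0 < bracket x"
proof -
  show 1: "1 \<le> bracket x" by (simp add: bracket_def)
  show "norm x \<le> bracket x" unfolding bracket_def by (rule real_le_rsqrt) simp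
  show "0 < bracket x" using 1 by simp
qed

lemma bracket_measurable [measurable]: "bracket \<in> borel_measurable borel"
  unfolding bracket_def[abs_def] by measurable

lemma bracket_powr: "bracket x powr a = (1 + (norm x)\<^sup>2) powr (a/2)"
  unfolding bracket_def by (subst powr_half_sqrt[symmetric]) (auto simp: powr_powr)

text \<open>A Peetre-type inequality: it makes the decay classes below invariant under
  translation.\<close>

lemma bracket_shift: "bracket x \<le> 2 * bracket a * bracket (x - a)"
proof (rule power2_le_imp_le)
  have sq: "(bracket z)\<^sup>2 = 1 + (norm z)\<^sup>2" for z by (simp add: bracket_def)
  have "(norm x)\<^sup>2 \<le> 2 * (norm a)\<^sup>2 + 2 * (norm (x - a))\<^sup>2"
    using norm_add_sq_le[of a "x - a"] by simp
  moreover have "4 * ((1 + (norm a)\<^sup>2) * (1 + (norm (x - a))\<^sup>2))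
      = 4 + 4 * (norm a)\<^sup>2 + 4 * (norm (x - a))\<^sup>2 + 4 * ((norm a)\<^sup>2 * (norm (x - a))\<^sup>2)"
    by (simp only: distrib_left distrib_right mult_1_left mult_1_right)
  moreover have "0 \<le> (norm a)\<^sup>2" "0 \<le> (norm (x - a))\<^sup>2" "0 \<le> (norm a)\<^sup>2 * (norm (x - a))\<^sup>2" by simp_all
  ultimately have "1 + (norm x)\<^sup>2 \<le> 4 * ((1 + (norm a)\<^sup>2) * (1 + (norm (x - a))\<^sup>2))" by linarith
  moreover have "(2 * u * v)\<^sup>2 = 4 * (u\<^sup>2 * v\<^sup>2)" for u v :: real by (simp add: power_mult_distrib)
  ultimately show "(bracket x)\<^sup>2 \<le> (2 * bracket a * bracket (x - a))\<^sup>2"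
    by (simp only: sq)
qed (use bracket_ge[of a] bracket_ge[of "x - a"] in auto)

lemma nn_integral_bracket_powr:
  assumes "q > 3"
  shows "(\<integral>\<^sup>+x. ennreal (bracket x powr (-q)) \<partial>lborel) < \<infinity>"
proof -
  have "(\<integral>\<^sup>+x. ennreal (bracket x powr (-q)) \<partial>lborel)
    \<le> (\<integral>\<^sup>+x. indicator (ball 0 1) x + ennreal (norm (x::real^3) powr (-q)) * indicator {x. 1 \<le> norm x} x \<partial>lborel)"
  proof (rule nn_integral_mono)
    fix x
    show "ennreal (bracket x powr (-q)) \<le> indicator (ball 0 1) x + ennreal (norm x powr (-q)) * indicator {x. 1 \<le> norm x} x"
    proof (cases "1 \<le> norm x")
      case True
      then have "bracket x powr (-q) \<le> norm x powr (-q)"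
        using bracket_ge[of x] assms by (intro powr_mono2') auto
      then show ?thesis using True by (auto intro: ennreal_leI)
    next
      case False
      have "bracket x powr (-q) \<le> 1 powr (-q)" using bracket_ge[of x] assms by (intro powr_mono2') auto
      then show ?thesis using False by simp
    qed
  qed
  also have "\<dots> = (\<integral>\<^sup>+x. indicator (ball (0::real^3) 1) x \<partial>lborel) + (\<integral>\<^sup>+x. ennreal (norm (x::real^3) powr (-q)) * indicator {x. 1 \<le> norm x} x \<partial>lborel)"
    by (rule nn_integral_add, rule borel_measurable_indicator, simp, measurable)
  also have "\<dots> < \<infinity>"
    using nn_integral_norm_powr_outside[of q 1] assms by (auto simp: emeasure_ball3 less_top[symmetric] top_unique)
  finally show ?thesis .
qed

text \<open>Decay of order \<open>q\<close>, with growth allowed for negative \<open>q\<close>. The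
  thresholds are 3/2 for square integrability and 3 for integrability; order 4 suffices for pairing
  with f and order 2 for pairing with g.\<close>

definition dec :: "real \<Rightarrow> (real^3 \<Rightarrow> complex) \<Rightarrow> bool" where
  "dec q h \<longleftrightarrow> (\<exists>K. \<forall>x. cmod (h x) \<le> K * bracket x powr (-q))"

lemma decE:
  assumes "dec q h"
  obtains K where "K \<ge> 0" "\<And>x. cmod (h x) \<le> K * bracket x powr (-q)"
proof -
  obtain K where K: "\<And>x. cmod (h x) \<le> K * bracket x powr (-q)" using assms by (auto simp: dec_def)
  have "0 \<le> K * bracket 0 powr (-q)" using K[of 0] norm_ge_zero[of "h 0"] by linarith
  then have "K \<ge> 0" by (simp add: bracket_def)
  then show thesis using K that by blast
qed

lemma dec_add: "dec q u \<Longrightarrow> dec q v \<Longrightarrow> dec q (\<lambda>x. u x + v x)"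
proof -
  assume "dec q u" "dec q v"
  then obtain K L where "\<And>x. cmod (u x) \<le> K * bracket x powr (-q)" "\<And>x. cmod (v x) \<le> L * bracket x powr (-q)"
    by (auto simp: dec_def)
  then have "cmod (u x + v x) \<le> (K + L) * bracket x powr (-q)" for x
    using norm_triangle_ineq[of "u x" "v x"] by (smt (verit) distrib_right)
  then show ?thesis by (auto simp: dec_def)
qed

lemma dec_cmult: "dec q u \<Longrightarrow> dec q (\<lambda>x. c * u x)"
proof -
  assume "dec q u"
  then obtain K where "\<And>x. cmod (u x) \<le> K * bracket x powr (-q)" by (auto simp: dec_def)
  then have "cmod (c * u x) \<le> (cmod c * K) * bracket x powr (-q)" for x
    by (simp add: norm_mult mult.assoc mult_left_mono)
  then show ?thesis by (auto simp: dec_def)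
qed

lemma dec_zero: "dec q (\<lambda>x. 0)"
  by (auto simp: dec_def intro: exI[of _ 0])

lemma dec_diff: "dec q u \<Longrightarrow> dec q v \<Longrightarrow> dec q (\<lambda>x. u x - v x)"
  using dec_add[of q u "\<lambda>x. - v x"] dec_cmult[of q v "-1"] by simp

lemma dec_sum: "finite A \<Longrightarrow> (\<And>i. i \<in> A \<Longrightarrow> dec q (u i)) \<Longrightarrow> dec q (\<lambda>x. \<Sum>i\<in>A. u i x)"
  by (induction A rule: finite_induct) (auto intro: dec_add dec_zero)

lemma dec_mono:
  assumes "dec q u" "p \<le> q"
  shows "dec p u"
proof -
  obtain K where K: "K \<ge> 0" "\<And>x. cmod (u x) \<le> K * bracket x powr (-q)" using assms(1) by (rule decE) auto
  have "cmod (u x) \<le> K * bracket x powr (-p)" for x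
  proof -
    have "bracket x powr (-q) \<le> bracket x powr (-p)" using bracket_ge[of x] assms(2) by (intro powr_mono) auto
    then show ?thesis using K by (meson mult_left_mono order.trans)
  qed
  then show ?thesis by (auto simp: dec_def)
qed

lemma dec_mult:
  assumes "dec p u" "dec q v"
  shows "dec (p + q) (\<lambda>x. u x * v x)"
proof -
  obtain K where K: "K \<ge> 0" "\<And>x. cmod (u x) \<le> K * bracket x powr (-p)" using assms(1) by (rule decE) auto
  obtain L where L: "L \<ge> 0" "\<And>x. cmod (v x) \<le> L * bracket x powr (-q)" using assms(2) by (rule decE) auto
  have "cmod (u x * v x) \<le> (K * L) * bracket x powr (-(p + q))" for x
  proof -
    have "cmod (u x * v x) \<le> (K * bracket x powr (-p)) * (L * bracket x powr (-q))"
      unfolding norm_mult using K L by (intro mult_mono) auto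
    also have "\<dots> = (K * L) * (bracket x powr (-p) * bracket x powr (-q))" by simp
    also have "bracket x powr (-p) * bracket x powr (-q) = bracket x powr (-(p + q))" by (simp flip: powr_add)
    finally show ?thesis .
  qed
  then show ?thesis unfolding dec_def by blast
qed

lemma dec_shift:
  assumes "dec q u" "q \<ge> 0"
  shows "dec q (\<lambda>x. u (x - a))"
proof -
  obtain K where K: "K \<ge> 0" "\<And>x. cmod (u x) \<le> K * bracket x powr (-q)" using assms(1) by (rule decE) auto
  have "cmod (u (x - a)) \<le> (K * (2 * bracket a) powr q) * bracket x powr (-q)" for x
  proof -
    have p: "2 * bracket a > 0" "bracket (x - a) > 0" using bracket_ge by auto
    have "(2 * bracket a * bracket (x - a)) powr (-q) \<le> bracket x powr (-q)"
      using bracket_shift[of x a] bracket_ge[of x] assms by (intro powr_mono2') auto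
    then have "(2 * bracket a) powr (-q) * bracket (x - a) powr (-q) \<le> bracket x powr (-q)"
      using p by (simp add: powr_mult)
    then have "(2 * bracket a) powr q * ((2 * bracket a) powr (-q) * bracket (x - a) powr (-q)) \<le> (2 * bracket a) powr q * bracket x powr (-q)"
      by (intro mult_left_mono) auto
    moreover have "(2 * bracket a) powr q * (2 * bracket a) powr (-q) = 1"
      using p by (subst powr_add[symmetric]) simp
    ultimately have "bracket (x - a) powr (-q) \<le> (2 * bracket a) powr q * bracket x powr (-q)"
      by (simp add: mult.assoc[symmetric])
    then have "K * bracket (x - a) powr (-q) \<le> K * ((2 * bracket a) powr q * bracket x powr (-q))"
      using K by (intro mult_left_mono)
    then show ?thesis using K(2)[of "x - a"] by (simp add: mult.assoc)
  qed
  then show ?thesis unfolding dec_def by blast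
qed

lemma dec_compact_support:
  assumes "continuous_on UNIV u" "\<And>x. norm x > R \<Longrightarrow> u x = 0"
  shows "dec q u"
proof -
  have "compact ((\<lambda>x. u x * of_real (bracket x powr q)) ` cball 0 R)"
  proof (rule compact_continuous_image)
    have "continuous_on (cball 0 R) bracket" unfolding bracket_def[abs_def] by (intro continuous_intros)
    then show "continuous_on (cball 0 R) (\<lambda>x. u x * of_real (bracket x powr q))"
      using continuous_on_subset[OF assms(1)] bracket_ge(3)
      by (intro continuous_intros) (auto simp: less_imp_neq[symmetric])
  qed auto
  then obtain B where B: "\<And>x. x \<in> cball 0 R \<Longrightarrow> cmod (u x * of_real (bracket x powr q)) \<le> B"
    using compact_imp_bounded by (fastforce simp: bounded_iff)
  have "cmod (u x) \<le> \<bar>B\<bar> * bracket x powr (-q)" for x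
  proof (cases "norm x \<le> R")
    case True
    then have "cmod (u x) * bracket x powr q \<le> \<bar>B\<bar>" using B[of x] by (simp add: norm_mult)
    then show ?thesis using bracket_ge(3)[of x] by (simp add: powr_minus field_simps)
  qed (use assms(2) in auto)
  then show ?thesis by (auto simp: dec_def)
qed

lemma sqnorm_dec_finite:
  assumes "dec q u" "q > 3/2"
  shows "sqnorm u < \<infinity>"
proof -
  obtain K where K: "K \<ge> 0" "\<And>x. cmod (u x) \<le> K * bracket x powr (-q)" using assms(1) by (rule decE) auto
  have "sqnorm u \<le> (\<integral>\<^sup>+x. ennreal (K\<^sup>2) * ennreal (bracket x powr (-(2*q))) \<partial>lborel)"
    unfolding sqnorm_def
  proof (rule nn_integral_mono)
    fix x
    have "(cmod (u x))\<^sup>2 \<le> (K * bracket x powr (-q))\<^sup>2" by (intro power_mono K) auto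
    also have "\<dots> = K\<^sup>2 * bracket x powr (-(2*q))"
      by (simp add: power_mult_distrib power2_eq_square flip: powr_add)
    finally show "ennreal ((cmod (u x))\<^sup>2) \<le> ennreal (K\<^sup>2) * ennreal (bracket x powr (-(2*q)))"
      by (subst ennreal_mult[symmetric]) (auto intro: ennreal_leI)
  qed
  also have "\<dots> < \<infinity>"
    using nn_integral_bracket_powr[of "2*q"] assms(2)
    by (subst nn_integral_cmult) (auto simp: ennreal_mult_less_top)
  finally show ?thesis .
qed

lemma integrable_dec:
  assumes "dec q u" "q > 3" and [measurable]: "u \<in> borel_measurable borel"
  shows "integrable lborel u"
proof (rule integrableI_bounded)
  obtain K where K: "K \<ge> 0" "\<And>x. cmod (u x) \<le> K * bracket x powr (-q)" using assms(1) by (rule decE) auto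
  have "(\<integral>\<^sup>+x. ennreal (cmod (u x)) \<partial>lborel) \<le> (\<integral>\<^sup>+x. ennreal K * ennreal (bracket x powr (-q)) \<partial>lborel)"
  proof (rule nn_integral_mono)
    fix x show "ennreal (cmod (u x)) \<le> ennreal K * ennreal (bracket x powr (-q))"
      using K by (subst ennreal_mult[symmetric]) (auto intro: ennreal_leI)
  qed
  also have "\<dots> < \<infinity>"
    using nn_integral_bracket_powr[of q] assms(2)
    by (subst nn_integral_cmult) (auto simp: ennreal_mult_less_top)
  finally show "(\<integral>\<^sup>+x. ennreal (cmod (u x)) \<partial>lborel) < \<infinity>" .
qed measurable

section \<open>The Plummer kernels\<close>

text \<open>A smooth substitute for |x|^(-q); q = 1 is the Plummer potential. Indexed by the order
  of decay: products add the indices, and a derivative gives a coordinate times the kernel of index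
  \<open>q + 2\<close>.\<close>

definition plummer :: "real \<Rightarrow> real \<Rightarrow> real^3 \<Rightarrow> real" where
  "plummer e q x = (e\<^sup>2 + (norm x)\<^sup>2) powr (- q / 2)"

lemma plummer_base_pos: "e > 0 \<Longrightarrow> 0 < e\<^sup>2 + (norm x)\<^sup>2"
  by (simp add: add_pos_nonneg)

lemma elem_plummer:
  assumes "e > 0"
  shows "elem (\<lambda>x. of_real (plummer e q x))"
proof -
  have "elem (\<lambda>x. of_real (e\<^sup>2) + of_real ((norm x)\<^sup>2))" by (intro elem_norm_sq elem.intros)
  then show ?thesis unfolding plummer_def
    by (intro elem_powr) (use assms plummer_base_pos in auto)
qed

lemma has_grad_plummer:
  assumes "e > 0"
  shows "has_grad (\<lambda>x. of_real (plummer e q x)) (\<lambda>j x. of_real (- q * (x $ j) * plummer e (q + 2) x))"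
proof -
  have "has_grad (\<lambda>x. of_real (e\<^sup>2) + (\<Sum>i\<in>UNIV. of_real (x $ i) * of_real (x $ i)))
     (\<lambda>j x. \<Sum>i\<in>UNIV. (if j = i then 2 * of_real (x $ i) else 0))"
    unfolding sum_3
  proof -
    have c: "has_grad (\<lambda>x. of_real (x $ i) * of_real (x $ i)) (\<lambda>j x. if j = i then 2 * of_real (x $ i) else 0)" for i
    proof -
      have "(\<lambda>j x. complex_of_real (x $ i) * (if j = i then 1 else 0) + (if j = i then 1 else 0) * complex_of_real (x $ i))
        = (\<lambda>j (x::real^3). if j = i then 2 * of_real (x $ i) else 0)"
        by (intro ext) auto
      then show ?thesis using has_grad_mult[OF has_grad_coord[of i] has_grad_coord[of i]] by (simp only:)
    qed
    show "has_grad (\<lambda>x. complex_of_real (e\<^sup>2) + (of_real (x $ 1) * of_real (x $ 1) + of_real (x $ 2) * of_real (x $ 2) + of_real (x $ 3) * of_real (x $ 3)))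
     (\<lambda>j x. (if j = 1 then 2 * of_real (x $ 1) else 0) + (if j = 2 then 2 * of_real (x $ 2) else 0) + (if j = 3 then 2 * of_real (x $ 3) else 0))"
      using has_grad_add[OF has_grad_const[of "complex_of_real (e\<^sup>2)"] has_grad_add[OF has_grad_add[OF c[of 1] c[of 2]] c[of 3]]]
      by simp
  qed
  then have q: "has_grad (\<lambda>x. of_real (e\<^sup>2 + (norm x)\<^sup>2)) (\<lambda>j x. 2 * of_real (x $ j))"
    unfolding norm_sq_vec3 by (simp add: power2_eq_square)
  have "((\<lambda>t. t powr (-q/2)) has_real_derivative (-q/2) * (e\<^sup>2 + (norm x)\<^sup>2) powr (-q/2 - 1)) (at (e\<^sup>2 + (norm x)\<^sup>2))" for x :: "real^3"
    by (rule has_real_derivative_powr) (rule plummer_base_pos[OF assms])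
  from has_grad_compose_real[where F="\<lambda>t. t powr (-q/2)" and F'="\<lambda>t. (-q/2) * t powr (-q/2 - 1)", OF this q]
  have "has_grad (\<lambda>x. of_real (plummer e q x)) (\<lambda>j x. of_real ((-q/2) * (e\<^sup>2 + (norm x)\<^sup>2) powr (-q/2 - 1)) * (2 * of_real (x $ j)))"
    by (simp add: plummer_def)
  moreover have "(\<lambda>j x. complex_of_real ((-q/2) * (e\<^sup>2 + (norm x)\<^sup>2) powr (-q/2 - 1)) * (2 * of_real (x $ j)))
    = (\<lambda>j x. of_real (- q * (x $ j) * plummer e (q + 2) x))"
  proof (intro ext)
    fix j and x :: "real^3"
    have "(- q / 2 - 1) = - (q + 2) / 2" by (simp add: field_simps)
    then show "complex_of_real ((-q/2) * (e\<^sup>2 + (norm x)\<^sup>2) powr (-q/2 - 1)) * (2 * of_real (x $ j)) = of_real (- q * (x $ j) * plummer e (q + 2) x)"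
      by (simp only: plummer_def) simp
  qed
  ultimately show ?thesis by simp
qed

lemma plummer_pos: "e > 0 \<Longrightarrow> plummer e q x > 0"
  using plummer_base_pos[of e x] by (simp add: plummer_def)

lemma plummer_add: "plummer e p x * plummer e q x = plummer e (p + q) x"
  by (simp add: plummer_def powr_add[symmetric] add_divide_distrib diff_divide_distrib)

lemma norm_le_plummer: "norm x \<le> plummer e (-1) x"
proof -
  have "plummer e (-1) x = sqrt (e\<^sup>2 + (norm x)\<^sup>2)" by (simp add: plummer_def powr_half_sqrt)
  also have "norm x \<le> \<dots>" by (rule real_le_rsqrt) simp
  finally show ?thesis .
qed

text \<open>A coordinate costs one order of decay, since it is dominated by the kernel of index
  -1.\<close>

lemma coord_plummer_le: "e > 0 \<Longrightarrow> \<bar>(x $ j) * plummer e (q + 1) x\<bar> \<le> plummer e q x"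
proof -
  assume e: "e > 0"
  have "\<bar>x $ j\<bar> \<le> plummer e (-1) x" using component_le_norm_cart[of x j] norm_le_plummer[of x e] by linarith
  then have "\<bar>x $ j\<bar> * plummer e (q + 1) x \<le> plummer e (-1) x * plummer e (q + 1) x"
    using plummer_pos[OF e, of "q+1" x] by (intro mult_right_mono) auto
  then show ?thesis using plummer_pos[OF e, of "q+1" x] by (simp add: plummer_add abs_mult)
qed

text \<open>The right side is free of \<open>e\<close>: every estimate that has to be uniform in the
  regularisation goes through this one.\<close>

lemma plummer_le_norm_powr:
  assumes "q \<ge> 0" "x \<noteq> 0"
  shows "plummer e q x \<le> norm x powr (-q)"
proof -
  have "plummer e q x \<le> ((norm x)\<^sup>2) powr (- q / 2)"
    unfolding plummer_def using assms by (intro powr_mono2') auto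
  also have "\<dots> = norm x powr (-q)"
    using assms by (simp add: powr_powr flip: powr_numeral)
  finally show ?thesis .
qed

text \<open>Here the constant depends on \<open>e\<close>; the bound serves to justify integrals at
  fixed \<open>e\<close>. It rests on e^2 + |x|^2 >= m (1 + |x|^2) with m = min 1 (e^2).\<close>

lemma dec_plummer:
  assumes "e > 0" "q \<ge> 0"
  shows "dec q (\<lambda>x. of_real (plummer e q x))"
proof -
  define m where "m = min 1 (e\<^sup>2)"
  have m: "m > 0" using assms by (simp add: m_def)
  have "cmod (of_real (plummer e q x)) \<le> m powr (-q/2) * bracket x powr (-q)" for x
  proof -
    have "m * (1 + (norm x)\<^sup>2) \<le> e\<^sup>2 + (norm x)\<^sup>2"
    proof -
      have "m * 1 \<le> e\<^sup>2" "m * (norm x)\<^sup>2 \<le> 1 * (norm x)\<^sup>2"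
        by (simp add: m_def, rule mult_right_mono) (simp_all add: m_def)
      then show ?thesis by (simp add: distrib_left)
    qed
    then have "plummer e q x \<le> (m * (1 + (norm x)\<^sup>2)) powr (-q/2)"
      unfolding plummer_def using m assms by (intro powr_mono2') (auto intro!: mult_pos_pos add_pos_nonneg)
    also have "\<dots> = m powr (-q/2) * bracket x powr (-q)"
      using m by (simp add: powr_mult bracket_powr)
    finally show ?thesis using plummer_pos[OF assms(1), of q x] by simp
  qed
  then show ?thesis unfolding dec_def by blast
qed

lemma dec_coord_plummer:
  assumes "e > 0" "q \<ge> 0"
  shows "dec q (\<lambda>x. of_real ((x $ j) * plummer e (q + 1) x))"
proof -
  obtain K where K: "\<And>x. cmod (of_real (plummer e q x)) \<le> K * bracket x powr (-q)"
    using dec_plummer[OF assms] by (auto simp: dec_def)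
  have "cmod (of_real ((x $ j) * plummer e (q + 1) x)) \<le> K * bracket x powr (-q)" for x
    using K[of x] coord_plummer_le[OF assms(1), of x j q] plummer_pos[OF assms(1), of q x]
    unfolding norm_of_real by linarith
  then show ?thesis by (auto simp: dec_def)
qed

section \<open>Algebra of the Dirac matrices\<close>

lemma vector_4:
  "(vector [x, y, z, w] :: 'a^4) $ 1 = (x::'a::zero)"
  "(vector [x, y, z, w] :: 'a^4) $ 2 = y"
  "(vector [x, y, z, w] :: 'a^4) $ 3 = z"
  "(vector [x, y, z, w] :: 'a^4) $ 4 = w"
  unfolding vector_def by simp_all

lemma dirac_alpha_eqs:
  "dirac_alpha 1 = vector [vector [0, 0, 0, 1], vector [0, 0, 1, 0], vector [0, 1, 0, 0], vector [1, 0, 0, 0]]"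
  "dirac_alpha 2 = vector [vector [0, 0, 0, -\<i>], vector [0, 0, \<i>, 0], vector [0, -\<i>, 0, 0], vector [\<i>, 0, 0, 0]]"
  "dirac_alpha 3 = vector [vector [0, 0, 1, 0], vector [0, 0, 0, -1], vector [1, 0, 0, 0], vector [0, -1, 0, 0]]"
  by (simp_all add: dirac_alpha_def pauli_def)

text \<open>The anticommutation relations, checked by evaluating every entry for every pair of
  matrices.\<close>

lemma clifford:
  "(\<Sum>a\<in>UNIV. dirac_alpha k $ c $ a * dirac_alpha j $ a $ b) + (\<Sum>a\<in>UNIV. dirac_alpha j $ c $ a * dirac_alpha k $ a $ b)
    = (if j = k \<and> b = c then 2 else 0)"
proof -
  have "\<forall>j k. \<forall>b c. (\<Sum>a\<in>UNIV. dirac_alpha k $ c $ a * dirac_alpha j $ a $ b) + (\<Sum>a\<in>UNIV. dirac_alpha j $ c $ a * dirac_alpha k $ a $ b)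
    = (if j = k \<and> b = c then 2 else 0)"
    unfolding forall_3 forall_4 sum_4 dirac_alpha_eqs vector_4 by simp
  then show ?thesis by blast
qed

lemma dirac_alpha_hermitian: "cnj (dirac_alpha j $ a $ b) = dirac_alpha j $ b $ a"
proof -
  have "\<forall>j a b. cnj (dirac_alpha j $ a $ b) = dirac_alpha j $ b $ a"
    unfolding forall_3 forall_4 dirac_alpha_eqs vector_4 by simp
  then show ?thesis by blast
qed

lemma norm_dirac_alpha_le: "cmod (dirac_alpha j $ a $ b) \<le> 1"
proof -
  have "\<forall>j a b. cmod (dirac_alpha j $ a $ b) \<le> 1"
    unfolding forall_3 forall_4 dirac_alpha_eqs vector_4 by simp
  then show ?thesis by blast
qed

subsection \<open>The weak Dirac equation\<close>

lemma tendsto_0_from_ennreal_sq: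
  fixes z :: "nat \<Rightarrow> complex"
  assumes "(\<lambda>n. ennreal ((cmod (z n))\<^sup>2)) \<longlonglongrightarrow> 0"
  shows "z \<longlonglongrightarrow> 0"
proof (rule tendstoI)
  fix e :: real assume e: "e > 0"
  then have "eventually (\<lambda>n. ennreal ((cmod (z n))\<^sup>2) < ennreal (e\<^sup>2)) sequentially"
    by (intro order_tendstoD(2)[OF assms]) simp
  then show "eventually (\<lambda>n. dist (z n) 0 < e) sequentially"
  proof eventually_elim
    case (elim n)
    then have "(cmod (z n))\<^sup>2 < e\<^sup>2" by (simp add: ennreal_less_iff)
    then show ?case using e by (simp add: power_less_imp_less_base)
  qed
qed

lemma dec_bracket_powr: "p = - q \<Longrightarrow> dec q (\<lambda>x. of_real (bracket x powr p))"
  by (auto simp: dec_def intro!: exI[of _ 1])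

text \<open>What the argument uses of the hypotheses: \<open>g\<close> stands for Q f, s <= 3/2
  gives the weight -3/2 for \<open>f\<close>, and s <= \<rho> - 1 gives the weight 1 for
  \<open>g\<close>. Both are Borel measurable, so that Fubini on \<open>lborel\<close> applies. The
  sign in \<open>weak\<close> is the one that results from moving D onto the test function.\<close>

locale dirac_weak =
  fixes f g :: "4 \<Rightarrow> real^3 \<Rightarrow> complex"
  assumes fm [measurable]: "\<And>b. f b \<in> borel_measurable borel"
    and gm [measurable]: "\<And>a. g a \<in> borel_measurable borel"
    and fw: "\<And>b. sqnorm (\<lambda>x. f b x * of_real (bracket x powr (-3/2))) < \<infinity>"
    and gw: "\<And>a. sqnorm (\<lambda>x. g a x * of_real (bracket x)) < \<infinity>"
    and weak: "\<And>a \<phi>. \<phi> \<in> test_functions \<Longrightarrow>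
      (\<Sum>j\<in>UNIV. \<Sum>b\<in>UNIV. dirac_alpha j $ a $ b * (LINT x|lborel. f b x * D_op j \<phi> x)) = (LINT x|lborel. g a x * \<phi> x)"
begin

text \<open>The weight of \<open>f\<close> uses up 3/2 of the decay of \<open>h\<close>; the
  remaining 5/2 exceeds the threshold 3/2 for square integrability.\<close>

lemma integrable_f:
  assumes h: "dec 4 h" and [measurable]: "h \<in> borel_measurable borel"
  shows "integrable lborel (\<lambda>x. f b x * h x)"
proof -
  have "dec (-3/2 + 4) (\<lambda>x. of_real (bracket x powr (3/2)) * h x)"
    by (rule dec_mult[OF dec_bracket_powr h]) simp
  then have "sqnorm (\<lambda>x. of_real (bracket x powr (3/2)) * h x) < \<infinity>"
    by (rule sqnorm_dec_finite) simp
  then have "integrable lborel (\<lambda>x. (f b x * of_real (bracket x powr (-3/2))) * (of_real (bracket x powr (3/2)) * h x))"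
    by (intro integrable_mult_sqnorm fw) measurable
  moreover have "(f b x * of_real (bracket x powr (-3/2))) * (of_real (bracket x powr (3/2)) * h x) = f b x * h x" for x
  proof -
    have "bracket x powr (-3/2) * bracket x powr (3/2) = 1"
      using bracket_ge(3)[of x] by (simp add: powr_add[symmetric])
    then have "complex_of_real (bracket x powr (-3/2)) * of_real (bracket x powr (3/2)) = 1"
      by (metis of_real_1 of_real_mult)
    then show ?thesis by (simp add: mult_ac)
  qed
  ultimately show ?thesis by (simp only:)
qed

text \<open>The weight of \<open>g\<close> raises the decay from 2 to 3, above the threshold
  3/2.\<close>

lemma integrable_g:
  assumes h: "dec 2 h" and [measurable]: "h \<in> borel_measurable borel"
  shows "integrable lborel (\<lambda>x. g a x * h x)"
proof -
  have "dec (1 + 2) (\<lambda>x. of_real (bracket x powr (-1)) * h x)"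
    by (rule dec_mult[OF dec_bracket_powr h]) simp
  then have "sqnorm (\<lambda>x. of_real (bracket x powr (-1)) * h x) < \<infinity>"
    by (rule sqnorm_dec_finite) simp
  then have "integrable lborel (\<lambda>x. (g a x * of_real (bracket x)) * (of_real (bracket x powr (-1)) * h x))"
    by (intro integrable_mult_sqnorm gw) measurable
  moreover have "(g a x * of_real (bracket x)) * (of_real (bracket x powr (-1)) * h x) = g a x * h x" for x
    using bracket_ge(3)[of x] by (simp add: powr_minus)
  ultimately show ?thesis by simp
qed

text \<open>The factor 1/i of \<open>D_op\<close> is moved to the right, which leaves plain partial
  derivatives.\<close>

lemma weak_elem:
  assumes "elem \<phi>" "has_grad \<phi> D" "\<And>x. norm x > R \<Longrightarrow> \<phi> x = 0"
  shows "(\<Sum>j\<in>UNIV. \<Sum>b\<in>UNIV. dirac_alpha j $ a $ b * (LINT x|lborel. f b x * D j x)) = \<i> * (LINT x|lborel. g a x * \<phi> x)"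
proof -
  have "closure {x. \<phi> x \<noteq> 0} \<subseteq> cball 0 R"
  proof (intro closure_minimal subsetI)
    fix x assume "x \<in> {x. \<phi> x \<noteq> 0}"
    then show "x \<in> cball 0 R" using assms(3)[of x] by (cases "norm x > R") auto
  qed simp
  then have "compact (closure {x. \<phi> x \<noteq> 0})"
    by (meson bounded_cball bounded_subset closed_closure compact_eq_bounded_closed)
  then have "\<phi> \<in> test_functions" using elem_smooth[OF assms(1)] by (simp add: test_functions_def)
  note e = weak[OF this, of a]
  have "\<i> * (LINT x|lborel. g a x * \<phi> x) = (\<Sum>j\<in>UNIV. \<Sum>b\<in>UNIV. \<i> * (dirac_alpha j $ a $ b * (LINT x|lborel. f b x * D_op j \<phi> x)))"
    unfolding e[symmetric] sum_distrib_left ..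
  also have "\<dots> = (\<Sum>j\<in>UNIV. \<Sum>b\<in>UNIV. dirac_alpha j $ a $ b * (LINT x|lborel. f b x * D j x))"
  proof (intro sum.cong refl)
    fix j :: 3 and b :: 4
    have "(LINT x|lborel. f b x * D_op j \<phi> x) = (LINT x|lborel. (1/\<i>) * (f b x * D j x))"
      by (simp add: D_op_def has_grad_partial_deriv[OF assms(2)] mult_ac)
    also have "\<dots> = (1/\<i>) * (LINT x|lborel. f b x * D j x)" by (rule integral_mult_right_zero)
    finally show "\<i> * (dirac_alpha j $ a $ b * (LINT x|lborel. f b x * D_op j \<phi> x)) = dirac_alpha j $ a $ b * (LINT x|lborel. f b x * D j x)"
      by (simp add: field_simps)
  qed
  finally show ?thesis by simp
qed

text \<open>The term in which the cutoff is differentiated lives on an annulus of radius \<open>n\<close>, where the weight \<open>-3/2\<close> is just critical.\<close>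

lemma weak_extended:
  fixes \<psi> :: "4 \<Rightarrow> real^3 \<Rightarrow> complex"
  assumes el: "\<And>a. elem (\<psi> a)" and gr: "\<And>a. has_grad (\<psi> a) (E a)"
    and cE: "\<And>a j. continuous_on UNIV (E a j)"
    and d2: "\<And>a. dec 2 (\<psi> a)"
    and d4: "\<And>b. dec 4 (\<lambda>x. \<Sum>a\<in>UNIV. \<Sum>j\<in>UNIV. dirac_alpha j $ a $ b * E a j x)"
  shows "(\<Sum>b\<in>UNIV. LINT x|lborel. f b x * (\<Sum>a\<in>UNIV. \<Sum>j\<in>UNIV. dirac_alpha j $ a $ b * E a j x))
    = \<i> * (\<Sum>a\<in>UNIV. LINT x|lborel. g a x * \<psi> a x)"
proof -
  \<comment> \<open>Decay of order 4 is available for this combination only. Single terms can be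
    paired with \<open>f\<close> while the cutoff is present, so the sums over \<open>a\<close> and
    \<open>j\<close> must be formed before the cutoff is removed.\<close>
  define P where "P = (\<lambda>b x. \<Sum>a\<in>UNIV. \<Sum>j\<in>UNIV. dirac_alpha j $ a $ b * E a j x)"
  have dP: "dec 4 (P b)" for b unfolding P_def by (rule d4)
  have cP: "continuous_on UNIV (P b)" for b unfolding P_def by (intro continuous_intros cE)
  have [measurable]: "P b \<in> borel_measurable borel" for b using cP by (rule borel_measurable_continuous_onI)
  have c\<psi>: "continuous_on UNIV (\<psi> a)" for a using gr has_grad_continuous by blast
  have [measurable]: "\<psi> a \<in> borel_measurable borel" for a using c\<psi> by (rule borel_measurable_continuous_onI)
  obtain cut Dc C where cut: "elem cut" "has_grad cut Dc" "\<And>x. norm x \<le> 1 \<Longrightarrow> cut x = 1"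
    "\<And>x. norm x \<ge> 2 \<Longrightarrow> cut x = 0" "\<And>x. cmod (cut x) \<le> 1" "C \<ge> 0" "\<And>j x. cmod (Dc j x) \<le> C"
    "\<And>j x. norm x < 1 \<or> norm x > 2 \<Longrightarrow> Dc j x = 0" "\<And>j. continuous_on UNIV (Dc j)"
    using cutoff_exists by metis
  define R where "R = (\<lambda>n. real (Suc n))"
  have R: "R n > 0" "R n \<ge> 1" for n by (auto simp: R_def)
  define c where "c = (\<lambda>n x. cut ((1 / R n) *\<^sub>R x))"
  define d where "d = (\<lambda>n j x. of_real (1 / R n) * Dc j ((1 / R n) *\<^sub>R x))"
  have c_el: "elem (c n)" for n unfolding c_def using elem_affine[OF cut(1), of "1 / R n" 0] by simp
  have c_gr: "has_grad (c n) (d n)" for n unfolding c_def d_def using has_grad_affine[OF cut(2), of "1 / R n" 0] by simp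
  have cc: "continuous_on UNIV (c n)" for n using c_gr has_grad_continuous by blast
  have cd: "continuous_on UNIV (d n j)" for n j
    unfolding d_def by (intro continuous_intros continuous_on_compose2[OF cut(9)]) auto
  have [measurable]: "c n \<in> borel_measurable borel" for n using cc by (rule borel_measurable_continuous_onI)
  have [measurable]: "d n j \<in> borel_measurable borel" for n j using cd by (rule borel_measurable_continuous_onI)
  have c1: "c n x = 1" if "norm x \<le> R n" for n x
    unfolding c_def by (rule cut(3)) (use that R[of n] in \<open>simp add: field_simps\<close>)
  have c0: "c n x = 0" if "norm x \<ge> 2 * R n" for n x
    unfolding c_def by (rule cut(4)) (use that R[of n] in \<open>simp add: field_simps\<close>)
  have d0: "d n j x = 0" if "norm x < R n \<or> norm x > 2 * R n" for n j x
  proof -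
    have "norm ((1 / R n) *\<^sub>R x) < 1 \<or> norm ((1 / R n) *\<^sub>R x) > 2"
      using that R[of n] by (simp add: field_simps)
    from cut(8)[OF this] show ?thesis by (simp add: d_def)
  qed
  have dC: "cmod (d n j x) \<le> C / R n" for n j x
    using cut(7)[of j "(1 / R n) *\<^sub>R x"] R[of n] by (simp add: d_def norm_mult norm_divide field_simps)
  have cn: "cmod (c n x) \<le> 1" for n x unfolding c_def by (rule cut(5))
  have clim: "(\<lambda>n. c n x) \<longlonglongrightarrow> 1" for x
  proof (rule tendsto_eventually)
    obtain N :: nat where "norm x \<le> real N" using real_arch_simple by blast
    then show "eventually (\<lambda>n. c n x = 1) sequentially"
      by (auto simp: eventually_sequentially R_def intro!: exI[of _ N] c1)
  qed
  have i1: "integrable lborel (\<lambda>x. f b x * (c n x * E a j x))" for a b j n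
    by (intro integrable_f borel_measurable_continuous_onI dec_compact_support[where R="2 * R n"])
       (auto intro!: continuous_intros cE cc simp: c0)
  have i2: "integrable lborel (\<lambda>x. f b x * (d n j x * \<psi> a x))" for a b j n
    by (intro integrable_f borel_measurable_continuous_onI dec_compact_support[where R="2 * R n"])
       (auto intro!: continuous_intros cd c\<psi> simp: d0)
  \<comment> \<open>The weak equation tested with \<open>c n\<close> times \<open>\<psi> a\<close>,
    split by the product rule into the part with the cutoff intact and the part with the cutoff
    differentiated.\<close>
  have step: "(\<Sum>b\<in>UNIV. LINT x|lborel. f b x * (c n x * P b x))
      + (\<Sum>a\<in>UNIV. \<Sum>j\<in>UNIV. \<Sum>b\<in>UNIV. dirac_alpha j $ a $ b * (LINT x|lborel. f b x * (d n j x * \<psi> a x)))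
      = \<i> * (\<Sum>a\<in>UNIV. LINT x|lborel. g a x * (c n x * \<psi> a x))" for n
  proof -
    have "\<i> * (\<Sum>a\<in>UNIV. LINT x|lborel. g a x * (c n x * \<psi> a x))
      = (\<Sum>a\<in>UNIV. \<Sum>j\<in>UNIV. \<Sum>b\<in>UNIV. dirac_alpha j $ a $ b * (LINT x|lborel. f b x * (c n x * E a j x + d n j x * \<psi> a x)))"
      unfolding sum_distrib_left
    proof (intro sum.cong refl)
      fix a
      show "\<i> * (LINT x|lborel. g a x * (c n x * \<psi> a x)) = (\<Sum>j\<in>UNIV. \<Sum>b\<in>UNIV. dirac_alpha j $ a $ b * (LINT x|lborel. f b x * (c n x * E a j x + d n j x * \<psi> a x)))"
        by (rule weak_elem[symmetric, where R="2 * R n"]) (auto intro: elem_mult c_el el has_grad_mult c_gr gr simp: c0)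
    qed
    also have "\<dots> = (\<Sum>a\<in>UNIV. \<Sum>j\<in>UNIV. \<Sum>b\<in>UNIV. dirac_alpha j $ a $ b * (LINT x|lborel. f b x * (c n x * E a j x)))
      + (\<Sum>a\<in>UNIV. \<Sum>j\<in>UNIV. \<Sum>b\<in>UNIV. dirac_alpha j $ a $ b * (LINT x|lborel. f b x * (d n j x * \<psi> a x)))"
    proof -
      have "(LINT x|lborel. f b x * (c n x * E a j x + d n j x * \<psi> a x))
        = (LINT x|lborel. f b x * (c n x * E a j x)) + (LINT x|lborel. f b x * (d n j x * \<psi> a x))" for a j b
        unfolding distrib_left by (rule Bochner_Integration.integral_add[OF i1 i2])
      then show ?thesis by (simp add: distrib_left sum.distrib)
    qed
    also have "(\<Sum>a\<in>UNIV. \<Sum>j\<in>UNIV. \<Sum>b\<in>UNIV. dirac_alpha j $ a $ b * (LINT x|lborel. f b x * (c n x * E a j x)))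
      = (\<Sum>b\<in>UNIV. \<Sum>a\<in>UNIV. \<Sum>j\<in>UNIV. dirac_alpha j $ a $ b * (LINT x|lborel. f b x * (c n x * E a j x)))"
      by (subst (2) sum.swap, subst sum.swap) (rule refl)
    also have "\<dots> = (\<Sum>b\<in>UNIV. LINT x|lborel. f b x * (c n x * P b x))"
    proof (intro sum.cong refl)
      fix b
      have "(LINT x|lborel. f b x * (c n x * P b x)) = (LINT x|lborel. (\<Sum>a\<in>UNIV. \<Sum>j\<in>UNIV. dirac_alpha j $ a $ b * (f b x * (c n x * E a j x))))"
        by (simp add: P_def sum_distrib_left mult_ac)
      also have "\<dots> = (\<Sum>a\<in>UNIV. \<Sum>j\<in>UNIV. dirac_alpha j $ a $ b * (LINT x|lborel. f b x * (c n x * E a j x)))"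
        using i1 by (simp add: Bochner_Integration.integral_sum)
      finally show "(\<Sum>a\<in>UNIV. \<Sum>j\<in>UNIV. dirac_alpha j $ a $ b * (LINT x|lborel. f b x * (c n x * E a j x))) = (LINT x|lborel. f b x * (c n x * P b x))" ..
    qed
    finally show ?thesis by simp
  qed
  have T1: "(\<lambda>n. LINT x|lborel. f b x * (c n x * P b x)) \<longlonglongrightarrow> (LINT x|lborel. f b x * P b x)" for b
  proof (rule integral_dominated_convergence[where w="\<lambda>x. cmod (f b x * P b x)"])
    show "integrable lborel (\<lambda>x. cmod (f b x * P b x))"
      using integrable_f[OF dP[of b]] by simp
    show "AE x in lborel. (\<lambda>n. f b x * (c n x * P b x)) \<longlonglongrightarrow> f b x * P b x"
    proof (rule AE_I2)
      fix x
      have "(\<lambda>n. f b x * (c n x * P b x)) \<longlonglongrightarrow> f b x * (1 * P b x)" by (intro tendsto_mult tendsto_const clim)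
      then show "(\<lambda>n. f b x * (c n x * P b x)) \<longlonglongrightarrow> f b x * P b x" by simp
    qed
    show "AE x in lborel. norm (f b x * (c n x * P b x)) \<le> cmod (f b x * P b x)" for n
    proof (rule AE_I2)
      fix x show "norm (f b x * (c n x * P b x)) \<le> cmod (f b x * P b x)"
        using mult_left_le_one_le[of "cmod (f b x * P b x)" "cmod (c n x)"] cn[of n x] by (simp add: norm_mult mult_ac)
    qed
  qed measurable
  have T3: "(\<lambda>n. LINT x|lborel. g a x * (c n x * \<psi> a x)) \<longlonglongrightarrow> (LINT x|lborel. g a x * \<psi> a x)" for a
  proof (rule integral_dominated_convergence[where w="\<lambda>x. cmod (g a x * \<psi> a x)"])
    show "integrable lborel (\<lambda>x. cmod (g a x * \<psi> a x))"
      using integrable_g[OF d2[of a]] by simp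
    show "AE x in lborel. (\<lambda>n. g a x * (c n x * \<psi> a x)) \<longlonglongrightarrow> g a x * \<psi> a x"
    proof (rule AE_I2)
      fix x
      have "(\<lambda>n. g a x * (c n x * \<psi> a x)) \<longlonglongrightarrow> g a x * (1 * \<psi> a x)" by (intro tendsto_mult tendsto_const clim)
      then show "(\<lambda>n. g a x * (c n x * \<psi> a x)) \<longlonglongrightarrow> g a x * \<psi> a x" by simp
    qed
    show "AE x in lborel. norm (g a x * (c n x * \<psi> a x)) \<le> cmod (g a x * \<psi> a x)" for n
    proof (rule AE_I2)
      fix x show "norm (g a x * (c n x * \<psi> a x)) \<le> cmod (g a x * \<psi> a x)"
        using mult_left_le_one_le[of "cmod (g a x * \<psi> a x)" "cmod (c n x)"] cn[of n x] by (simp add: norm_mult mult_ac)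
    qed
  qed measurable
  have T2: "(\<lambda>n. LINT x|lborel. f b x * (d n j x * \<psi> a x)) \<longlonglongrightarrow> 0" for a b j
  proof (rule tendsto_0_from_ennreal_sq)
    obtain K where K: "K \<ge> 0" "\<And>x. cmod (\<psi> a x) \<le> K * bracket x powr (-2)" using d2[of a] by (rule decE) auto
    \<comment> \<open>\<open>F n\<close> holds the weighted tail of \<open>f\<close>, which tends to
      0 in norm, and \<open>H n\<close> everything else, with the inverse weight, which stays merely
      bounded.\<close>
    define F where "F = (\<lambda>n x. indicator {x. R n \<le> norm x} x * (f b x * of_real (bracket x powr (-3/2))) :: complex)"
    define H where "H = (\<lambda>n x. of_real (bracket x powr (3/2)) * (d n j x * \<psi> a x))"
    have [measurable]: "F n \<in> borel_measurable borel" "H n \<in> borel_measurable borel" for n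
      unfolding F_def H_def by measurable
    \<comment> \<open>On the annulus the square of \<open>H n\<close> is at most (C K)^2 R^-3: R^-2
      from the cutoff gradient and R^-1 from the weight 3/2 against the decay 2. The open ball of
      radius 3 R, of volume proportional to 27 R^3, contains the annulus, so the powers of R
      cancel.\<close>
    define M where "M = (C * K)\<^sup>2 * (unit_ball_vol 3 * 3^3)"
    have Hb: "sqnorm (H n) \<le> ennreal M" for n
    proof -
      have "sqnorm (H n) \<le> (\<integral>\<^sup>+x. ennreal ((C * K)\<^sup>2 / R n ^ 3) * indicator (ball (0::real^3) (3 * R n)) x \<partial>lborel)"
        unfolding sqnorm_def
      proof (rule nn_integral_mono)
        fix x
        show "ennreal ((cmod (H n x))\<^sup>2) \<le> ennreal ((C * K)\<^sup>2 / R n ^ 3) * indicator (ball 0 (3 * R n)) x"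
        proof (cases "R n \<le> norm x \<and> norm x \<le> 2 * R n")
          case True
          have bR: "bracket x \<ge> R n" using bracket_ge(2)[of x] True by linarith
          have "cmod (H n x) \<le> bracket x powr (3/2) * ((C / R n) * (K * bracket x powr (-2)))"
            unfolding H_def norm_mult using dC[of n j x] K(2)[of x] cut(6) R[of n]
            by (intro mult_mono) (auto intro!: mult_nonneg_nonneg K)
          also have "\<dots> = (C * K / R n) * (bracket x powr (3/2) * bracket x powr (-2))" by simp
          also have "bracket x powr (3/2) * bracket x powr (-2) = bracket x powr (-1/2)" by (simp flip: powr_add)
          finally have "(cmod (H n x))\<^sup>2 \<le> ((C * K / R n) * bracket x powr (-1/2))\<^sup>2" by (intro power_mono) auto
          also have "\<dots> = (C * K / R n)\<^sup>2 * bracket x powr (-1)"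
            unfolding power_mult_distrib by (simp add: power2_eq_square flip: powr_add)
          also have "\<dots> \<le> (C * K / R n)\<^sup>2 * R n powr (-1)"
            using bR R[of n] by (intro mult_left_mono powr_mono2') auto
          also have "\<dots> = (C * K)\<^sup>2 / R n ^ 3"
            using R[of n] by (simp add: powr_minus power_divide power_mult_distrib field_simps power2_eq_square power3_eq_cube)
          finally show ?thesis using True R[of n] by (auto intro: ennreal_leI)
        next
          case False
          then have "d n j x = 0" by (intro d0) auto
          then show ?thesis by (simp add: H_def)
        qed
      qed
      also have "\<dots> = ennreal ((C * K)\<^sup>2 / R n ^ 3) * ennreal (unit_ball_vol 3 * (3 * R n)^3)"
        using R[of n] by (subst nn_integral_cmult_indicator) (auto simp: emeasure_ball3)
      also have "\<dots> = ennreal M"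
        using R[of n] by (subst ennreal_mult[symmetric]) (auto simp: M_def power_mult_distrib)
      finally show ?thesis .
    qed
    have bound: "ennreal ((cmod (LINT x|lborel. f b x * (d n j x * \<psi> a x)))\<^sup>2) \<le> ennreal M * sqnorm (F n)" for n
    proof -
      have "f b x * (d n j x * \<psi> a x) = F n x * H n x" for x
      proof (cases "R n \<le> norm x")
        case True
        have "bracket x powr (-3/2) * bracket x powr (3/2) = 1"
          using bracket_ge(3)[of x] by (simp add: powr_add[symmetric])
        then have "complex_of_real (bracket x powr (-3/2)) * of_real (bracket x powr (3/2)) = 1"
          by (metis of_real_1 of_real_mult)
        moreover have "(u * p) * (q * v) = u * (p * q) * v" for u p q v :: complex by simp
        ultimately show ?thesis using True by (simp only: F_def H_def) simp
      next
        case False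
        then show ?thesis by (simp add: F_def d0)
      qed
      then have "ennreal ((cmod (LINT x|lborel. f b x * (d n j x * \<psi> a x)))\<^sup>2) \<le> sqnorm (F n) * sqnorm (H n)"
        using sqnorm_integrable_mult_le[of "F n" "H n"] by simp
      also have "\<dots> \<le> sqnorm (F n) * ennreal M" by (intro mult_left_mono Hb) auto
      finally show ?thesis by (simp add: mult.commute)
    qed
    have "(\<lambda>n. \<integral>\<^sup>+x. ennreal ((cmod (F n x))\<^sup>2) \<partial>lborel) \<longlonglongrightarrow> (\<integral>\<^sup>+x. 0 \<partial>(lborel :: (real^3) measure))"
    proof (rule nn_integral_dominated_convergence[where w="\<lambda>x. ennreal ((cmod (f b x * of_real (bracket x powr (-3/2))))\<^sup>2)"])
      show "(\<integral>\<^sup>+x. ennreal ((cmod (f b x * of_real (bracket x powr (-3/2))))\<^sup>2) \<partial>lborel) < \<infinity>"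
        using fw[of b] by (simp add: sqnorm_def)
      show "AE x in lborel. ennreal ((cmod (F n x))\<^sup>2) \<le> ennreal ((cmod (f b x * of_real (bracket x powr (-3/2))))\<^sup>2)" for n
        by (rule AE_I2) (simp add: F_def indicator_def)
      show "AE x in lborel. (\<lambda>n. ennreal ((cmod (F n x))\<^sup>2)) \<longlonglongrightarrow> 0"
      proof (rule AE_I2, rule tendsto_eventually)
        fix x :: "real^3"
        obtain N :: nat where "norm x < real N" using reals_Archimedean2 by blast
        then show "eventually (\<lambda>n. ennreal ((cmod (F n x))\<^sup>2) = 0) sequentially"
          by (auto simp: eventually_sequentially R_def F_def intro!: exI[of _ N])
      qed
    qed measurable
    then have "(\<lambda>n. sqnorm (F n)) \<longlonglongrightarrow> 0" by (simp add: sqnorm_def)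
    from ennreal_tendsto_cmult[OF _ this, of "ennreal M"]
    have lim: "(\<lambda>n. ennreal M * sqnorm (F n)) \<longlonglongrightarrow> 0" by simp
    show "(\<lambda>n. ennreal ((cmod (LINT x|lborel. f b x * (d n j x * \<psi> a x)))\<^sup>2)) \<longlonglongrightarrow> 0"
      by (rule tendsto_sandwich[OF _ _ tendsto_const lim]) (use bound in \<open>auto intro: always_eventually\<close>)
  qed
  have "(\<lambda>n. (\<Sum>b\<in>UNIV. LINT x|lborel. f b x * (c n x * P b x))
      + (\<Sum>a\<in>UNIV. \<Sum>j\<in>UNIV. \<Sum>b\<in>UNIV. dirac_alpha j $ a $ b * (LINT x|lborel. f b x * (d n j x * \<psi> a x))))
    \<longlonglongrightarrow> (\<Sum>b\<in>UNIV. LINT x|lborel. f b x * P b x) + (\<Sum>a\<in>(UNIV::4 set). \<Sum>j\<in>UNIV. \<Sum>b\<in>UNIV. dirac_alpha j $ a $ b * 0)"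
    by (intro tendsto_add tendsto_sum tendsto_mult tendsto_const T1 T2)
  moreover have "(\<lambda>n. \<i> * (\<Sum>a\<in>UNIV. LINT x|lborel. g a x * (c n x * \<psi> a x))) \<longlonglongrightarrow> \<i> * (\<Sum>a\<in>UNIV. LINT x|lborel. g a x * \<psi> a x)"
    by (intro tendsto_mult tendsto_sum tendsto_const T3)
  ultimately have "(\<Sum>b\<in>UNIV. LINT x|lborel. f b x * P b x) + (\<Sum>a\<in>(UNIV::4 set). \<Sum>j\<in>UNIV. \<Sum>b\<in>UNIV. dirac_alpha j $ a $ b * 0)
     = \<i> * (\<Sum>a\<in>UNIV. LINT x|lborel. g a x * \<psi> a x)"
    unfolding step by (rule LIMSEQ_unique)
  then show ?thesis by (simp add: P_def)
qed

end

section \<open>The Plummer mollifier\<close>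

text \<open>The Plummer density, equal to e^-3 times \<open>eta 1\<close> at z / e. It is even, so
  \<open>corr (eta e)\<close> is an ordinary mollification.\<close>

definition eta :: "real \<Rightarrow> real^3 \<Rightarrow> complex" where
  "eta e z = of_real (e\<^sup>2 * plummer e 5 z)"

text \<open>The common mass of all \<open>eta e\<close>. The mollifier is left unnormalised and the
  mass (4 pi / 3) is never computed; positivity is what allows dividing by it.\<close>

definition ceta :: real where
  "ceta = enn2real (\<integral>\<^sup>+z. ennreal (cmod (eta 1 z)) \<partial>lborel)"

lemma plummer_measurable [measurable]: "plummer e q \<in> borel_measurable borel"
  unfolding plummer_def[abs_def] by measurable

lemma eta_measurable [measurable]: "eta e \<in> borel_measurable borel"
  unfolding eta_def[abs_def] by measurable

lemma dec_eta: "e > 0 \<Longrightarrow> dec 5 (eta e)"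
  using dec_cmult[OF dec_plummer[of e 5], of "of_real (e\<^sup>2)"] by (simp add: eta_def[abs_def])

lemma norm_eta: "e > 0 \<Longrightarrow> cmod (eta e z) = e\<^sup>2 * plummer e 5 z"
  using plummer_pos[of e 5 z] by (simp add: eta_def norm_mult norm_power)

lemma integrable_eta: "e > 0 \<Longrightarrow> integrable lborel (eta e)"
  by (rule integrable_dec[OF dec_eta]) auto

lemma nn_integral_eta_1: "(\<integral>\<^sup>+z. ennreal (cmod (eta 1 z)) \<partial>lborel) = ennreal ceta"
  using integrable_eta[of 1] by (simp add: ceta_def integrable_iff_bounded)

text \<open>Scale invariance: the dilation contributes e^3, the prefactor e^2 and the kernel of
  index 5 contributes e^-5.\<close>

lemma nn_integral_eta:
  assumes e: "e > 0"
  shows "(\<integral>\<^sup>+z. ennreal (cmod (eta e z)) \<partial>lborel) = ennreal ceta"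
proof -
  have "(\<integral>\<^sup>+z. ennreal (cmod (eta e z)) \<partial>lborel) = ennreal (e^3) * (\<integral>\<^sup>+z. ennreal (cmod (eta e (e *\<^sub>R z))) \<partial>lborel)"
    by (rule nn_integral_dilate[OF _ e]) measurable
  also have "\<dots> = (\<integral>\<^sup>+z. ennreal (e^3) * ennreal (cmod (eta e (e *\<^sub>R z))) \<partial>lborel)"
    by (rule nn_integral_cmult[symmetric]) measurable
  also have "\<dots> = (\<integral>\<^sup>+z. ennreal (cmod (eta 1 z)) \<partial>lborel)"
  proof (rule nn_integral_cong)
    fix z :: "real^3"
    have "e\<^sup>2 + (norm (e *\<^sub>R z))\<^sup>2 = e\<^sup>2 * (1 + (norm z)\<^sup>2)" by (simp add: power_mult_distrib algebra_simps)
    then have "plummer e 5 (e *\<^sub>R z) = (e\<^sup>2) powr (-5/2) * plummer 1 5 z"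
      by (simp add: plummer_def powr_mult)
    also have "(e\<^sup>2) powr (-5/2) = e powr (-5)" using e by (simp add: powr_powr flip: powr_numeral)
    finally have pe: "plummer e 5 (e *\<^sub>R z) = e powr (-5) * plummer 1 5 z" .
    have "e^3 * e\<^sup>2 = e powr 5" using e by (simp add: powr_numeral power_add[symmetric])
    moreover have "e powr 5 * e powr (-5) = 1" using e powr_add[of e 5 "-5"] by simp
    moreover have "e^3 * (e\<^sup>2 * plummer e 5 (e *\<^sub>R z)) = (e^3 * e\<^sup>2) * e powr (-5) * plummer 1 5 z"
      by (simp only: pe mult.assoc)
    ultimately have "e^3 * (e\<^sup>2 * plummer e 5 (e *\<^sub>R z)) = plummer 1 5 z" by (simp only: mult_1_left)
    then show "ennreal (e^3) * ennreal (cmod (eta e (e *\<^sub>R z))) = ennreal (cmod (eta 1 z))"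
      using e by (subst ennreal_mult[symmetric]) (auto simp: norm_eta plummer_pos[THEN less_imp_le])
  qed
  finally show ?thesis by (simp add: nn_integral_eta_1)
qed

lemma ceta_pos: "ceta > 0"
proof (rule ccontr)
  assume "\<not> ceta > 0"
  then have "(\<integral>\<^sup>+z. ennreal (cmod (eta 1 z)) \<partial>lborel) = 0" by (simp add: nn_integral_eta_1 ennreal_neg)
  then have "AE z in lborel. ennreal (cmod (eta 1 z)) = 0" by (subst (asm) nn_integral_0_iff_AE) auto
  then have "AE z in (lborel :: (real^3) measure). False"
    by eventually_elim (use plummer_pos[of 1 5] in \<open>auto simp: eta_def less_le\<close>)
  then show False
    using ae_filter_eq_bot_iff[of "lborel :: (real^3) measure"] by (simp add: eventually_False emeasure_lborel_UNIV)
qed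

lemma integral_eta: "e > 0 \<Longrightarrow> (LINT z|lborel. eta e z) = of_real ceta"
proof -
  assume e: "e > 0"
  have "(LINT z|lborel. eta e z) = of_real (LINT z|lborel. cmod (eta e z))"
  proof -
    have "eta e z = of_real (cmod (eta e z))" for z
      using norm_eta[OF e, of z] by (simp only: eta_def)
    then have "(LINT z|lborel. eta e z) = (LINT z|lborel. of_real (cmod (eta e z)))" by (rule Bochner_Integration.integral_cong[OF refl])
    then show ?thesis by (simp only: integral_complex_of_real)
  qed
  also have "(LINT z|lborel. cmod (eta e z)) = ceta"
    using nn_integral_eta[OF e] ceta_pos by (subst integral_eq_nn_integral) auto
  finally show ?thesis .
qed

abbreviation width :: "nat \<Rightarrow> real" where "width n \<equiv> 1 / real (Suc n)"

lemma eta_tail: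
  assumes "e > 0" "r > 0" "norm z \<ge> r"
  shows "cmod (eta e z) \<le> e\<^sup>2 * norm z powr (-5)"
proof -
  have "z \<noteq> 0" using assms by auto
  then show ?thesis using assms(1) plummer_le_norm_powr[of 5 z e] by (simp add: norm_eta mult_left_mono)
qed

text \<open>Near the origin the modulus of continuity is small, uniformly in the width; away from it
  the modulus is bounded and the tail of \<open>eta e\<close> carries a factor e^2.\<close>

lemma eta_mollify:
  assumes [measurable]: "u \<in> borel_measurable borel" and fin: "sqnorm u < \<infinity>"
  shows "(\<lambda>n. sqnorm (\<lambda>x. corr (eta (width n)) u x - of_real ceta * u x)) \<longlonglongrightarrow> 0"
proof (rule tendsto_zero_ennreal)
  fix \<delta> :: real assume \<delta>: "\<delta> > 0"
  obtain S where S: "S \<ge> 0" "sqnorm u = ennreal S" using fin by (cases "sqnorm u") auto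
  \<comment> \<open>The mass \<open>ceta\<close> enters twice, once from Cauchy-Schwarz and once
    from integrating \<open>eta\<close> against the small modulus; this leaves \<delta> / 2 for the
    near part.\<close>
  define \<delta>' where "\<delta>' = \<delta> / (2 * ceta\<^sup>2)"
  have \<delta>': "\<delta>' > 0" using \<delta> ceta_pos by (simp add: \<delta>'_def)
  obtain r where r: "r > 0" "\<And>z. norm z < r \<Longrightarrow> modulus u z \<le> ennreal \<delta>'"
    using modulus_tendsto_0[OF assms \<delta>'] by auto
  define K where "K = 8 * unit_ball_vol 3 / (1 - 2 powr (3 - 5 :: real)) * r powr (3 - 5)"
  have K: "K \<ge> 0" using r powr_less_one[of 2 "3 - 5 :: real"] by (auto simp: K_def intro!: mult_nonneg_nonneg divide_nonneg_nonneg)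
  have bound: "sqnorm (\<lambda>x. corr (eta e) u x - of_real ceta * u x) \<le> ennreal (\<delta>/2 + ceta * (4 * S * K) * e\<^sup>2)"
    if e: "e > 0" for e
  proof -
    have "(\<integral>\<^sup>+z. ennreal (cmod (eta e z)) * modulus u z \<partial>lborel)
      \<le> (\<integral>\<^sup>+z. ennreal \<delta>' * ennreal (cmod (eta e z)) + ennreal (4 * S * e\<^sup>2) * (ennreal (norm z powr (-5)) * indicator {z. r \<le> norm z} z) \<partial>lborel)"
    proof (rule nn_integral_mono)
      fix z :: "real^3"
      show "ennreal (cmod (eta e z)) * modulus u z \<le> ennreal \<delta>' * ennreal (cmod (eta e z)) + ennreal (4 * S * e\<^sup>2) * (ennreal (norm z powr (-5)) * indicator {z. r \<le> norm z} z)"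
      proof (cases "norm z < r")
        case True
        have "ennreal (cmod (eta e z)) * modulus u z \<le> ennreal (cmod (eta e z)) * ennreal \<delta>'"
          by (intro mult_left_mono r True) simp
        then show ?thesis using True by (simp add: mult.commute)
      next
        case False
        have "modulus u z \<le> 4 * ennreal S" using modulus_le[of u z] by (simp add: S)
        also have "\<dots> = ennreal (4 * S)" using S by (simp add: ennreal_mult)
        finally have "ennreal (cmod (eta e z)) * modulus u z \<le> ennreal (e\<^sup>2 * norm z powr (-5)) * ennreal (4 * S)"
          using eta_tail[OF e r(1), of z] False by (intro mult_mono ennreal_leI) auto
        also have "\<dots> = ennreal ((4 * S * e\<^sup>2) * norm z powr (-5))"
          using S by (subst ennreal_mult[symmetric]) (auto simp: mult_ac)
        also have "\<dots> = ennreal (4 * S * e\<^sup>2) * (ennreal (norm z powr (-5)) * indicator {z. r \<le> norm z} z)"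
          using S False by (subst ennreal_mult) auto
        finally show ?thesis by (simp add: add_increasing)
      qed
    qed
    also have "\<dots> = ennreal \<delta>' * ennreal ceta + ennreal (4 * S * e\<^sup>2) * (\<integral>\<^sup>+z. ennreal (norm (z::real^3) powr (-5)) * indicator {z. r \<le> norm z} z \<partial>lborel)"
      by (subst nn_integral_add, measurable, subst (1 2) nn_integral_cmult, measurable) (simp add: nn_integral_eta[OF e])
    also have "\<dots> \<le> ennreal \<delta>' * ennreal ceta + ennreal (4 * S * e\<^sup>2) * ennreal K"
      using nn_integral_norm_powr_outside[of 5 r] r by (intro add_left_mono mult_left_mono) (auto simp: K_def)
    also have "\<dots> = ennreal (\<delta>' * ceta + 4 * S * e\<^sup>2 * K)"
      using \<delta>' ceta_pos S K by (subst (1 2) ennreal_mult[symmetric]) (auto simp: ennreal_plus[symmetric] simp del: ennreal_plus)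
    finally have m: "(\<integral>\<^sup>+z. ennreal (cmod (eta e z)) * modulus u z \<partial>lborel) \<le> ennreal (\<delta>' * ceta + 4 * S * e\<^sup>2 * K)" .
    have "sqnorm (\<lambda>x. corr (eta e) u x - of_real ceta * u x) \<le> ennreal ceta * (\<integral>\<^sup>+z. ennreal (cmod (eta e z)) * modulus u z \<partial>lborel)"
      using sqnorm_corr_diff_le[OF assms(1) integrable_eta[OF e]] by (simp add: nn_integral_eta[OF e] integral_eta[OF e])
    also have "\<dots> \<le> ennreal ceta * ennreal (\<delta>' * ceta + 4 * S * e\<^sup>2 * K)"
      by (intro mult_left_mono m) simp
    also have "\<dots> = ennreal (ceta * (\<delta>' * ceta + 4 * S * e\<^sup>2 * K))"
      using ceta_pos \<delta>' S K by (subst ennreal_mult[symmetric]) auto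
    also have "ceta * (\<delta>' * ceta + 4 * S * e\<^sup>2 * K) = \<delta>/2 + ceta * (4 * S * K) * e\<^sup>2"
      using ceta_pos by (simp add: \<delta>'_def field_simps power2_eq_square)
    finally show ?thesis .
  qed
  have "(\<lambda>n. \<delta>/2 + ceta * (4 * S * K) * (width n)\<^sup>2) \<longlonglongrightarrow> \<delta>/2 + ceta * (4 * S * K) * 0\<^sup>2"
    by (intro tendsto_intros LIMSEQ_Suc[OF lim_1_over_n])
  from order_tendstoD(2)[OF this, of \<delta>]
  have "eventually (\<lambda>n. \<delta>/2 + ceta * (4 * S * K) * (width n)\<^sup>2 < \<delta>) sequentially"
    using \<delta> by simp
  then show "eventually (\<lambda>n. sqnorm (\<lambda>x. corr (eta (width n)) u x - of_real ceta * u x) < ennreal \<delta>) sequentially"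
  proof eventually_elim
    case (elim n)
    have "ennreal (\<delta>/2 + ceta * (4 * S * K) * (width n)\<^sup>2) < ennreal \<delta>"
      using \<delta> elim by (subst ennreal_less_iff) (use ceta_pos S K in auto)
    with bound[of "width n"] show ?case by (simp add: le_less_trans)
  qed
qed

section \<open>The mollified solution as an integral of g\<close>

text \<open>Against a symmetric \<open>H\<close> only the symmetric part of the product of two Dirac
  matrices survives, and by the anticommutation relations this is a multiple of the identity. It is
  used with the Hessian of the potential, where it says (alpha . grad)^2 = Laplacian, and with the
  Gram matrix of a gradient in the energy identity.\<close>

lemma clifford_sum:
  fixes H :: "3 \<Rightarrow> 3 \<Rightarrow> complex"
  assumes "\<And>j k. H j k = H k j"
  shows "(\<Sum>a\<in>UNIV. \<Sum>j\<in>UNIV. dirac_alpha j $ a $ b * (\<Sum>k\<in>UNIV. dirac_alpha k $ c $ a * H k j))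
    = (if b = c then \<Sum>j\<in>UNIV. H j j else 0)"
proof -
  define A where "A = (\<lambda>k j. \<Sum>a\<in>UNIV. dirac_alpha k $ c $ a * dirac_alpha j $ a $ b)"
  define S where "S = (\<Sum>j\<in>UNIV. \<Sum>k\<in>UNIV. A k j * H k j)"
  have "(\<Sum>a\<in>UNIV. \<Sum>j\<in>UNIV. dirac_alpha j $ a $ b * (\<Sum>k\<in>UNIV. dirac_alpha k $ c $ a * H k j))
     = (\<Sum>a\<in>UNIV. \<Sum>j\<in>UNIV. \<Sum>k\<in>UNIV. dirac_alpha k $ c $ a * dirac_alpha j $ a $ b * H k j)"
    by (simp add: sum_distrib_left mult_ac)
  also have "\<dots> = (\<Sum>j\<in>UNIV. \<Sum>a\<in>UNIV. \<Sum>k\<in>UNIV. dirac_alpha k $ c $ a * dirac_alpha j $ a $ b * H k j)"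
    by (rule sum.swap)
  also have "\<dots> = (\<Sum>j\<in>UNIV. \<Sum>k\<in>UNIV. \<Sum>a\<in>UNIV. dirac_alpha k $ c $ a * dirac_alpha j $ a $ b * H k j)"
    by (intro sum.cong refl sum.swap)
  also have "\<dots> = S" by (simp add: S_def A_def sum_distrib_right)
  finally have 1: "(\<Sum>a\<in>UNIV. \<Sum>j\<in>UNIV. dirac_alpha j $ a $ b * (\<Sum>k\<in>UNIV. dirac_alpha k $ c $ a * H k j)) = S" .
  \<comment> \<open>Exchanging the names of \<open>j\<close> and \<open>k\<close> and using the
    symmetry of \<open>H\<close> transposes the order of the matrices; adding both forms of
    \<open>S\<close> yields the anticommutator.\<close>
  have "S = (\<Sum>j\<in>UNIV. \<Sum>k\<in>UNIV. A j k * H k j)"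
  proof -
    have "S = (\<Sum>k\<in>UNIV. \<Sum>j\<in>UNIV. A k j * H k j)" unfolding S_def by (rule sum.swap)
    also have "\<dots> = (\<Sum>k\<in>UNIV. \<Sum>j\<in>UNIV. A k j * H j k)" by (intro sum.cong refl) (simp only: assms)
    finally show ?thesis .
  qed
  then have "2 * S = (\<Sum>j\<in>UNIV. \<Sum>k\<in>UNIV. (A k j + A j k) * H k j)"
    by (simp add: S_def distrib_right sum.distrib)
  also have "\<dots> = (\<Sum>j\<in>UNIV. \<Sum>k\<in>UNIV. if k = j then (if b = c then 2 else 0) * H j j else 0)"
    unfolding A_def clifford by (intro sum.cong refl) auto
  also have "\<dots> = 2 * (if b = c then \<Sum>j\<in>UNIV. H j j else 0)"
    by (cases "b = c") (simp_all add: sum_distrib_left)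
  finally show ?thesis unfolding 1 by simp
qed

text \<open>The Hessian of the potential N_e. Its entries decay to order 3 only, too slowly for
  \<open>integrable_f\<close>, whereas its trace decays to order 5.\<close>

definition newton_hess :: "real \<Rightarrow> 3 \<Rightarrow> 3 \<Rightarrow> real^3 \<Rightarrow> complex" where
  "newton_hess e k j z = of_real (3 * (z $ k) * (z $ j) * plummer e 5 z - (if j = k then plummer e 3 z else 0))"

lemma has_grad_newton:
  assumes "e > 0"
  shows "has_grad (\<lambda>z. of_real (- ((z $ k) * plummer e 3 z))) (newton_hess e k)"
proof -
  have "has_grad (\<lambda>z. - (of_real (z $ k) * of_real (plummer e 3 z)))
     (\<lambda>j z. - (of_real (z $ k) * of_real (- 3 * (z $ j) * plummer e (3 + 2) z) + (if j = k then 1 else 0) * of_real (plummer e 3 z)))"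
    by (intro has_grad_uminus has_grad_mult has_grad_coord has_grad_plummer assms)
  moreover have "(\<lambda>j z. - (of_real (z $ k) * of_real (- 3 * (z $ j) * plummer e (3 + 2) z) + (if j = k then 1 else 0) * complex_of_real (plummer e 3 z)))
    = newton_hess e k"
    by (intro ext) (simp add: newton_hess_def algebra_simps)
  ultimately show ?thesis by simp
qed

text \<open>The leading terms 3 |z|^2 cancel, because the kernel of index 3 is (e^2 + |z|^2) times
  the one of index 5; what is left carries e^2.\<close>

lemma newton_hess_trace: "e > 0 \<Longrightarrow> (\<Sum>j\<in>UNIV. newton_hess e j j z) = - 3 * eta e z"
proof -
  assume e: "e > 0"
  have p: "plummer e 3 z = (e\<^sup>2 + (norm z)\<^sup>2) * plummer e 5 z"
    using plummer_add[of e "-2" z 5] plummer_base_pos[OF e, of z] by (simp add: plummer_def)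
  have "(\<Sum>j\<in>UNIV. newton_hess e j j z) = of_real (\<Sum>j\<in>UNIV. 3 * (z $ j) * (z $ j) * plummer e 5 z - plummer e 3 z)"
    by (simp add: newton_hess_def)
  also have "(\<Sum>j\<in>UNIV. 3 * (z $ j) * (z $ j) * plummer e 5 z - plummer e 3 z) = 3 * (norm z)\<^sup>2 * plummer e 5 z - 3 * plummer e 3 z"
    unfolding norm_sq_vec3 sum_3 by (simp add: power2_eq_square algebra_simps)
  also have "\<dots> = - 3 * eta e z"
    unfolding p eta_def by (simp add: algebra_simps)
  finally show ?thesis .
qed

lemma elem_newton: "e > 0 \<Longrightarrow> elem (\<lambda>z. of_real (- ((z $ k) * plummer e 3 z)))"
proof -
  assume "e > 0"
  then have "elem (\<lambda>z. (-1) * (of_real (z $ k) * of_real (plummer e 3 z)))"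
    by (rule elem_mult[OF elem_const elem_mult[OF elem_coord elem_plummer]])
  then show ?thesis by simp
qed

text \<open>Partial derivatives are unique, so the closed formula coincides with the one supplied by
  \<open>elem_has_grad\<close>, which is in the class again and hence continuous.\<close>

lemma continuous_newton_hess: "e > 0 \<Longrightarrow> continuous_on UNIV (newton_hess e k j)"
proof -
  assume e: "e > 0"
  obtain D where D: "has_grad (\<lambda>z. of_real (- ((z $ k) * plummer e 3 z))) D" "elem (D j)"
    using elem_has_grad[OF elem_newton[OF e, of k]] by blast
  have "D j = newton_hess e k j"
    using has_grad_partial_deriv[OF D(1), of j] has_grad_partial_deriv[OF has_grad_newton[OF e, of k], of j] by simp
  then show ?thesis using elem_has_grad[OF D(2)] has_grad_continuous by auto
qed

lemma has_grad_shift: "has_grad u D \<Longrightarrow> has_grad (\<lambda>y. u (y - x)) (\<lambda>j y. D j (y - x))"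
  using has_grad_affine[of u D 1 "-x"] by simp

context dirac_weak
begin

text \<open>Testing with \<open>\<alpha> \<cdot> \<nabla> N\<close> for the Plummer potential \<open>N = (e\<^sup>2 + \<bar>z\<bar>\<^sup>2)\<^bsup>-1/2\<^esup>\<close>: since
  \<open>\<Delta> N = - 3 * eta e\<close>, this represents the mollified \<open>f\<close> through a kernel that is dominated, uniformly
  in \<open>e\<close>, by the Riesz kernel \<open>\<bar>x - y\<bar>\<^bsup>-2\<^esup>\<close>.\<close>

lemma corr_eta_representation:
  assumes e: "e > 0"
  shows "corr (eta e) (f c) x = (\<Sum>a\<in>UNIV. LINT y|lborel. g a y *
    ((- \<i> / 3) * (\<Sum>k\<in>UNIV. dirac_alpha k $ c $ a * of_real (- (((y - x) $ k) * plummer e 3 (y - x))))))"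
proof -
  \<comment> \<open>Row \<open>c\<close> of (alpha . grad) N_e, centred at \<open>x\<close>: the row
    index singles out the component \<open>f c\<close> on the left side of the weak
    equation.\<close>
  define \<psi> where "\<psi> = (\<lambda>a y. \<Sum>k\<in>UNIV. dirac_alpha k $ c $ a * of_real (- (((y - x) $ k) * plummer e 3 (y - x))))"
  define E where "E = (\<lambda>a j y. \<Sum>k\<in>UNIV. dirac_alpha k $ c $ a * newton_hess e k j (y - x))"
  have el: "elem (\<psi> a)" for a
    unfolding \<psi>_def by (intro elem_sum elem_cmult elem_shift[OF elem_newton[OF e]]) auto
  have gr: "has_grad (\<psi> a) (E a)" for a
    unfolding \<psi>_def E_def sum_3
    by (intro has_grad_add has_grad_cmult has_grad_shift[OF has_grad_newton[OF e]])
  have cE: "continuous_on UNIV (E a j)" for a j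
    unfolding E_def by (intro continuous_intros continuous_on_compose2[OF continuous_newton_hess[OF e]]) auto
  have d2: "dec 2 (\<psi> a)" for a
  proof -
    have "dec 2 (\<lambda>z. of_real (- (z $ k * plummer e 3 z)))" for k
      using dec_cmult[OF dec_coord_plummer[OF e, of 2 k], of "-1"] by simp
    from dec_shift[OF this] show ?thesis unfolding \<psi>_def by (intro dec_sum dec_cmult) auto
  qed
  \<comment> \<open>The Clifford cancellation that \<open>weak_extended\<close> is designed for: the
    order-3 entries of the Hessian combine to a multiple of \<open>eta e\<close>, so that
    \<open>d4\<close> holds.\<close>
  have P: "(\<Sum>a\<in>UNIV. \<Sum>j\<in>UNIV. dirac_alpha j $ a $ b * E a j y) = (if b = c then - 3 * eta e (y - x) else 0)" for b y
  proof -
    have "newton_hess e k j w = newton_hess e j k w" for k j w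
      by (simp add: newton_hess_def mult_ac)
    from clifford_sum[OF this[of _ _ "y - x"]] show ?thesis unfolding E_def by (simp only: newton_hess_trace[OF e])
  qed
  have d4: "dec 4 (\<lambda>y. \<Sum>a\<in>UNIV. \<Sum>j\<in>UNIV. dirac_alpha j $ a $ b * E a j y)" for b
  proof -
    have "dec 4 (\<lambda>y. - 3 * eta e (y - x))"
      by (rule dec_mono[OF dec_cmult[OF dec_shift[OF dec_eta[OF e]]]]) auto
    then show ?thesis unfolding P by (cases "b = c") (auto intro: dec_zero)
  qed
  have "(\<Sum>b\<in>UNIV. LINT y|lborel. f b y * (if b = c then - 3 * eta e (y - x) else 0)) = \<i> * (\<Sum>a\<in>UNIV. LINT y|lborel. g a y * \<psi> a y)"
    using weak_extended[OF el gr cE d2 d4] unfolding P .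
  moreover have "(\<Sum>b\<in>UNIV. LINT y|lborel. f b y * (if b = c then - 3 * eta e (y - x) else 0))
     = (\<Sum>b\<in>UNIV. if b = c then - 3 * corr (eta e) (f c) x else 0)"
  proof (intro sum.cong refl)
    fix b
    have "(LINT y|lborel. f c y * (- 3 * eta e (y - x))) = (LINT y|lborel. - 3 * (eta e (y - x) * f c y))"
      by (simp add: mult_ac)
    then show "(LINT y|lborel. f b y * (if b = c then - 3 * eta e (y - x) else 0)) = (if b = c then - 3 * corr (eta e) (f c) x else 0)"
      by (auto simp: corr_def)
  qed
  ultimately have eq: "\<i> * (\<Sum>a\<in>UNIV. LINT y|lborel. g a y * \<psi> a y) = - 3 * corr (eta e) (f c) x" by simp
  have "(- \<i> / 3) * (\<Sum>a\<in>UNIV. LINT y|lborel. g a y * \<psi> a y) = (- 1 / 3) * (\<i> * (\<Sum>a\<in>UNIV. LINT y|lborel. g a y * \<psi> a y))"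
    by simp
  then have "corr (eta e) (f c) x = (- \<i> / 3) * (\<Sum>a\<in>UNIV. LINT y|lborel. g a y * \<psi> a y)"
    unfolding eq by simp
  also have "\<dots> = (\<Sum>a\<in>UNIV. LINT y|lborel. (- \<i> / 3) * (g a y * \<psi> a y))"
    by (simp only: sum_distrib_left integral_mult_right_zero)
  finally show ?thesis by (simp add: \<psi>_def mult_ac)
qed

lemma norm_corr_eta_le:
  assumes e: "e > 0"
  shows "ennreal (cmod (corr (eta e) (f c) x))
    \<le> (\<integral>\<^sup>+y. (\<Sum>a\<in>UNIV. ennreal (cmod (g a y))) * ennreal (norm (x - y) powr (-2)) \<partial>lborel)"
proof -
  define k where "k = (\<lambda>a y. (- \<i> / 3) * (\<Sum>k\<in>UNIV. dirac_alpha k $ c $ a * of_real (- (((y - x) $ k) * plummer e 3 (y - x)))))"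
  \<comment> \<open>Each of the three coordinates contributes at most |x - y|^-2, the entries of the
    matrices being at most 1, and the prefactor 1/3 compensates for their number. At y = x both
    sides are 0.\<close>
  have kb: "cmod (k a y) \<le> norm (x - y) powr (-2)" for a y
  proof (cases "y = x")
    case False
    have "cmod (dirac_alpha k $ c $ a * of_real (- (((y - x) $ k) * plummer e 3 (y - x)))) \<le> 1 * norm (x - y) powr (-2)" for k
      unfolding norm_mult
    proof (rule mult_mono[OF norm_dirac_alpha_le])
      have "\<bar>(y - x) $ k * plummer e 3 (y - x)\<bar> \<le> plummer e 2 (y - x)"
        using coord_plummer_le[OF e, of "y - x" k 2] by simp
      also have "\<dots> \<le> norm (y - x) powr (-2)" using False by (intro plummer_le_norm_powr) auto
      finally show "cmod (of_real (- ((y - x) $ k * plummer e 3 (y - x)))) \<le> norm (x - y) powr (-2)"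
        unfolding norm_of_real by (simp add: norm_minus_commute)
    qed auto
    then have "cmod (\<Sum>k\<in>UNIV. dirac_alpha k $ c $ a * of_real (- (((y - x) $ k) * plummer e 3 (y - x)))) \<le> (\<Sum>k\<in>(UNIV::3 set). 1 * norm (x - y) powr (-2))"
      by (intro order.trans[OF norm_sum] sum_mono)
    then show ?thesis by (simp add: k_def norm_mult norm_divide)
  qed (simp add: k_def)
  have "corr (eta e) (f c) x = (\<Sum>a\<in>UNIV. LINT y|lborel. g a y * k a y)"
    using corr_eta_representation[OF e, of c x] unfolding k_def .
  then have "ennreal (cmod (corr (eta e) (f c) x)) \<le> (\<Sum>a\<in>UNIV. ennreal (cmod (LINT y|lborel. g a y * k a y)))"
    by (simp only:, subst sum_ennreal) (auto intro!: ennreal_leI norm_sum)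
  also have "\<dots> \<le> (\<Sum>a\<in>UNIV. \<integral>\<^sup>+y. ennreal (cmod (g a y)) * ennreal (norm (x - y) powr (-2)) \<partial>lborel)"
  proof (rule sum_mono)
    fix a
    have "ennreal (cmod (LINT y|lborel. g a y * k a y)) \<le> (\<integral>\<^sup>+y. ennreal (cmod (g a y * k a y)) \<partial>lborel)"
      by (rule norm_integral_le_nn_integral)
    also have "\<dots> \<le> (\<integral>\<^sup>+y. ennreal (cmod (g a y)) * ennreal (norm (x - y) powr (-2)) \<partial>lborel)"
    proof (rule nn_integral_mono)
      fix y show "ennreal (cmod (g a y * k a y)) \<le> ennreal (cmod (g a y)) * ennreal (norm (x - y) powr (-2))"
        unfolding norm_mult using kb[of a y] by (subst ennreal_mult) (auto intro!: mult_left_mono ennreal_leI)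
    qed
    finally show "ennreal (cmod (LINT y|lborel. g a y * k a y)) \<le> (\<integral>\<^sup>+y. ennreal (cmod (g a y)) * ennreal (norm (x - y) powr (-2)) \<partial>lborel)" .
  qed
  also have "\<dots> = (\<integral>\<^sup>+y. (\<Sum>a\<in>UNIV. ennreal (cmod (g a y)) * ennreal (norm (x - y) powr (-2))) \<partial>lborel)"
    by (rule nn_integral_sum[symmetric]) measurable
  finally show ?thesis by (simp only: sum_distrib_right)
qed

text \<open>The four components of \<open>g\<close> are lumped into one nonnegative function for
  Schur's test, and |y| is at most \<open>bracket y\<close>. The kernel bound does not involve
  \<open>e\<close>, hence neither does the result.\<close>

lemma sqnorm_corr_eta_bounded:
  "\<exists>B\<ge>0. \<forall>e>0. \<forall>c. sqnorm (corr (eta e) (f c)) \<le> ennreal B"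
proof -
  obtain C where C: "C \<ge> 0" "\<And>G. G \<in> borel_measurable (borel :: (real^3) measure) \<Longrightarrow>
    (\<integral>\<^sup>+x. (\<integral>\<^sup>+y. G y * ennreal (norm (x - y) powr (-2)) \<partial>lborel)\<^sup>2 \<partial>lborel)
      \<le> ennreal C * (\<integral>\<^sup>+y. (G y)\<^sup>2 * ennreal ((norm y)\<^sup>2) \<partial>lborel)"
    using schur_bound by blast
  define G where "G = (\<lambda>y. \<Sum>a\<in>UNIV. ennreal (cmod (g a y)))"
  have [measurable]: "G \<in> borel_measurable borel" unfolding G_def by measurable
  have "(\<integral>\<^sup>+y. (G y)\<^sup>2 * ennreal ((norm y)\<^sup>2) \<partial>lborel) \<le> (\<integral>\<^sup>+y. (\<Sum>a\<in>UNIV. 4 * ennreal ((cmod (g a y * of_real (bracket y)))\<^sup>2)) \<partial>lborel)"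
  proof (rule nn_integral_mono)
    fix y
    have "(\<Sum>a\<in>UNIV. cmod (g a y))\<^sup>2 \<le> (\<Sum>a\<in>UNIV. 4 * (cmod (g a y))\<^sup>2)"
    proof -
      have "(p + q + r + s)\<^sup>2 \<le> 4 * p\<^sup>2 + 4 * q\<^sup>2 + 4 * r\<^sup>2 + 4 * s\<^sup>2" for p q r s :: real
      proof -
        have "0 \<le> (p - q)\<^sup>2 + (p - r)\<^sup>2 + (p - s)\<^sup>2 + (q - r)\<^sup>2 + (q - s)\<^sup>2 + (r - s)\<^sup>2" by simp
        then show ?thesis by (simp add: power2_eq_square algebra_simps)
      qed
      then show ?thesis by (simp add: sum_4)
    qed
    moreover have "(norm y)\<^sup>2 \<le> (bracket y)\<^sup>2" using bracket_ge(2)[of y] by (intro power_mono) auto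
    ultimately have "(\<Sum>a\<in>UNIV. cmod (g a y))\<^sup>2 * (norm y)\<^sup>2 \<le> (\<Sum>a\<in>UNIV. 4 * (cmod (g a y))\<^sup>2) * (bracket y)\<^sup>2"
      by (intro mult_mono) (auto intro: sum_nonneg)
    also have "\<dots> = (\<Sum>a\<in>UNIV. 4 * (cmod (g a y * of_real (bracket y)))\<^sup>2)"
      by (simp add: norm_mult power_mult_distrib sum_distrib_right mult.assoc)
    finally have "ennreal ((\<Sum>a\<in>UNIV. cmod (g a y))\<^sup>2 * (norm y)\<^sup>2) \<le> ennreal (\<Sum>a\<in>UNIV. 4 * (cmod (g a y * of_real (bracket y)))\<^sup>2)"
      by (rule ennreal_leI)
    also have "\<dots> = (\<Sum>a\<in>UNIV. 4 * ennreal ((cmod (g a y * of_real (bracket y)))\<^sup>2))"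
      by (subst sum_ennreal[symmetric]) (auto simp: ennreal_mult)
    also have "ennreal ((\<Sum>a\<in>UNIV. cmod (g a y))\<^sup>2 * (norm y)\<^sup>2) = (G y)\<^sup>2 * ennreal ((norm y)\<^sup>2)"
      by (subst ennreal_mult) (auto simp: G_def ennreal_power[symmetric] sum_nonneg)
    finally show "(G y)\<^sup>2 * ennreal ((norm y)\<^sup>2) \<le> (\<Sum>a\<in>UNIV. 4 * ennreal ((cmod (g a y * of_real (bracket y)))\<^sup>2))" .
  qed
  also have "\<dots> = (\<Sum>a\<in>UNIV. 4 * sqnorm (\<lambda>y. g a y * of_real (bracket y)))"
    unfolding sqnorm_def by (subst nn_integral_sum, measurable, subst nn_integral_cmult, measurable)
  also have "\<dots> < \<infinity>" using gw by (simp add: ennreal_mult_less_top)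
  finally have fin: "(\<integral>\<^sup>+y. (G y)\<^sup>2 * ennreal ((norm y)\<^sup>2) \<partial>lborel) < \<infinity>" .
  define B where "B = enn2real (ennreal C * (\<integral>\<^sup>+y. (G y)\<^sup>2 * ennreal ((norm y)\<^sup>2) \<partial>lborel))"
  have B: "ennreal B = ennreal C * (\<integral>\<^sup>+y. (G y)\<^sup>2 * ennreal ((norm y)\<^sup>2) \<partial>lborel)"
    using fin by (simp add: B_def ennreal_mult_less_top)
  have "sqnorm (corr (eta e) (f c)) \<le> ennreal B" if e: "e > 0" for e c
  proof -
    have "sqnorm (corr (eta e) (f c)) \<le> (\<integral>\<^sup>+x. (\<integral>\<^sup>+y. G y * ennreal (norm (x - y) powr (-2)) \<partial>lborel)\<^sup>2 \<partial>lborel)"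
      unfolding sqnorm_def
    proof (rule nn_integral_mono)
      fix x
      have "ennreal ((cmod (corr (eta e) (f c) x))\<^sup>2) = (ennreal (cmod (corr (eta e) (f c) x)))\<^sup>2" by (simp add: ennreal_power)
      also have "\<dots> \<le> (\<integral>\<^sup>+y. G y * ennreal (norm (x - y) powr (-2)) \<partial>lborel)\<^sup>2"
        unfolding G_def by (intro power_mono norm_corr_eta_le e) auto
      finally show "ennreal ((cmod (corr (eta e) (f c) x))\<^sup>2) \<le> (\<integral>\<^sup>+y. G y * ennreal (norm (x - y) powr (-2)) \<partial>lborel)\<^sup>2" .
    qed
    also have "\<dots> \<le> ennreal B" unfolding B by (rule C) measurable
    finally show ?thesis .
  qed
  moreover have "B \<ge> 0" by (simp add: B_def)
  ultimately show ?thesis by blast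
qed

end

context dirac_weak
begin

text \<open>\<open>eta_mollify\<close> is not applicable to \<open>f\<close>, whose square
  integrability is the claim. So \<open>f\<close> is split at radius \<open>M\<close>: the inner
  part is square integrable because the weight is bounded below there, and on the ball of radius M /
  2 the outer part is seen only through the tail of \<open>eta e\<close>, which is O(e^2). Letting e
  tend to 0 gives a bound independent of \<open>M\<close>, and Fatou removes
  \<open>M\<close>.\<close>

lemma sqnorm_f_finite: "sqnorm (f c) < \<infinity>"
proof -
  obtain B where B: "B \<ge> 0" "\<And>e c. e > 0 \<Longrightarrow> sqnorm (corr (eta e) (f c)) \<le> ennreal B"
    using sqnorm_corr_eta_bounded by blast
  have local: "(\<integral>\<^sup>+x. ennreal (ceta\<^sup>2 * (cmod (f c x))\<^sup>2) * indicator (ball 0 (M/2)) x \<partial>lborel) \<le> ennreal (4 * B)"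
    if M: "M \<ge> 1" for M
  proof -
    define F where "F = (\<lambda>x. indicator (ball 0 M) x * f c x)"
    define W where "W = (\<lambda>x. indicator (- ball 0 M) x * f c x)"
    have [measurable]: "ball (0::real^3) R \<in> sets borel" "- ball (0::real^3) R \<in> sets borel" for R
      by (auto intro: borel_open)
    have [measurable]: "F \<in> borel_measurable borel" "W \<in> borel_measurable borel" unfolding F_def W_def by measurable
    have FW: "F x + W x = f c x" for x by (auto simp: F_def W_def indicator_def)
    have Ffin: "sqnorm F < \<infinity>"
    proof -
      have "sqnorm F \<le> sqnorm (\<lambda>x. of_real ((1 + M) powr (3/2)) * (f c x * of_real (bracket x powr (-3/2))))"
      proof (rule sqnorm_mono)
        fix x
        show "cmod (F x) \<le> cmod (of_real ((1 + M) powr (3/2)) * (f c x * of_real (bracket x powr (-3/2))))"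
        proof (cases "norm x < M")
          case True
          have "(norm x)\<^sup>2 \<le> M\<^sup>2" using True by (intro power_mono) auto
          moreover have "(1 + M)\<^sup>2 = 1 + 2 * M + M\<^sup>2" by (simp add: power2_sum)
          ultimately have "1 + (norm x)\<^sup>2 \<le> (1 + M)\<^sup>2" using M by linarith
          then have "bracket x \<le> 1 + M" unfolding bracket_def using M by (intro real_le_lsqrt) auto
          then have "bracket x powr (3/2) \<le> (1 + M) powr (3/2)" using bracket_ge(3)[of x] by (intro powr_mono2) auto
          then have "bracket x powr (3/2) * bracket x powr (-3/2) \<le> (1 + M) powr (3/2) * bracket x powr (-3/2)"
            by (intro mult_right_mono) auto
          moreover have "bracket x powr (3/2) * bracket x powr (-3/2) = 1"
            using bracket_ge(3)[of x] by (simp add: powr_add[symmetric])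
          ultimately have "cmod (f c x) * 1 \<le> cmod (f c x) * ((1 + M) powr (3/2) * bracket x powr (-3/2))"
            by (intro mult_left_mono) auto
          then show ?thesis using True by (simp add: F_def norm_mult mult_ac)
        qed (simp add: F_def)
      qed
      also have "\<dots> = ennreal ((cmod (of_real ((1 + M) powr (3/2))))\<^sup>2) * sqnorm (\<lambda>x. f c x * of_real (bracket x powr (-3/2)))"
        by (rule sqnorm_cmult) measurable
      also have "\<dots> < \<infinity>" using fw[of c] by (simp add: ennreal_mult_less_top)
      finally show ?thesis .
    qed
    \<comment> \<open>Dominates the tail of \<open>eta\<close> far from \<open>x\<close> and decays
      fast enough to be integrable against \<open>f\<close>.\<close>
    define h where "h = (\<lambda>y. complex_of_real (bracket y powr (-5)))"
    have hm[measurable]: "h \<in> borel_measurable borel" unfolding h_def by measurable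
    have "dec 4 h" unfolding h_def by (rule dec_mono[OF dec_bracket_powr[of "-5" 5]]) auto
    then have hint: "integrable lborel (\<lambda>y. f c y * h y)" by (rule integrable_f) measurable
    \<comment> \<open>For |x| < M/2 and |y| >= M >= 1 one has |y - x| >= |y| / 2 and
      \<open>bracket y\<close> at most 2 |y|, so |y - x| is at least a quarter of
      \<open>bracket y\<close>; 1024 is 4^5.\<close>
    define J where "J = 1024 * (LINT y|lborel. cmod (f c y * h y))"
    have J: "J \<ge> 0" by (simp add: J_def)
    have kint: "integrable lborel (\<lambda>y. eta e (y - x) * (indicator S y * f c y))"
      if e: "e > 0" and S: "S \<in> sets borel" for e x S
    proof -
      have "integrable lborel (\<lambda>y. f c y * eta e (y - x))"
        by (rule integrable_f[OF dec_mono[OF dec_shift[OF dec_eta[OF e]]]]) auto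
      from integrable_mult_indicator[OF _ this, of S] S
      have "integrable lborel (\<lambda>y. indicator S y *\<^sub>R (f c y * eta e (y - x)))" by simp
      moreover have "(\<lambda>y. indicator S y *\<^sub>R (f c y * eta e (y - x))) = (\<lambda>y. eta e (y - x) * (indicator S y * f c y))"
        by (auto simp: indicator_def fun_eq_iff)
      ultimately show ?thesis by simp
    qed
    have split: "corr (eta e) (f c) x = corr (eta e) F x + corr (eta e) W x" if e: "e > 0" for e x
    proof -
      have "corr (eta e) F x + corr (eta e) W x = (LINT y|lborel. eta e (y - x) * F y + eta e (y - x) * W y)"
        unfolding corr_def F_def W_def by (rule Bochner_Integration.integral_add[symmetric]) (intro kint e; auto intro: borel_open)+
      also have "\<dots> = corr (eta e) (f c) x" by (simp add: corr_def FW distrib_left[symmetric])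
      finally show ?thesis ..
    qed
    have far: "cmod (corr (eta e) W x) \<le> e\<^sup>2 * J" if e: "e > 0" and x: "norm x < M/2" for e x
    proof -
      have pw: "cmod (eta e (y - x) * W y) \<le> (e\<^sup>2 * 1024) * cmod (f c y * h y)" for y
      proof (cases "norm y < M")
        case False
        have n: "norm (y - x) \<ge> norm y / 2" using norm_triangle_ineq2[of y x] x False by linarith
        have bn: "bracket y \<le> 2 * norm y"
        proof -
          have "1 \<le> norm y" using False M by linarith
          then have "1 \<le> (norm y)\<^sup>2" by (simp add: one_le_power)
          then show ?thesis unfolding bracket_def by (intro real_le_lsqrt) (auto simp: power_mult_distrib)
        qed
        have "cmod (eta e (y - x)) \<le> e\<^sup>2 * norm (y - x) powr (-5)"
          using n False M by (intro eta_tail[where r="M/2"] e) auto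
        also have "\<dots> \<le> e\<^sup>2 * (bracket y / 4) powr (-5)"
          using n bn bracket_ge(3)[of y] by (intro mult_left_mono powr_mono2') auto
        also have "(bracket y / 4) powr (-5) = 1024 * bracket y powr (-5)"
          using bracket_ge(3)[of y] by (simp add: powr_divide powr_minus powr_numeral field_simps)
        finally have "cmod (eta e (y - x)) * cmod (f c y) \<le> (e\<^sup>2 * (1024 * bracket y powr (-5))) * cmod (f c y)"
          by (intro mult_right_mono) auto
        then show ?thesis using False by (simp add: W_def h_def norm_mult mult_ac)
      qed (simp add: W_def)
      have "cmod (corr (eta e) W x) \<le> (LINT y|lborel. cmod (eta e (y - x) * W y))"
        unfolding corr_def by (rule integral_norm_bound)
      also have "\<dots> \<le> (LINT y|lborel. (e\<^sup>2 * 1024) * cmod (f c y * h y))"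
      proof (rule integral_mono)
        show "integrable lborel (\<lambda>y. cmod (eta e (y - x) * W y))"
          unfolding W_def by (intro integrable_norm kint e) auto
        show "integrable lborel (\<lambda>y. (e\<^sup>2 * 1024) * cmod (f c y * h y))"
          by (intro integrable_mult_right integrable_norm hint)
      qed (rule pw)
      also have "\<dots> = e\<^sup>2 * J" by (simp add: J_def)
      finally show ?thesis .
    qed
    define v where "v = unit_ball_vol 3 * (M/2)^3"
    have v: "v \<ge> 0" using M by (simp add: v_def)
    \<comment> \<open>Three contributions to \<open>ceta\<close> times \<open>f c\<close>: the
      mollification error of the inner part, the uniformly bounded mollification of
      \<open>f\<close>, and the outer part. The first and the last vanish with
      \<open>e\<close>.\<close>
    have est: "(\<integral>\<^sup>+x. ennreal (ceta\<^sup>2 * (cmod (f c x))\<^sup>2) * indicator (ball 0 (M/2)) x \<partial>lborel)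
      \<le> 2 * sqnorm (\<lambda>x. corr (eta e) F x - of_real ceta * F x) + ennreal (4 * B) + ennreal (4 * (e\<^sup>2 * J)\<^sup>2 * v)" if e: "e > 0" for e
    proof -
      have pw: "ennreal (ceta\<^sup>2 * (cmod (f c x))\<^sup>2) * indicator (ball 0 (M/2)) x
        \<le> 2 * ennreal ((cmod (corr (eta e) F x - of_real ceta * F x))\<^sup>2) + 4 * ennreal ((cmod (corr (eta e) (f c) x))\<^sup>2)
          + ennreal (4 * (e\<^sup>2 * J)\<^sup>2) * indicator (ball 0 (M/2)) x" for x
      proof (cases "norm x < M/2")
        case True
        then have Fx: "F x = f c x" using M by (simp add: F_def)
        let ?a = "corr (eta e) F x - of_real ceta * F x" and ?b = "corr (eta e) (f c) x" and ?w = "corr (eta e) W x"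
        have "of_real ceta * f c x = - ?a + (?b + - ?w)" using split[OF e, of x] by (simp add: Fx)
        then have "(cmod (of_real ceta * f c x))\<^sup>2 \<le> 2 * (cmod ?a)\<^sup>2 + 2 * (cmod (?b + - ?w))\<^sup>2"
          using norm_add_sq_le[of "- ?a" "?b + - ?w", unfolded norm_minus_cancel] by (simp only:)
        also have "\<dots> \<le> 2 * (cmod ?a)\<^sup>2 + 2 * (2 * (cmod ?b)\<^sup>2 + 2 * (cmod ?w)\<^sup>2)"
          using norm_add_sq_le[of ?b "- ?w", unfolded norm_minus_cancel] by (intro add_left_mono mult_left_mono) auto
        also have "\<dots> \<le> 2 * (cmod ?a)\<^sup>2 + 4 * (cmod ?b)\<^sup>2 + 4 * (e\<^sup>2 * J)\<^sup>2"
          using power_mono[OF far[OF e True], of 2] by simp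
        finally have "ennreal (ceta\<^sup>2 * (cmod (f c x))\<^sup>2) \<le> ennreal (2 * (cmod ?a)\<^sup>2 + 4 * (cmod ?b)\<^sup>2 + 4 * (e\<^sup>2 * J)\<^sup>2)"
          by (intro ennreal_leI) (simp add: norm_mult power_mult_distrib)
        then show ?thesis using True by (simp add: ennreal_mult)
      qed simp
      have "(\<integral>\<^sup>+x. ennreal (ceta\<^sup>2 * (cmod (f c x))\<^sup>2) * indicator (ball 0 (M/2)) x \<partial>lborel)
        \<le> (\<integral>\<^sup>+x. (2 * ennreal ((cmod (corr (eta e) F x - of_real ceta * F x))\<^sup>2) + 4 * ennreal ((cmod (corr (eta e) (f c) x))\<^sup>2))
          + ennreal (4 * (e\<^sup>2 * J)\<^sup>2) * indicator (ball 0 (M/2)) x \<partial>lborel)"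
        by (intro nn_integral_mono pw)
      also have "\<dots> = 2 * sqnorm (\<lambda>x. corr (eta e) F x - of_real ceta * F x) + 4 * sqnorm (corr (eta e) (f c))
          + ennreal (4 * (e\<^sup>2 * J)\<^sup>2) * emeasure lborel (ball (0::real^3) (M/2))"
        unfolding sqnorm_def
        by (subst nn_integral_add, measurable, subst nn_integral_add, measurable,
            subst (1 2) nn_integral_cmult, measurable, subst nn_integral_cmult_indicator) auto
      also have "\<dots> \<le> 2 * sqnorm (\<lambda>x. corr (eta e) F x - of_real ceta * F x) + 4 * ennreal B + ennreal (4 * (e\<^sup>2 * J)\<^sup>2) * ennreal v"
        using M by (intro add_mono mult_left_mono order_refl B e) (auto simp: v_def emeasure_ball3)
      also have "\<dots> = 2 * sqnorm (\<lambda>x. corr (eta e) F x - of_real ceta * F x) + ennreal (4 * B) + ennreal (4 * (e\<^sup>2 * J)\<^sup>2 * v)"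
        using B(1) v by (subst (1 2) ennreal_mult) auto
      finally show ?thesis .
    qed
    have l1: "(\<lambda>n. 2 * sqnorm (\<lambda>x. corr (eta (width n)) F x - of_real ceta * F x)) \<longlonglongrightarrow> 2 * 0"
      by (rule ennreal_tendsto_cmult[OF _ eta_mollify[OF _ Ffin]]) auto
    have "(\<lambda>n. 4 * ((width n)\<^sup>2 * J)\<^sup>2 * v) \<longlonglongrightarrow> 4 * (0\<^sup>2 * J)\<^sup>2 * v"
      by (intro tendsto_intros LIMSEQ_Suc[OF lim_1_over_n])
    from tendsto_ennrealI[OF this]
    have l2: "(\<lambda>n. ennreal (4 * ((width n)\<^sup>2 * J)\<^sup>2 * v)) \<longlonglongrightarrow> 0" by simp
    have "(\<lambda>n. 2 * sqnorm (\<lambda>x. corr (eta (width n)) F x - of_real ceta * F x) + ennreal (4 * B) + ennreal (4 * ((width n)\<^sup>2 * J)\<^sup>2 * v))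
        \<longlonglongrightarrow> 2 * 0 + ennreal (4 * B) + 0"
      by (rule tendsto_add[OF tendsto_add[OF l1 tendsto_const] l2])
    then have "(\<integral>\<^sup>+x. ennreal (ceta\<^sup>2 * (cmod (f c x))\<^sup>2) * indicator (ball 0 (M/2)) x \<partial>lborel) \<le> 2 * 0 + ennreal (4 * B) + 0"
      by (rule LIMSEQ_le_const) (use est in auto)
    then show ?thesis by simp
  qed
  have "(\<integral>\<^sup>+x. ennreal (ceta\<^sup>2 * (cmod (f c x))\<^sup>2) \<partial>lborel)
    = (\<integral>\<^sup>+x. liminf (\<lambda>n. ennreal (ceta\<^sup>2 * (cmod (f c x))\<^sup>2) * indicator (ball 0 (real (Suc n)/2)) x) \<partial>lborel)"
  proof (rule nn_integral_cong)
    fix x :: "real^3"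
    obtain N :: nat where N: "2 * norm x < real N" using reals_Archimedean2 by blast
    have "(\<lambda>n. ennreal (ceta\<^sup>2 * (cmod (f c x))\<^sup>2) * indicator (ball 0 (real (Suc n)/2)) x) \<longlonglongrightarrow> ennreal (ceta\<^sup>2 * (cmod (f c x))\<^sup>2)"
      by (rule tendsto_eventually) (use N in \<open>auto simp: eventually_sequentially intro!: exI[of _ N]\<close>)
    then show "ennreal (ceta\<^sup>2 * (cmod (f c x))\<^sup>2) = liminf (\<lambda>n. ennreal (ceta\<^sup>2 * (cmod (f c x))\<^sup>2) * indicator (ball 0 (real (Suc n)/2)) x)"
      by (intro lim_imp_Liminf[symmetric]) simp_all
  qed
  also have "\<dots> \<le> liminf (\<lambda>n. \<integral>\<^sup>+x. ennreal (ceta\<^sup>2 * (cmod (f c x))\<^sup>2) * indicator (ball 0 (real (Suc n)/2)) x \<partial>lborel)"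
  proof (rule nn_integral_liminf, rule borel_measurable_times_ennreal)
    show "(\<lambda>x. ennreal (ceta\<^sup>2 * (cmod (f c x))\<^sup>2)) \<in> borel_measurable lborel" by measurable
    show "indicator (ball 0 (real (Suc n) / 2)) \<in> borel_measurable (lborel :: (real^3) measure)" for n
      by (rule borel_measurable_indicator) simp
  qed
  also have "\<dots> \<le> ennreal (4 * B)"
    by (rule Liminf_le) (auto intro!: always_eventually local)
  finally have "ennreal (ceta\<^sup>2) * sqnorm (f c) \<le> ennreal (4 * B)"
    by (simp add: sqnorm_def ennreal_mult nn_integral_cmult)
  then have "ennreal (ceta\<^sup>2) * sqnorm (f c) < \<infinity>" by (simp add: le_less_trans)
  then show ?thesis using ceta_pos by (auto simp: ennreal_mult_less_top)
qed

end

text \<open>Fubini; the double integrand is absolutely integrable by Young's inequality followed by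
  Cauchy-Schwarz.\<close>

lemma corr_adjoint:
  assumes k: "integrable lborel k" and [measurable]: "u \<in> borel_measurable borel" "v \<in> borel_measurable borel"
    and fin: "sqnorm u < \<infinity>" "sqnorm v < \<infinity>"
  shows "(LINT x|lborel. corr k u x * v x) = (LINT y|lborel. u y * corr (\<lambda>z. k (- z)) v y)"
proof -
  have [measurable]: "k \<in> borel_measurable borel" using borel_measurable_integrable[OF k] by simp
  define A where "A = (\<lambda>x. \<integral>\<^sup>+y. ennreal (cmod (k (y - x))) * ennreal (cmod (u y)) \<partial>lborel)"
  have [measurable]: "A \<in> borel_measurable borel" unfolding A_def by measurable
  have A2: "(\<integral>\<^sup>+x. (A x)\<^sup>2 \<partial>lborel) < \<infinity>"
  proof -
    have "(\<integral>\<^sup>+x. (A x)\<^sup>2 \<partial>lborel) \<le> (\<integral>\<^sup>+z. ennreal (cmod (k z)) \<partial>lborel)\<^sup>2 * (\<integral>\<^sup>+y. (ennreal (cmod (u y)))\<^sup>2 \<partial>lborel)"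
      unfolding A_def by (rule young_nn_integral) measurable
    also have "(\<integral>\<^sup>+y. (ennreal (cmod (u y)))\<^sup>2 \<partial>lborel) = sqnorm u" by (simp add: sqnorm_def ennreal_power)
    also have "(\<integral>\<^sup>+z. ennreal (cmod (k z)) \<partial>lborel)\<^sup>2 * sqnorm u < \<infinity>"
      using k fin(1) by (simp add: integrable_iff_bounded ennreal_mult_less_top power2_eq_square)
    finally show ?thesis .
  qed
  have prod: "integrable (lborel \<Otimes>\<^sub>M lborel) (\<lambda>(x, y). k (y - x) * u y * v x)"
  proof (rule integrableI_bounded)
    have "(\<integral>\<^sup>+p. ennreal (norm (case p of (x, y) \<Rightarrow> k (y - x) * u y * v x)) \<partial>(lborel \<Otimes>\<^sub>M lborel))
      = (\<integral>\<^sup>+x. \<integral>\<^sup>+y. ennreal (cmod (k (y - x) * u y * v x)) \<partial>lborel \<partial>lborel)"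
      by (subst lborel.nn_integral_fst[symmetric]) auto
    also have "\<dots> = (\<integral>\<^sup>+x. A x * ennreal (cmod (v x)) \<partial>lborel)"
      unfolding A_def by (simp add: norm_mult ennreal_mult nn_integral_multc)
    finally have eq: "(\<integral>\<^sup>+p. ennreal (norm (case p of (x, y) \<Rightarrow> k (y - x) * u y * v x)) \<partial>(lborel \<Otimes>\<^sub>M lborel))
      = (\<integral>\<^sup>+x. A x * ennreal (cmod (v x)) \<partial>lborel)" .
    have "(\<integral>\<^sup>+x. A x * ennreal (cmod (v x)) \<partial>lborel)\<^sup>2 \<le> (\<integral>\<^sup>+x. (A x)\<^sup>2 \<partial>lborel) * (\<integral>\<^sup>+x. (ennreal (cmod (v x)))\<^sup>2 \<partial>lborel)"
      by (rule Cauchy_Schwarz_nn_integral) measurable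
    also have "\<dots> < \<infinity>" using A2 fin(2) by (simp add: sqnorm_def ennreal_power ennreal_mult_less_top)
    finally show "(\<integral>\<^sup>+p. ennreal (norm (case p of (x, y) \<Rightarrow> k (y - x) * u y * v x)) \<partial>(lborel \<Otimes>\<^sub>M lborel)) < \<infinity>"
      unfolding eq by (cases "\<integral>\<^sup>+x. A x * ennreal (cmod (v x)) \<partial>lborel") (auto simp: power2_eq_square ennreal_top_mult)
  qed measurable
  have "(LINT x|lborel. corr k u x * v x) = (LINT x|lborel. LINT y|lborel. k (y - x) * u y * v x)"
    by (simp add: corr_def)
  also have "\<dots> = (LINT y|lborel. LINT x|lborel. k (y - x) * u y * v x)"
    using lborel_pair.Fubini_integral[OF prod] by simp
  also have "\<dots> = (LINT y|lborel. u y * corr (\<lambda>z. k (- z)) v y)"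
  proof (rule Bochner_Integration.integral_cong[OF refl])
    fix y
    have "(LINT x|lborel. k (y - x) * u y * v x) = (LINT x|lborel. u y * (k (- (x - y)) * v x))"
      by (simp add: mult_ac)
    then show "(LINT x|lborel. k (y - x) * u y * v x) = u y * corr (\<lambda>z. k (- z)) v y"
      by (simp add: corr_def)
  qed
  finally show ?thesis .
qed

subsection \<open>Square integrability of the gradient\<close>

lemma borel_measurable_cnj [measurable]: "cnj \<in> borel_measurable borel"
  by (intro borel_measurable_continuous_onI continuous_intros)

lemma dec_reflect:
  assumes "dec q u" "q \<ge> 0"
  shows "dec q (\<lambda>x. u (a - x))"
proof -
  have "dec q (\<lambda>z. u (- z))" using assms(1) by (auto simp: dec_def) (metis bracket_def norm_minus_cancel)
  from dec_shift[OF this assms(2), of a] show ?thesis by simp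
qed

lemma has_grad_reflect: "has_grad u D \<Longrightarrow> has_grad (\<lambda>x. u (a - x)) (\<lambda>j x. - D j (a - x))"
  using has_grad_affine[of u D "-1" a] by simp

lemma continuous_on_shift_reflect:
  fixes u :: "real^3 \<Rightarrow> complex"
  assumes "continuous_on UNIV u"
  shows "continuous_on UNIV (\<lambda>x. u (x - a))" "continuous_on UNIV (\<lambda>x. u (a - x))"
  by (rule continuous_on_compose2[OF assms]; auto intro!: continuous_intros)+

lemma sqnorm_eq_inner:
  assumes [measurable]: "u \<in> borel_measurable borel" and "sqnorm u < \<infinity>"
  shows "sqnorm u = ennreal (LINT x|lborel. (cmod (u x))\<^sup>2)"
    and "(LINT x|lborel. u x * cnj (u x)) = of_real (LINT x|lborel. (cmod (u x))\<^sup>2)"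
proof -
  have "integrable lborel (\<lambda>x. (cmod (u x))\<^sup>2)" using assms by (auto simp: integrable_iff_bounded sqnorm_def)
  then show "sqnorm u = ennreal (LINT x|lborel. (cmod (u x))\<^sup>2)"
    unfolding sqnorm_def by (rule nn_integral_eq_integral) auto
  show "(LINT x|lborel. u x * cnj (u x)) = of_real (LINT x|lborel. (cmod (u x))\<^sup>2)"
    by (simp add: complex_norm_square[symmetric] flip: integral_complex_of_real)
qed

text \<open>The properties of a mollifier that the energy identity needs. They are collected in a
  locale because the identity is applied to the difference of two mollifiers. Boundedness of the
  second derivatives suffices, since they only ever occur next to \<zeta>, which decays to order
  5.\<close>

locale kernel =
  fixes \<zeta> :: "real^3 \<Rightarrow> complex" and \<zeta>1 :: "3 \<Rightarrow> real^3 \<Rightarrow> complex" and \<zeta>2 :: "3 \<Rightarrow> 3 \<Rightarrow> real^3 \<Rightarrow> complex"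
  assumes grad1: "has_grad \<zeta> \<zeta>1" and grad2: "\<And>j. has_grad (\<zeta>1 j) (\<zeta>2 j)"
    and cont2: "\<And>j k. continuous_on UNIV (\<zeta>2 j k)"
    and sym2: "\<And>j k z. \<zeta>2 j k z = \<zeta>2 k j z"
    and dec0: "dec 5 \<zeta>" and dec1: "\<And>j. dec 5 (\<zeta>1 j)" and dec2: "\<And>j k. dec 0 (\<zeta>2 j k)"
    and cnj1: "\<And>j z. cnj (\<zeta>1 j z) = \<zeta>1 j z"
begin

lemma cont0: "continuous_on UNIV \<zeta>" and cont1: "continuous_on UNIV (\<zeta>1 j)"
  using grad1 grad2 has_grad_continuous by blast+

lemma meas0 [measurable]: "\<zeta> \<in> borel_measurable borel" and meas1 [measurable]: "\<zeta>1 j \<in> borel_measurable borel"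
  using cont0 cont1 by (auto intro: borel_measurable_continuous_onI)

lemma integrable1: "integrable lborel (\<zeta>1 j)"
  by (rule integrable_dec[OF dec1]) auto

text \<open>One integration by parts on either side leaves \<zeta> against a mixed second derivative
  of \<zeta>, and mixed derivatives commute. The differentiations fall on the mollifier because
  \<open>u\<close> need not be differentiable.\<close>

lemma overlap_symmetric:
  "(LINT x|lborel. \<zeta>1 j (y - x) * \<zeta>1 k (z - x)) = (LINT x|lborel. \<zeta>1 k (y - x) * \<zeta>1 j (z - x))"
proof -
  have "(LINT x|lborel. \<zeta>1 j (y - x) * \<zeta>1 k (z - x)) = - (LINT x|lborel. \<zeta> (y - x) * \<zeta>2 k j (z - x))" for j k
  proof -
    let ?w = "\<lambda>x. \<zeta> (y - x) * \<zeta>1 k (z - x)"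
    let ?D = "\<lambda>j x. \<zeta> (y - x) * (- \<zeta>2 k j (z - x)) + (- \<zeta>1 j (y - x)) * \<zeta>1 k (z - x)"
    have i: "integrable lborel (\<lambda>x. \<zeta> (y - x) * \<zeta>2 k j (z - x))" "integrable lborel (\<lambda>x. \<zeta>1 j (y - x) * \<zeta>1 k (z - x))" "integrable lborel ?w"
    proof -
      have "dec (5 + 0) (\<lambda>x. \<zeta> (y - x) * \<zeta>2 k j (z - x))" "dec (5 + 5) (\<lambda>x. \<zeta>1 j (y - x) * \<zeta>1 k (z - x))" "dec (5 + 5) ?w"
        by (intro dec_mult dec_reflect dec0 dec1 dec2; simp)+
      moreover have "(\<lambda>x. \<zeta> (y - x) * \<zeta>2 k j (z - x)) \<in> borel_measurable borel"
        by (intro borel_measurable_continuous_onI continuous_on_mult continuous_on_shift_reflect cont0 cont2)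
      ultimately show "integrable lborel (\<lambda>x. \<zeta> (y - x) * \<zeta>2 k j (z - x))" "integrable lborel (\<lambda>x. \<zeta>1 j (y - x) * \<zeta>1 k (z - x))" "integrable lborel ?w"
        by (auto intro: integrable_dec)
    qed
    have "(LINT x|lborel. ?D j x) = 0"
    proof (rule integral_partial_eq_0[where D="?D" and w="?w"])
      show "has_grad ?w ?D" by (intro has_grad_mult has_grad_reflect grad1 grad2)
      show "integrable lborel (?D j)" using i(1,2) by simp
      show "continuous_on UNIV (?D j)"
        by (intro continuous_on_add continuous_on_mult continuous_on_minus continuous_on_shift_reflect cont0 cont1 cont2)
    qed (rule i(3))
    moreover have "(LINT x|lborel. ?D j x) = - (LINT x|lborel. \<zeta> (y - x) * \<zeta>2 k j (z - x)) - (LINT x|lborel. \<zeta>1 j (y - x) * \<zeta>1 k (z - x))"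
      using i(1,2) by simp
    ultimately show ?thesis by (simp add: algebra_simps)
  qed
  from this[of j k] this[of k j] show ?thesis by (simp add: sym2)
qed

lemma sqnorm_corr_finite:
  assumes "u \<in> borel_measurable borel" "sqnorm u < \<infinity>"
  shows "sqnorm (corr (\<zeta>1 j) u) < \<infinity>"
proof -
  have "sqnorm (corr (\<zeta>1 j) u) \<le> (\<integral>\<^sup>+z. ennreal (cmod (\<zeta>1 j z)) \<partial>lborel)\<^sup>2 * sqnorm u"
    by (rule sqnorm_corr_le) (use assms in auto)
  also have "\<dots> < \<infinity>" using assms integrable1[of j] by (simp add: integrable_iff_bounded power2_eq_square ennreal_mult_less_top)
  finally show ?thesis .
qed

lemma cnj_corr: "cnj (corr (\<zeta>1 j) u x) = corr (\<zeta>1 j) (\<lambda>y. cnj (u y)) x"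
  unfolding corr_def by (subst Bochner_Integration.integral_cnj[symmetric]) (simp add: cnj1)

text \<open>The symmetry in \<open>j\<close> and \<open>k\<close> that \<open>clifford_sum\<close>
  requires. Taking adjoints twice moves both kernels into a single overlap integral, to which
  \<open>overlap_symmetric\<close> applies.\<close>

lemma inner_swap:
  assumes [measurable]: "u \<in> borel_measurable borel" "v \<in> borel_measurable borel"
    and fin: "sqnorm u < \<infinity>" "sqnorm v < \<infinity>"
  shows "(LINT x|lborel. corr (\<zeta>1 j) u x * cnj (corr (\<zeta>1 k) v x)) = (LINT x|lborel. corr (\<zeta>1 k) u x * cnj (corr (\<zeta>1 j) v x))"
proof -
  let ?v = "\<lambda>y. cnj (v y)"
  have vf: "sqnorm ?v < \<infinity>" using fin(2) by (simp add: sqnorm_def)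
  have "(LINT x|lborel. corr (\<zeta>1 j) u x * cnj (corr (\<zeta>1 k) v x))
    = (LINT y|lborel. u y * (LINT z|lborel. ?v z * (LINT x|lborel. \<zeta>1 k (z - x) * \<zeta>1 j (y - x))))" for j k
  proof -
    have "(LINT x|lborel. corr (\<zeta>1 j) u x * cnj (corr (\<zeta>1 k) v x)) = (LINT y|lborel. u y * corr (\<lambda>z. \<zeta>1 j (- z)) (corr (\<zeta>1 k) ?v) y)"
      unfolding cnj_corr by (intro corr_adjoint integrable1 sqnorm_corr_finite fin vf) measurable
    moreover have "corr (\<lambda>z. \<zeta>1 j (- z)) (corr (\<zeta>1 k) ?v) y = (LINT z|lborel. ?v z * (LINT x|lborel. \<zeta>1 k (z - x) * \<zeta>1 j (y - x)))" for y
    proof -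
      have "dec 5 (\<lambda>x. \<zeta>1 j (y - x))" by (intro dec_reflect dec1) simp
      then have "sqnorm (\<lambda>x. \<zeta>1 j (y - x)) < \<infinity>" by (rule sqnorm_dec_finite) simp
      then have "(LINT x|lborel. corr (\<zeta>1 k) ?v x * \<zeta>1 j (y - x)) = (LINT z|lborel. ?v z * corr (\<lambda>z. \<zeta>1 k (- z)) (\<lambda>x. \<zeta>1 j (y - x)) z)"
        by (intro corr_adjoint integrable1 vf) measurable
      then show ?thesis by (simp add: corr_def mult.commute)
    qed
    ultimately show ?thesis by simp
  qed
  from this[of j k] this[of k j] show ?thesis
    by (simp add: overlap_symmetric[of k _ j])
qed

text \<open>This is \<open>\<parallel>(\<alpha> \<cdot> \<nabla>) (\<zeta> * u)\<parallel>\<^sup>2 = \<parallel>\<nabla> (\<zeta> * u)\<parallel>\<^sup>2\<close>; the cross terms cancel by the Clifford relations.\<close>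

lemma dirac_energy:
  fixes u :: "4 \<Rightarrow> real^3 \<Rightarrow> complex"
  assumes [measurable]: "\<And>b. u b \<in> borel_measurable borel" and fin: "\<And>b. sqnorm (u b) < \<infinity>"
  shows "(\<Sum>b\<in>UNIV. \<Sum>j\<in>UNIV. sqnorm (corr (\<zeta>1 j) (u b)))
    = (\<Sum>a\<in>UNIV. sqnorm (\<lambda>x. \<Sum>j\<in>UNIV. \<Sum>b\<in>UNIV. dirac_alpha j $ a $ b * corr (\<zeta>1 j) (u b) x))"
proof -
  let ?U = "\<lambda>j b. corr (\<zeta>1 j) (u b)"
  let ?T = "\<lambda>a x. \<Sum>j\<in>UNIV. \<Sum>b\<in>UNIV. dirac_alpha j $ a $ b * ?U j b x"
  define S where "S = (\<lambda>j b k c. LINT x|lborel. ?U j b x * cnj (?U k c x))"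
  have Uf: "sqnorm (?U j b) < \<infinity>" for j b by (intro sqnorm_corr_finite fin) measurable
  have Ui: "integrable lborel (\<lambda>x. ?U j b x * cnj (?U k c x))" for j b k c
    by (rule integrable_mult_sqnorm) (use Uf in \<open>auto simp: sqnorm_def\<close>)
  have Tf: "sqnorm (?T a) < \<infinity>" for a
  proof -
    have s: "sqnorm (\<lambda>x. p x + q x) < \<infinity>" if "p \<in> borel_measurable borel" "q \<in> borel_measurable borel" "sqnorm p < \<infinity>" "sqnorm q < \<infinity>" for p q
      using sqnorm_add[OF that(1,2)] that(3,4) by (auto simp: ennreal_mult_less_top elim!: le_less_trans)
    have "sqnorm (\<lambda>x. dirac_alpha j $ a $ b * ?U j b x) < \<infinity>" for j b
      using Uf[of j b] by (subst sqnorm_cmult) (auto simp: ennreal_mult_less_top)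
    then show ?thesis unfolding sum_3 sum_4 by (intro s) auto
  qed
  have TT: "(LINT x|lborel. ?T a x * cnj (?T a x))
     = (\<Sum>c\<in>UNIV. \<Sum>b\<in>UNIV. \<Sum>j\<in>UNIV. dirac_alpha j $ a $ b * (\<Sum>k\<in>UNIV. dirac_alpha k $ c $ a * S j b k c))" for a
  proof -
    have "?T a x * cnj (?T a x) = (\<Sum>c\<in>UNIV. \<Sum>b\<in>UNIV. \<Sum>j\<in>UNIV. \<Sum>k\<in>UNIV. (dirac_alpha j $ a $ b * dirac_alpha k $ c $ a) * (?U j b x * cnj (?U k c x)))" for x
    proof -
      have 1: "?T a x = (\<Sum>b\<in>UNIV. \<Sum>j\<in>UNIV. dirac_alpha j $ a $ b * ?U j b x)" by (rule sum.swap)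
      \<comment> \<open>Hermitian matrices turn the conjugate into a transpose, so the two matrices
        meet as the product (alpha_k alpha_j) with outer indices \<open>c\<close> and
        \<open>b\<close>, the form that \<open>clifford_sum\<close> contracts.\<close>
      have 2: "cnj (?T a x) = (\<Sum>c\<in>UNIV. \<Sum>k\<in>UNIV. dirac_alpha k $ c $ a * cnj (?U k c x))"
        unfolding 1 by (simp add: dirac_alpha_hermitian)
      show ?thesis unfolding 2 unfolding 1
        unfolding sum_product by (subst sum.swap) (simp add: mult_ac)
    qed
    then have "(LINT x|lborel. ?T a x * cnj (?T a x)) = (\<Sum>c\<in>UNIV. \<Sum>b\<in>UNIV. \<Sum>j\<in>UNIV. \<Sum>k\<in>UNIV. (dirac_alpha j $ a $ b * dirac_alpha k $ c $ a) * S j b k c)"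
      using Ui by (simp add: Bochner_Integration.integral_sum S_def)
    then show ?thesis by (simp add: sum_distrib_left mult.assoc)
  qed
  have "(\<Sum>a\<in>UNIV. LINT x|lborel. ?T a x * cnj (?T a x))
     = (\<Sum>c\<in>UNIV. \<Sum>b\<in>UNIV. \<Sum>a\<in>UNIV. \<Sum>j\<in>UNIV. dirac_alpha j $ a $ b * (\<Sum>k\<in>UNIV. dirac_alpha k $ c $ a * S j b k c))"
    unfolding TT by (subst sum.swap) (intro sum.cong refl sum.swap)
  also have "\<dots> = (\<Sum>c\<in>UNIV. \<Sum>b\<in>UNIV. if b = c then \<Sum>j\<in>UNIV. S j b j c else 0)"
  proof (intro sum.cong refl)
    fix b c
    have "S j b k c = S k b j c" for j k
      unfolding S_def by (rule inner_swap) (use fin in auto)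
    from clifford_sum[of "\<lambda>k j. S j b k c", OF this]
    show "(\<Sum>a\<in>UNIV. \<Sum>j\<in>UNIV. dirac_alpha j $ a $ b * (\<Sum>k\<in>UNIV. dirac_alpha k $ c $ a * S j b k c)) = (if b = c then \<Sum>j\<in>UNIV. S j b j c else 0)" .
  qed
  also have "\<dots> = (\<Sum>c\<in>UNIV. \<Sum>j\<in>UNIV. S j c j c)" by simp
  finally have "complex_of_real (\<Sum>a\<in>UNIV. LINT x|lborel. (cmod (?T a x))\<^sup>2) = of_real (\<Sum>b\<in>UNIV. \<Sum>j\<in>UNIV. LINT x|lborel. (cmod (?U j b x))\<^sup>2)"
    unfolding S_def using sqnorm_eq_inner(2)[OF _ Tf] sqnorm_eq_inner(2)[OF _ Uf] by simp
  then have "(\<Sum>a\<in>UNIV. LINT x|lborel. (cmod (?T a x))\<^sup>2) = (\<Sum>b\<in>UNIV. \<Sum>j\<in>UNIV. LINT x|lborel. (cmod (?U j b x))\<^sup>2)"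
    by (simp only: of_real_eq_iff)
  then show ?thesis
    using sqnorm_eq_inner(1)[OF _ Tf] sqnorm_eq_inner(1)[OF _ Uf] by (simp add: sum_ennreal sum_nonneg)
qed

end

text \<open>First partial derivatives of the mollifier in closed form; \<open>ddeta\<close> holds
  the second ones. Up to sign, \<open>corr (deta e j) u\<close> is the j-th partial derivative of
  \<open>corr (eta e) u\<close>: the sign is negative because \<open>x\<close> enters the kernel as
  \<open>y - x\<close>.\<close>

definition deta :: "real \<Rightarrow> 3 \<Rightarrow> real^3 \<Rightarrow> complex" where
  "deta e j z = of_real (- 5 * e\<^sup>2 * (z $ j) * plummer e 7 z)"

definition ddeta :: "real \<Rightarrow> 3 \<Rightarrow> 3 \<Rightarrow> real^3 \<Rightarrow> complex" where
  "ddeta e j k z = of_real (- 5 * e\<^sup>2 * ((if k = j then plummer e 7 z else 0) - 7 * (z $ j) * (z $ k) * plummer e 9 z))"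

lemma kernel_eta:
  assumes e: "e > 0"
  shows "kernel (eta e) (deta e) (ddeta e)"
proof
  show "has_grad (eta e) (deta e)"
  proof -
    have "has_grad (\<lambda>z. of_real (e\<^sup>2) * of_real (plummer e 5 z)) (\<lambda>j z. of_real (e\<^sup>2) * of_real (- 5 * (z $ j) * plummer e (5 + 2) z))"
      by (intro has_grad_cmult has_grad_plummer e)
    moreover have "(\<lambda>z. of_real (e\<^sup>2) * complex_of_real (plummer e 5 z)) = eta e"
      "(\<lambda>j z. of_real (e\<^sup>2) * complex_of_real (- 5 * (z $ j) * plummer e (5 + 2) z)) = deta e"
      by (auto simp: eta_def deta_def fun_eq_iff)
    ultimately show ?thesis by simp
  qed
  show "has_grad (deta e j) (ddeta e j)" for j
  proof -
    have "has_grad (\<lambda>z. of_real (- 5 * e\<^sup>2) * (of_real (z $ j) * of_real (plummer e 7 z)))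
      (\<lambda>k z. of_real (- 5 * e\<^sup>2) * (of_real (z $ j) * of_real (- 7 * (z $ k) * plummer e (7 + 2) z) + (if k = j then 1 else 0) * of_real (plummer e 7 z)))"
      by (intro has_grad_cmult has_grad_mult has_grad_coord has_grad_plummer e)
    moreover have "(\<lambda>z. of_real (- 5 * e\<^sup>2) * (complex_of_real (z $ j) * of_real (plummer e 7 z))) = deta e j"
      by (auto simp: deta_def fun_eq_iff)
    moreover have "(\<lambda>k z. of_real (- 5 * e\<^sup>2) * (complex_of_real (z $ j) * of_real (- 7 * (z $ k) * plummer e (7 + 2) z) + (if k = j then 1 else 0) * of_real (plummer e 7 z))) = ddeta e j"
      by (auto simp: ddeta_def fun_eq_iff algebra_simps)
    ultimately show ?thesis by simp
  qed
  show "continuous_on UNIV (ddeta e j k)" for j k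
  proof -
    have p: "continuous_on UNIV (plummer e q)" for q
      unfolding plummer_def[abs_def] using plummer_base_pos[OF e]
      by (intro continuous_intros) (use e in \<open>auto simp: less_imp_neq[symmetric]\<close>)
    show ?thesis unfolding ddeta_def[abs_def]
      by (cases "k = j") (auto intro!: continuous_intros p)
  qed
  show "ddeta e j k z = ddeta e k j z" for j k z by (simp add: ddeta_def mult_ac)
  show "dec 5 (eta e)" by (rule dec_eta[OF e])
  show "dec 5 (deta e j)" for j
  proof -
    have "dec 6 (\<lambda>z. of_real (- 5 * e\<^sup>2) * of_real ((z $ j) * plummer e (6 + 1) z))"
      by (intro dec_cmult dec_coord_plummer e) simp
    then have "dec 6 (deta e j)" by (simp add: deta_def[abs_def] mult.assoc)
    then show ?thesis by (rule dec_mono) simp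
  qed
  show "dec 0 (ddeta e j k)" for j k
  proof -
    have a: "dec 0 (\<lambda>z. of_real (plummer e 7 z))"
      by (rule dec_mono[OF dec_plummer[OF e, of 7]]) auto
    have "dec (0 + 0) (\<lambda>z. of_real ((z $ j) * plummer e (3 + 1) z) * of_real ((z $ k) * plummer e (4 + 1) z))"
      by (intro dec_mult dec_mono[OF dec_coord_plummer[OF e]]) auto
    moreover have "complex_of_real ((z $ j) * plummer e (3 + 1) z) * of_real ((z $ k) * plummer e (4 + 1) z) = of_real ((z $ j) * (z $ k) * plummer e 9 z)" for z
      using plummer_add[of e 4 z 5] by (simp add: mult_ac flip: of_real_mult)
    ultimately have b: "dec 0 (\<lambda>z. of_real ((z $ j) * (z $ k) * plummer e 9 z))" by (simp only: add_0)
    have "dec 0 (\<lambda>z. of_real (- 5 * e\<^sup>2) * ((if k = j then 1 else 0) * of_real (plummer e 7 z) - 7 * of_real ((z $ j) * (z $ k) * plummer e 9 z)))"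
      by (intro dec_cmult dec_diff a b)
    moreover have "(\<lambda>z. of_real (- 5 * e\<^sup>2) * ((if k = j then 1 else 0) * complex_of_real (plummer e 7 z) - 7 * of_real ((z $ j) * (z $ k) * plummer e 9 z))) = ddeta e j k"
      by (auto simp: ddeta_def fun_eq_iff mult.assoc)
    ultimately show ?thesis by simp
  qed
  show "cnj (deta e j z) = deta e j z" for j z by (simp add: deta_def)
qed

text \<open>Lets the energy identity act on the difference of two mollifiers, which is what a Cauchy
  estimate for the gradients needs.\<close>

lemma kernel_diff:
  assumes "kernel z z1 z2" "kernel y y1 y2"
  shows "kernel (\<lambda>x. z x - y x) (\<lambda>j x. z1 j x - y1 j x) (\<lambda>j k x. z2 j k x - y2 j k x)"
proof -
  interpret Z: kernel z z1 z2 by fact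
  interpret Y: kernel y y1 y2 by fact
  show ?thesis
    by unfold_locales
      (intro has_grad_diff Z.grad1 Y.grad1 Z.grad2 Y.grad2 continuous_on_diff Z.cont2 Y.cont2 dec_diff Z.dec0 Y.dec0 Z.dec1 Y.dec1 Z.dec2 Y.dec2
        | simp add: Z.sym2 Y.sym2 Z.cnj1 Y.cnj1)+
qed

text \<open>Order 5 makes a translated kernel square integrable, so both correlations converge at
  every point and the identity is pointwise.\<close>

lemma corr_diff_kernel:
  assumes [measurable]: "k \<in> borel_measurable borel" "l \<in> borel_measurable borel" "u \<in> borel_measurable borel"
    and "dec 5 k" "dec 5 l" "sqnorm u < \<infinity>"
  shows "corr (\<lambda>z. k z - l z) u x = corr k u x - corr l u x"
proof -
  have i: "integrable lborel (\<lambda>y. k (y - x) * u y)" if [measurable]: "k \<in> borel_measurable borel" and "dec 5 k" for k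
  proof (rule integrable_mult_sqnorm)
    have "dec 5 (\<lambda>y. k (y - x))" by (rule dec_shift[OF that(2)]) simp
    then show "sqnorm (\<lambda>y. k (y - x)) < \<infinity>" by (rule sqnorm_dec_finite) simp
  qed (use assms in auto)
  show ?thesis unfolding corr_def left_diff_distrib
    by (rule Bochner_Integration.integral_diff) (use i assms in auto)
qed

lemma integral_tendsto_of_sqnorm:
  assumes [measurable]: "\<And>n. u n \<in> borel_measurable borel" "G \<in> borel_measurable borel" "h \<in> borel_measurable borel"
    and fin: "\<And>n. sqnorm (u n) < \<infinity>" "sqnorm G < \<infinity>" "sqnorm h < \<infinity>"
    and lim: "(\<lambda>n. sqnorm (\<lambda>x. u n x - G x)) \<longlonglongrightarrow> 0"
  shows "(\<lambda>n. LINT x|lborel. u n x * h x) \<longlonglongrightarrow> (LINT x|lborel. G x * h x)"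
proof -
  have "(\<lambda>n. (LINT x|lborel. u n x * h x) - (LINT x|lborel. G x * h x)) \<longlonglongrightarrow> 0"
  proof (rule tendsto_0_from_ennreal_sq)
    have b: "ennreal ((cmod ((LINT x|lborel. u n x * h x) - (LINT x|lborel. G x * h x)))\<^sup>2) \<le> sqnorm h * sqnorm (\<lambda>x. u n x - G x)" for n
    proof -
      have "integrable lborel (\<lambda>x. u n x * h x)" "integrable lborel (\<lambda>x. G x * h x)"
        using fin by (auto intro: integrable_mult_sqnorm)
      then have "(LINT x|lborel. u n x * h x) - (LINT x|lborel. G x * h x) = (LINT x|lborel. (u n x - G x) * h x)"
        by (simp add: left_diff_distrib)
      then show ?thesis using sqnorm_integrable_mult_le[of "\<lambda>x. u n x - G x" h] by (simp add: mult.commute)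
    qed
    have "(\<lambda>n. sqnorm h * sqnorm (\<lambda>x. u n x - G x)) \<longlonglongrightarrow> sqnorm h * 0"
      by (rule ennreal_tendsto_cmult[OF _ lim]) (use fin in simp)
    then have l: "(\<lambda>n. sqnorm h * sqnorm (\<lambda>x. u n x - G x)) \<longlonglongrightarrow> 0" by simp
    show "(\<lambda>n. ennreal ((cmod ((LINT x|lborel. u n x * h x) - (LINT x|lborel. G x * h x)))\<^sup>2)) \<longlonglongrightarrow> 0"
      by (rule tendsto_sandwich[OF _ _ tendsto_const l]) (use b in \<open>auto intro: always_eventually\<close>)
  qed
  then show ?thesis by (simp add: LIM_zero_iff)
qed

text \<open>There is no minus sign: the one from integrating by parts cancels the one from
  differentiating the kernel at \<open>y - x\<close> with respect to \<open>x\<close>.\<close>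

lemma corr_deta_by_parts:
  assumes e: "e > 0" and [measurable]: "u \<in> borel_measurable borel" and fin: "sqnorm u < \<infinity>"
    and \<phi>: "has_grad \<phi> D" "continuous_on UNIV (D j)" "dec 5 \<phi>" "dec 5 (D j)"
  shows "(LINT x|lborel. corr (deta e j) u x * \<phi> x) = (LINT x|lborel. corr (eta e) u x * D j x)"
proof -
  interpret K: kernel "eta e" "deta e" "ddeta e" by (rule kernel_eta[OF e])
  have c: "continuous_on UNIV \<phi>" using \<phi>(1) has_grad_continuous by blast
  have [measurable]: "\<phi> \<in> borel_measurable borel" "D j \<in> borel_measurable borel"
    using c \<phi>(2) by (auto intro: borel_measurable_continuous_onI)
  have f: "sqnorm \<phi> < \<infinity>" "sqnorm (D j) < \<infinity>" using sqnorm_dec_finite[OF \<phi>(3)] sqnorm_dec_finite[OF \<phi>(4)] by simp_all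
  have "(LINT x|lborel. deta e j (y - x) * \<phi> x) = (LINT x|lborel. eta e (y - x) * D j x)" for y
  proof -
    let ?w = "\<lambda>x. eta e (y - x) * \<phi> x"
    let ?D = "\<lambda>j x. eta e (y - x) * D j x + (- deta e j (y - x)) * \<phi> x"
    have "dec (5 + 5) (\<lambda>x. eta e (y - x) * D j x)" "dec (5 + 5) (\<lambda>x. deta e j (y - x) * \<phi> x)" "dec (5 + 5) ?w"
      by (intro dec_mult dec_reflect K.dec0 K.dec1 \<phi>; simp)+
    then have i: "integrable lborel (\<lambda>x. eta e (y - x) * D j x)" "integrable lborel (\<lambda>x. deta e j (y - x) * \<phi> x)" "integrable lborel ?w"
      by (auto intro: integrable_dec)
    have "(LINT x|lborel. ?D j x) = 0"
    proof (rule integral_partial_eq_0[where D="?D" and w="?w"])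
      show "has_grad ?w ?D" by (intro has_grad_mult has_grad_reflect K.grad1 \<phi>)
      show "integrable lborel (?D j)" using i(1,2) by simp
      show "continuous_on UNIV (?D j)"
        by (intro continuous_on_add continuous_on_mult continuous_on_minus continuous_on_shift_reflect K.cont0 K.cont1 c \<phi>)
    qed (rule i(3))
    moreover have "(LINT x|lborel. ?D j x) = (LINT x|lborel. eta e (y - x) * D j x) - (LINT x|lborel. deta e j (y - x) * \<phi> x)"
      using i(1,2) by simp
    ultimately show ?thesis by simp
  qed
  then have "corr (\<lambda>z. deta e j (- z)) \<phi> y = corr (\<lambda>z. eta e (- z)) (D j) y" for y by (simp add: corr_def)
  then show ?thesis
    by (simp add: corr_adjoint[OF K.integrable1 assms(2) _ fin f(1)] corr_adjoint[OF integrable_eta[OF e] assms(2) _ fin f(2)])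
qed

context dirac_weak
begin

lemma sqnorm_g_finite: "sqnorm (g a) < \<infinity>"
proof -
  have "sqnorm (g a) \<le> sqnorm (\<lambda>x. g a x * of_real (bracket x))"
  proof (rule sqnorm_mono)
    fix x show "cmod (g a x) \<le> cmod (g a x * of_real (bracket x))"
      using mult_left_mono[OF bracket_ge(1)[of x] norm_ge_zero[of "g a x"]] bracket_ge(3)[of x] by (simp add: norm_mult)
  qed
  also have "\<dots> < \<infinity>" by (rule gw)
  finally show ?thesis .
qed

lemma dirac_corr_deta:
  assumes e: "e > 0"
  shows "(\<Sum>j\<in>UNIV. \<Sum>b\<in>UNIV. dirac_alpha j $ a $ b * corr (deta e j) (f b) x) = \<i> * corr (eta e) (g a) x"
proof -
  interpret K: kernel "eta e" "deta e" "ddeta e" by (rule kernel_eta[OF e])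
  define \<psi> where "\<psi> = (\<lambda>a' y. if a' = a then eta e (y - x) else 0)"
  define E where "E = (\<lambda>a' j y. if a' = a then deta e j (y - x) else 0)"
  have el: "elem (\<psi> a')" for a'
  proof -
    have "elem (\<lambda>z. of_real (e\<^sup>2) * of_real (plummer e 5 z))" by (intro elem_cmult elem_plummer e)
    then have "elem (eta e)" by (simp add: eta_def[abs_def])
    then show ?thesis unfolding \<psi>_def by (cases "a' = a") (auto intro: elem_shift elem_const)
  qed
  have gr: "has_grad (\<psi> a') (E a')" for a'
    unfolding \<psi>_def E_def by (cases "a' = a") (auto intro: has_grad_shift K.grad1 has_grad_const)
  have cE: "continuous_on UNIV (E a' j)" for a' j
    unfolding E_def by (cases "a' = a") (auto intro: continuous_on_shift_reflect K.cont1)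
  have d5: "dec 5 (\<lambda>y. eta e (y - x))" "dec 5 (\<lambda>y. deta e j (y - x))" for j
    by (intro dec_shift K.dec0 K.dec1; simp)+
  have dd2: "dec 2 (\<psi> a')" for a'
    unfolding \<psi>_def by (cases "a' = a") (auto intro: dec_mono[OF d5(1)] dec_zero)
  have P: "(\<Sum>a'\<in>UNIV. \<Sum>j\<in>UNIV. dirac_alpha j $ a' $ b * E a' j y) = (\<Sum>j\<in>UNIV. dirac_alpha j $ a $ b * deta e j (y - x))" for b y
  proof -
    have "(\<Sum>j\<in>UNIV. dirac_alpha j $ a' $ b * E a' j y) = (if a' = a then \<Sum>j\<in>UNIV. dirac_alpha j $ a $ b * deta e j (y - x) else 0)" for a'
      by (simp add: E_def)
    then show ?thesis by simp
  qed
  have d4: "dec 4 (\<lambda>y. \<Sum>a'\<in>UNIV. \<Sum>j\<in>UNIV. dirac_alpha j $ a' $ b * E a' j y)" for b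
    unfolding P by (intro dec_sum dec_cmult dec_mono[OF d5(2)]) auto
  have int: "integrable lborel (\<lambda>y. f b y * deta e j (y - x))" for b j
    by (intro integrable_f dec_mono[OF d5(2)]) auto
  have "(\<Sum>b\<in>UNIV. LINT y|lborel. f b y * (\<Sum>j\<in>UNIV. dirac_alpha j $ a $ b * deta e j (y - x))) = \<i> * (\<Sum>a'\<in>UNIV. LINT y|lborel. g a' y * \<psi> a' y)"
    using weak_extended[OF el gr cE dd2 d4] unfolding P .
  moreover have "(\<Sum>a'\<in>UNIV. LINT y|lborel. g a' y * \<psi> a' y) = corr (eta e) (g a) x"
  proof -
    have "(LINT y|lborel. g a' y * \<psi> a' y) = (if a' = a then corr (eta e) (g a) x else 0)" for a'
      by (simp add: \<psi>_def corr_def mult.commute)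
    then show ?thesis by simp
  qed
  moreover have "(LINT y|lborel. f b y * (\<Sum>j\<in>UNIV. dirac_alpha j $ a $ b * deta e j (y - x)))
     = (\<Sum>j\<in>UNIV. dirac_alpha j $ a $ b * corr (deta e j) (f b) x)" for b
  proof -
    have "(LINT y|lborel. f b y * (\<Sum>j\<in>UNIV. dirac_alpha j $ a $ b * deta e j (y - x))) = (LINT y|lborel. (\<Sum>j\<in>UNIV. dirac_alpha j $ a $ b * (f b y * deta e j (y - x))))"
      by (simp add: sum_distrib_left mult_ac)
    also have "\<dots> = (\<Sum>j\<in>UNIV. dirac_alpha j $ a $ b * (LINT y|lborel. f b y * deta e j (y - x)))"
      using int by (simp add: Bochner_Integration.integral_sum)
    finally show ?thesis by (simp add: corr_def mult.commute)
  qed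
  ultimately have "(\<Sum>b\<in>UNIV. \<Sum>j\<in>UNIV. dirac_alpha j $ a $ b * corr (deta e j) (f b) x) = \<i> * corr (eta e) (g a) x" by simp
  then show ?thesis by (subst sum.swap)
qed

text \<open>A single component of the gradient is bounded by the full energy, which by
  \<open>dirac_energy\<close> is that of the Dirac operator, and by the mollified equation that is
  expressed through \<open>g\<close>.\<close>

lemma gradient_difference_le:
  assumes e: "e > 0" "d > 0"
  shows "sqnorm (\<lambda>x. corr (deta e j) (f b) x - corr (deta d j) (f b) x)
    \<le> (\<Sum>a\<in>UNIV. sqnorm (\<lambda>x. corr (eta e) (g a) x - corr (eta d) (g a) x))"
proof -
  interpret K: kernel "eta e" "deta e" "ddeta e" by (rule kernel_eta[OF e(1)])
  interpret L: kernel "eta d" "deta d" "ddeta d" by (rule kernel_eta[OF e(2)])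
  interpret M: kernel "\<lambda>x. eta e x - eta d x" "\<lambda>j x. deta e j x - deta d j x" "\<lambda>j k x. ddeta e j k x - ddeta d j k x"
    by (rule kernel_diff[OF K.kernel_axioms L.kernel_axioms])
  have c: "corr (\<lambda>x. deta e j x - deta d j x) (f b) = (\<lambda>x. corr (deta e j) (f b) x - corr (deta d j) (f b) x)" for j b
    by (rule ext, rule corr_diff_kernel) (use K.dec1 L.dec1 sqnorm_f_finite in auto)
  have "(\<Sum>j\<in>UNIV. \<Sum>b\<in>UNIV. dirac_alpha j $ a $ b * (corr (deta e j) (f b) x - corr (deta d j) (f b) x))
     = \<i> * (corr (eta e) (g a) x - corr (eta d) (g a) x)" for a x
    unfolding right_diff_distrib sum_subtractf dirac_corr_deta[OF e(1)] dirac_corr_deta[OF e(2)] ..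
  then have T: "sqnorm (\<lambda>x. \<Sum>j\<in>UNIV. \<Sum>b\<in>UNIV. dirac_alpha j $ a $ b * corr (\<lambda>x. deta e j x - deta d j x) (f b) x)
     = sqnorm (\<lambda>x. corr (eta e) (g a) x - corr (eta d) (g a) x)" for a
    unfolding c by (simp add: sqnorm_def norm_mult)
  have "sqnorm (corr (\<lambda>x. deta e j x - deta d j x) (f b)) \<le> (\<Sum>j\<in>UNIV. sqnorm (corr (\<lambda>x. deta e j x - deta d j x) (f b)))"
    by (rule member_le_sum) auto
  also have "\<dots> \<le> (\<Sum>b\<in>UNIV. \<Sum>j\<in>UNIV. sqnorm (corr (\<lambda>x. deta e j x - deta d j x) (f b)))"
    by (rule member_le_sum[where f="\<lambda>b. \<Sum>j\<in>UNIV. sqnorm (corr (\<lambda>x. deta e j x - deta d j x) (f b))"]) auto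
  also have "\<dots> = (\<Sum>a\<in>UNIV. sqnorm (\<lambda>x. corr (eta e) (g a) x - corr (eta d) (g a) x))"
    unfolding M.dirac_energy[of f, OF fm sqnorm_f_finite] T ..
  finally show ?thesis unfolding c .
qed

text \<open>\<open>G\<close> is the L^2 limit of the correlations with \<open>deta\<close>, that is,
  -\<open>ceta\<close> times the weak j-th derivative of \<open>f b\<close>. The test class is
  described by decay of order 5.\<close>

lemma weak_gradient_exists:
  "\<exists>G. G \<in> borel_measurable borel \<and> sqnorm G < \<infinity> \<and>
    (\<forall>\<phi> D. has_grad \<phi> D \<longrightarrow> continuous_on UNIV (D j) \<longrightarrow> dec 5 \<phi> \<longrightarrow> dec 5 (D j) \<longrightarrow>
      (LINT x|lborel. G x * \<phi> x) = of_real ceta * (LINT x|lborel. f b x * D j x))"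
proof -
  let ?U = "\<lambda>n. corr (deta (width n) j) (f b)"
  have K: "kernel (eta (width n)) (deta (width n)) (ddeta (width n))" for n by (rule kernel_eta) simp
  have dm [measurable]: "deta (width n) j \<in> borel_measurable borel" for n by (rule kernel.meas1[OF K])
  have Uf: "sqnorm (?U n) < \<infinity>" for n
    by (rule kernel.sqnorm_corr_finite[OF K fm sqnorm_f_finite])
  have Ef: "sqnorm (corr (eta (width n)) u) < \<infinity>" if "u \<in> borel_measurable borel" "sqnorm u < \<infinity>" for u n
  proof -
    have "sqnorm (corr (eta (width n)) u) \<le> (\<integral>\<^sup>+z. ennreal (cmod (eta (width n) z)) \<partial>lborel)\<^sup>2 * sqnorm u"
      by (rule sqnorm_corr_le) (use that in auto)
    also have "\<dots> < \<infinity>" using that(2) by (simp add: nn_integral_eta power2_eq_square ennreal_mult_less_top)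
    finally show ?thesis .
  qed
  have Cauchy: "\<exists>N. \<forall>m\<ge>N. \<forall>n\<ge>N. sqnorm (\<lambda>x. ?U m x - ?U n x) \<le> ennreal \<delta>" if \<delta>: "\<delta> > 0" for \<delta>
  proof -
    let ?s = "\<lambda>a n. sqnorm (\<lambda>x. corr (eta (width n)) (g a) x - of_real ceta * g a x)"
    \<comment> \<open>The triangle inequality for squares turns two errors \<delta> / 16 into
      \<delta> / 4, and four components add up to \<delta>.\<close>
    have "eventually (\<lambda>n. ?s a n < ennreal (\<delta>/16)) sequentially" for a
      by (rule order_tendstoD(2)[OF eta_mollify[OF gm sqnorm_g_finite]]) (use \<delta> in simp)
    then have "eventually (\<lambda>n. \<forall>a. ?s a n < ennreal (\<delta>/16)) sequentially" by (intro eventually_all_finite)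
    then obtain N where N: "\<And>n a. n \<ge> N \<Longrightarrow> ?s a n < ennreal (\<delta>/16)" by (auto simp: eventually_sequentially)
    have "sqnorm (\<lambda>x. ?U m x - ?U n x) \<le> ennreal \<delta>" if mn: "m \<ge> N" "n \<ge> N" for m n
    proof -
      have "sqnorm (\<lambda>x. corr (eta (width m)) (g a) x - corr (eta (width n)) (g a) x) \<le> ennreal (\<delta>/4)" for a
      proof -
        have "sqnorm (\<lambda>x. corr (eta (width m)) (g a) x - corr (eta (width n)) (g a) x)
          \<le> 2 * ?s a m + 2 * sqnorm (\<lambda>x. of_real ceta * g a x - corr (eta (width n)) (g a) x)"
          by (rule sqnorm_diff_triangle) measurable
        also have "\<dots> \<le> 2 * ennreal (\<delta>/16) + 2 * ennreal (\<delta>/16)"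
          using N[OF mn(1), of a] N[OF mn(2), of a] sqnorm_minus_commute[of "\<lambda>x. of_real ceta * g a x" "corr (eta (width n)) (g a)"]
          by (intro add_mono mult_left_mono) auto
        also have "\<dots> = ennreal (\<delta>/8) + ennreal (\<delta>/8)" using ennreal_mult[of 2 "\<delta>/16"] \<delta> by simp
        also have "\<dots> = ennreal (\<delta>/4)" using ennreal_plus[of "\<delta>/8" "\<delta>/8"] \<delta> by simp
        finally show ?thesis .
      qed
      then have "(\<Sum>a\<in>UNIV. sqnorm (\<lambda>x. corr (eta (width m)) (g a) x - corr (eta (width n)) (g a) x)) \<le> (\<Sum>a\<in>(UNIV :: 4 set). ennreal (\<delta>/4))"
        by (intro sum_mono)
      also have "\<dots> = ennreal \<delta>" using \<delta> by (subst sum_ennreal) auto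
      finally show ?thesis using gradient_difference_le[of "width m" "width n" j b] by (simp add: order.trans)
    qed
    then show ?thesis by blast
  qed
  obtain G where G: "G \<in> borel_measurable borel" "sqnorm G < \<infinity>" "(\<lambda>n. sqnorm (\<lambda>x. ?U n x - G x)) \<longlonglongrightarrow> 0"
    using Riesz_Fischer[of ?U, OF corr_measurable[OF dm fm] Uf Cauchy] by blast
  have "(LINT x|lborel. G x * \<phi> x) = of_real ceta * (LINT x|lborel. f b x * D j x)"
    if \<phi>: "has_grad \<phi> D" "continuous_on UNIV (D j)" "dec 5 \<phi>" "dec 5 (D j)" for \<phi> D
  proof -
    have [measurable]: "\<phi> \<in> borel_measurable borel" "D j \<in> borel_measurable borel"
      using has_grad_continuous[OF \<phi>(1)] \<phi>(2) by (auto intro: borel_measurable_continuous_onI)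
    have fin: "sqnorm \<phi> < \<infinity>" "sqnorm (D j) < \<infinity>" using sqnorm_dec_finite[OF \<phi>(3)] sqnorm_dec_finite[OF \<phi>(4)] by simp_all
    have 1: "(\<lambda>n. LINT x|lborel. ?U n x * \<phi> x) \<longlonglongrightarrow> (LINT x|lborel. G x * \<phi> x)"
      by (rule integral_tendsto_of_sqnorm[OF corr_measurable[OF dm fm] G(1) _ Uf G(2) fin(1) G(3)]) measurable
    have "sqnorm (\<lambda>x. of_real ceta * f b x) < \<infinity>"
      using sqnorm_f_finite[of b] by (subst sqnorm_cmult) (auto simp: ennreal_mult_less_top)
    then have 2: "(\<lambda>n. LINT x|lborel. corr (eta (width n)) (f b) x * D j x) \<longlonglongrightarrow> (LINT x|lborel. (of_real ceta * f b x) * D j x)"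
      using Ef[OF fm sqnorm_f_finite] fin eta_mollify[OF fm sqnorm_f_finite]
      by (intro integral_tendsto_of_sqnorm) auto
    have eq: "(LINT x|lborel. ?U n x * \<phi> x) = (LINT x|lborel. corr (eta (width n)) (f b) x * D j x)" for n
      by (rule corr_deta_by_parts[OF _ fm sqnorm_f_finite \<phi>]) simp
    have "(LINT x|lborel. G x * \<phi> x) = (LINT x|lborel. (of_real ceta * f b x) * D j x)"
      using LIMSEQ_unique[OF 1[unfolded eq] 2] .
    then show ?thesis by (simp add: mult.assoc)
  qed
  then show ?thesis using G by blast
qed

end

section \<open>Test functions, Borel representatives and the theorem\<close>

text \<open>Translates the class of test functions into gradients and decay classes.
  Differentiability of the first partials yields their continuity, and compact support yields every
  order of decay.\<close>

lemma test_function_props: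
  assumes "\<phi> \<in> test_functions"
  shows "has_grad \<phi> (\<lambda>j. partial_deriv j \<phi>)" "continuous_on UNIV \<phi>" "continuous_on UNIV (partial_deriv j \<phi>)"
    "dec q \<phi>" "dec q (partial_deriv j \<phi>)"
proof -
  have sm: "fold partial_deriv js \<phi> differentiable_on UNIV" for js using assms by (auto simp: test_functions_def smooth_def)
  have d: "\<phi> differentiable (at x)" for x using sm[of "[]"] by (simp add: differentiable_on_def)
  have lin: "linear (frechet_derivative \<phi> (at x))" for x by (rule linear_frechet_derivative[OF d])
  have "frechet_derivative \<phi> (at x) h = (\<Sum>j\<in>UNIV. of_real (h $ j) * partial_deriv j \<phi> x)" for x h
  proof -
    have "h = (\<Sum>j\<in>UNIV. h $ j *\<^sub>R axis j 1)"
      by (simp add: vec_eq_iff axis_def if_distrib cong: if_cong)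
    then have "frechet_derivative \<phi> (at x) h = frechet_derivative \<phi> (at x) (\<Sum>j\<in>UNIV. h $ j *\<^sub>R axis j 1)" by simp
    also have "\<dots> = (\<Sum>j\<in>UNIV. h $ j *\<^sub>R frechet_derivative \<phi> (at x) (axis j 1))"
      by (simp add: linear_sum[OF lin] linear_cmul[OF lin])
    finally show ?thesis by (simp add: partial_deriv_def scaleR_conv_of_real)
  qed
  then show g: "has_grad \<phi> (\<lambda>j. partial_deriv j \<phi>)"
    unfolding has_grad_def using d[unfolded frechet_derivative_works] by (metis (no_types, lifting) ext)
  show c: "continuous_on UNIV \<phi>" using g has_grad_continuous by blast
  show c': "continuous_on UNIV (partial_deriv j \<phi>)"
    using sm[of "[j]"] by (simp add: differentiable_imp_continuous_on)
  have "bounded (closure {x. \<phi> x \<noteq> 0})" using assms by (simp add: test_functions_def compact_imp_bounded)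
  then obtain R where R: "\<And>x. x \<in> closure {x. \<phi> x \<noteq> 0} \<Longrightarrow> norm x \<le> R" by (auto simp: bounded_iff)
  have z: "\<phi> x = 0" if "norm x > R" for x
    using R[of x] that closure_subset[of "{x. \<phi> x \<noteq> 0}"] by fastforce
  have z': "partial_deriv j \<phi> x = 0" if x: "norm x > R" for x
  proof -
    have "(\<phi> has_derivative (\<lambda>h. 0)) (at x)"
    proof (rule has_derivative_transform_within_open[OF has_derivative_const[of 0], of "- cball 0 R"])
      show "open (- cball 0 R :: (real^3) set)" by (rule open_Compl) simp
    qed (use x z in auto)
    then show ?thesis by (simp add: partial_deriv_def frechet_derivative_at[symmetric])
  qed
  show "dec q \<phi>" by (rule dec_compact_support[OF c z])
  show "dec q (partial_deriv j \<phi>)" by (rule dec_compact_support[OF c' z'])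
qed

text \<open>Real and imaginary parts are treated separately, each by the representative theorem for
  real functions measurable with respect to a completion.\<close>

lemma borel_representative:
  fixes u :: "real^3 \<Rightarrow> complex"
  assumes "u \<in> borel_measurable lebesgue"
  shows "\<exists>v. v \<in> borel_measurable borel \<and> (AE x in lborel. u x = v x)"
proof -
  have "(\<lambda>x. Re (u x)) \<in> borel_measurable lebesgue" "(\<lambda>x. Im (u x)) \<in> borel_measurable lebesgue"
    using assms by (auto intro: measurable_compose[OF assms])
  note ReIm = this
  obtain r where r: "r \<in> borel_measurable lborel" "AE x in lborel. Re (u x) = r x"
    using completion_ex_borel_measurable_real[OF ReIm(1)] by blast
  obtain i where i: "i \<in> borel_measurable lborel" "AE x in lborel. Im (u x) = i x"
    using completion_ex_borel_measurable_real[OF ReIm(2)] by blast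
  have [measurable]: "r \<in> borel_measurable borel" "i \<in> borel_measurable borel" using r i by auto
  have "AE x in lborel. u x = of_real (r x) + \<i> * of_real (i x)"
    using r(2) i(2) by eventually_elim (auto simp: complex_eq_iff)
  moreover have "(\<lambda>x. complex_of_real (r x) + \<i> * of_real (i x)) \<in> borel_measurable borel" by measurable
  ultimately show ?thesis by blast
qed

lemma integral_lebesgue_eq_lborel:
  assumes u: "u \<in> borel_measurable lebesgue" and v: "v \<in> borel_measurable borel" and ae: "AE x in lborel. u x = v x"
    and h: "h \<in> borel_measurable borel"
  shows "(LINT x|lebesgue. u x * h x) = (LINT x|lborel. v x * (h x :: complex))"
proof -
  have [measurable]: "v \<in> borel_measurable lebesgue" "h \<in> borel_measurable lebesgue"
    using v h by (auto intro: measurable_completion)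
  have "(LINT x|lebesgue. u x * h x) = (LINT x|lebesgue. v x * h x)"
    using u AE_completion[OF ae] by (intro integral_cong_AE) (auto elim!: eventually_mono)
  also have "\<dots> = (LINT x|lborel. v x * h x)"
    using v h by (intro integral_completion) auto
  finally show ?thesis .
qed

lemma L2_iff_sqnorm:
  assumes u: "u \<in> borel_measurable lebesgue" and v: "v \<in> borel_measurable borel" and ae: "AE x in lborel. u x = v x"
  shows "u \<in> L2 \<longleftrightarrow> sqnorm v < \<infinity>"
proof -
  have "(\<integral>\<^sup>+x. ennreal ((cmod (u x))\<^sup>2) \<partial>lebesgue) = sqnorm v"
    unfolding sqnorm_def nn_integral_completion using ae by (intro nn_integral_cong_AE) (auto elim!: eventually_mono)
  then show ?thesis using u by (auto simp: L2_def integrable_iff_bounded)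
qed

theorem theorem2p2:
  fixes \<rho> C\<^sub>0 s :: real
    and Q :: "real^3 \<Rightarrow> complex^4^4"
    and f :: "real^3 \<Rightarrow> complex^4"
  assumes "\<rho> > 3/2"
    and "\<And>x. hermitian (Q x)"
    and "\<And>j k. (\<lambda>x. Q x $ j $ k) \<in> borel_measurable lebesgue"
    and "C\<^sub>0 > 0"
    and "\<And>x j k. cmod (Q x $ j $ k) \<le> C\<^sub>0 * bracket x powr (-\<rho>)"
    and "0 < s" and "s \<le> min (3/2) (\<rho> - 1)"
    and "f \<in> spinors (weighted_L2 (-s))"
    and "dirac_null Q f"
  shows "f \<in> spinors H1"
proof -
  have br [measurable]: "bracket \<in> borel_measurable lebesgue" by (intro measurable_completion) simp
  have wm: "(\<lambda>x. of_real (bracket x powr (-s)) * f x $ b) \<in> borel_measurable lebesgue"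
    and wi: "(\<integral>\<^sup>+x. ennreal ((cmod (of_real (bracket x powr (-s)) * f x $ b))\<^sup>2) \<partial>lborel) < \<infinity>" for b
    using assms(8) by (auto simp: spinors_def weighted_L2_def L2_def integrable_iff_bounded nn_integral_completion)
  \<comment> \<open>Only the weighted components are given as measurable; multiplying by the inverse
    weight recovers \<open>f\<close>.\<close>
  have fm: "(\<lambda>x. f x $ b) \<in> borel_measurable lebesgue" for b
  proof -
    have "(\<lambda>x. of_real (bracket x powr s) * (of_real (bracket x powr (-s)) * f x $ b)) \<in> borel_measurable lebesgue"
      by (rule borel_measurable_times[OF _ wm]) measurable
    moreover have "of_real (bracket x powr s) * (of_real (bracket x powr (-s)) * f x $ b) = f x $ b" for x
    proof -
      have "bracket x powr s * bracket x powr (-s) = 1" using bracket_ge(3)[of x] by (simp add: powr_add[symmetric])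
      then have "complex_of_real (bracket x powr s) * of_real (bracket x powr (-s)) = 1" by (metis of_real_1 of_real_mult)
      then show ?thesis by (simp only: mult.assoc[symmetric] mult_1_left)
    qed
    ultimately show ?thesis by simp
  qed
  have gm: "(\<lambda>x. (Q x *v f x) $ a) \<in> borel_measurable lebesgue" for a
    unfolding matrix_vector_mult_def using assms(3) fm by simp
  obtain f' where f': "\<And>b. f' b \<in> borel_measurable borel" "\<And>b. AE x in lborel. f x $ b = f' b x"
  proof -
    have "\<forall>b. \<exists>v. v \<in> borel_measurable borel \<and> (AE x in lborel. f x $ b = v x)"
      by (intro allI borel_representative fm)
    from choice[OF this] show thesis using that by blast
  qed
  obtain g' where g': "\<And>a. g' a \<in> borel_measurable borel" "\<And>a. AE x in lborel. (Q x *v f x) $ a = g' a x"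
  proof -
    have "\<forall>a. \<exists>v. v \<in> borel_measurable borel \<and> (AE x in lborel. (Q x *v f x) $ a = v x)"
      by (intro allI borel_representative gm)
    from choice[OF this] show thesis using that by blast
  qed
  \<comment> \<open>The minus sign in \<open>dist_D\<close> brings H f = 0 into the form of the
    locale, with the derivative term and the term in \<open>g'\<close> on opposite sides.\<close>
  have weak: "(\<Sum>j\<in>UNIV. \<Sum>b\<in>UNIV. dirac_alpha j $ a $ b * (LINT x|lborel. f' b x * D_op j \<phi> x)) = (LINT x|lborel. g' a x * \<phi> x)"
    if \<phi>: "\<phi> \<in> test_functions" for a \<phi>
  proof -
    have m: "\<phi> \<in> borel_measurable borel" "D_op j \<phi> \<in> borel_measurable borel" for j
      unfolding D_op_def using test_function_props(2,3)[OF \<phi>]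
      by (auto intro!: borel_measurable_continuous_onI continuous_intros)
    have "dirac_dist Q f a \<phi> = 0" using assms(9) \<phi> by (simp add: dirac_null_def)
    then have "- (\<Sum>j\<in>UNIV. \<Sum>b\<in>UNIV. dirac_alpha j $ a $ b * (LINT x|lborel. f' b x * D_op j \<phi> x)) + (LINT x|lborel. g' a x * \<phi> x) = 0"
      unfolding dirac_dist_def dist_D_def regular_dist_def
      by (simp add: integral_lebesgue_eq_lborel[OF fm f' m(2)] integral_lebesgue_eq_lborel[OF gm g' m(1)] sum_negf)
    then show ?thesis by simp
  qed
  \<comment> \<open>Here s <= 3/2 enters: \<open>bracket\<close> is at least 1, so the weight with
    exponent -3/2 is the smaller one.\<close>
  have fw: "sqnorm (\<lambda>x. f' b x * of_real (bracket x powr (-3/2))) < \<infinity>" for b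
  proof -
    have "sqnorm (\<lambda>x. f' b x * of_real (bracket x powr (-3/2))) \<le> (\<integral>\<^sup>+x. ennreal ((cmod (of_real (bracket x powr (-s)) * f x $ b))\<^sup>2) \<partial>lborel)"
      unfolding sqnorm_def
    proof (rule nn_integral_mono_AE, use f'(2)[of b] in eventually_elim)
      case (elim x)
      have "bracket x powr (-3/2) \<le> bracket x powr (-s)" using bracket_ge[of x] assms(7) by (intro powr_mono) auto
      then have "cmod (f' b x * of_real (bracket x powr (-3/2))) \<le> cmod (of_real (bracket x powr (-s)) * f x $ b)"
        by (simp add: norm_mult elim mult.commute mult_left_mono)
      then show ?case by (intro ennreal_leI power_mono) auto
    qed
    also have "\<dots> < \<infinity>" by (rule wi)
    finally show ?thesis .
  qed
  \<comment> \<open>Here s <= \<rho> - 1 enters: the decay of \<open>Q\<close> absorbs one factor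
    \<open>bracket\<close> and still leaves the weight with exponent -s on \<open>f\<close>.\<close>
  have gw: "sqnorm (\<lambda>x. g' a x * of_real (bracket x)) < \<infinity>" for a
  proof -
    define w where "w = (\<lambda>b x. C\<^sub>0 * cmod (of_real (bracket x powr (-s)) * f x $ b))"
    have pw: "(cmod ((Q x *v f x) $ a * of_real (bracket x)))\<^sup>2 \<le> (\<Sum>b\<in>UNIV. 4 * (w b x)\<^sup>2)" for x
    proof -
      have "cmod ((Q x *v f x) $ a * of_real (bracket x)) \<le> (\<Sum>b\<in>UNIV. w b x)"
      proof -
        have "cmod ((Q x *v f x) $ a * of_real (bracket x)) \<le> (\<Sum>b\<in>UNIV. cmod (Q x $ a $ b * f x $ b * of_real (bracket x)))"
          unfolding matrix_vector_mult_def by (simp add: sum_distrib_right norm_sum)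
        also have "\<dots> \<le> (\<Sum>b\<in>UNIV. w b x)"
        proof (rule sum_mono)
          fix b
          have "bracket x powr (-\<rho>) * bracket x = bracket x powr (-\<rho> + 1)"
            using bracket_ge(3)[of x] powr_add[of "bracket x" "-\<rho>" 1] by simp
          also have "\<dots> \<le> bracket x powr (-s)" using bracket_ge(1)[of x] assms(7) by (intro powr_mono) auto
          finally have b1: "bracket x powr (-\<rho>) * bracket x \<le> bracket x powr (-s)" .
          have "cmod (Q x $ a $ b) * bracket x \<le> (C\<^sub>0 * bracket x powr (-\<rho>)) * bracket x"
            using assms(5)[of x a b] bracket_ge(3)[of x] by (intro mult_right_mono) auto
          also have "\<dots> \<le> C\<^sub>0 * bracket x powr (-s)" using b1 assms(4) by (simp add: mult.assoc)
          finally have "cmod (Q x $ a $ b) * bracket x * cmod (f x $ b) \<le> C\<^sub>0 * bracket x powr (-s) * cmod (f x $ b)"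
            by (intro mult_right_mono) auto
          then show "cmod (Q x $ a $ b * f x $ b * of_real (bracket x)) \<le> w b x"
            using bracket_ge(3)[of x] by (simp add: w_def norm_mult mult_ac)
        qed
        finally show ?thesis .
      qed
      then have "(cmod ((Q x *v f x) $ a * of_real (bracket x)))\<^sup>2 \<le> (\<Sum>b\<in>UNIV. w b x)\<^sup>2" by (intro power_mono) auto
      also have "\<dots> \<le> (\<Sum>b\<in>(UNIV :: 4 set). (w b x)\<^sup>2) * real (card (UNIV :: 4 set))"
        by (rule sum_squared_le_sum_of_squares)
      finally show ?thesis by (simp add: sum_distrib_left mult.commute)
    qed
    \<comment> \<open>The bound is integrated over \<open>lebesgue\<close> because it contains
      \<open>f\<close> itself, which is only Lebesgue measurable, and splitting the sum requires
      measurability.\<close>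
    have "sqnorm (\<lambda>x. g' a x * of_real (bracket x))
      \<le> (\<integral>\<^sup>+x. (\<Sum>b\<in>UNIV. ennreal (4 * C\<^sub>0\<^sup>2) * ennreal ((cmod (of_real (bracket x powr (-s)) * f x $ b))\<^sup>2)) \<partial>lebesgue)"
      unfolding sqnorm_def nn_integral_completion
    proof (rule nn_integral_mono_AE, use g'(2)[of a] in eventually_elim)
      case (elim x)
      have "ennreal ((cmod (g' a x * of_real (bracket x)))\<^sup>2) \<le> ennreal (\<Sum>b\<in>UNIV. 4 * (w b x)\<^sup>2)"
        using pw[of x] by (intro ennreal_leI) (simp add: elim)
      also have "\<dots> = (\<Sum>b\<in>UNIV. ennreal (4 * (w b x)\<^sup>2))" by (simp add: sum_ennreal)
      also have "\<dots> = (\<Sum>b\<in>UNIV. ennreal (4 * C\<^sub>0\<^sup>2) * ennreal ((cmod (of_real (bracket x powr (-s)) * f x $ b))\<^sup>2))"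
        by (intro sum.cong refl, subst ennreal_mult[symmetric]) (auto simp: w_def power_mult_distrib mult_ac)
      finally show ?case .
    qed
    also have "\<dots> = (\<Sum>b\<in>UNIV. ennreal (4 * C\<^sub>0\<^sup>2) * (\<integral>\<^sup>+x. ennreal ((cmod (of_real (bracket x powr (-s)) * f x $ b))\<^sup>2) \<partial>lebesgue))"
      using wm by (simp add: nn_integral_sum nn_integral_cmult)
    also have "\<dots> < \<infinity>" using wi by (simp add: nn_integral_completion ennreal_mult_less_top)
    finally show ?thesis .
  qed
  interpret D: dirac_weak f' g'
    by unfold_locales (use f'(1) g'(1) fw gw weak in auto)
  have "(\<lambda>x. f x $ a) \<in> H1" for a
  proof -
    have "(\<lambda>x. f x $ a) \<in> L2" using L2_iff_sqnorm[OF fm f'(1) f'(2)] D.sqnorm_f_finite by blast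
    moreover have "\<exists>h\<in>L2. \<forall>\<phi>\<in>test_functions. dist_D j (regular_dist (\<lambda>x. f x $ a)) \<phi> = regular_dist h \<phi>" for j
    proof -
      obtain G where G: "G \<in> borel_measurable borel" "sqnorm G < \<infinity>"
        "\<And>\<phi> D. has_grad \<phi> D \<Longrightarrow> continuous_on UNIV (D j) \<Longrightarrow> dec 5 \<phi> \<Longrightarrow> dec 5 (D j) \<Longrightarrow>
          (LINT x|lborel. G x * \<phi> x) = of_real ceta * (LINT x|lborel. f' a x * D j x)"
        using D.weak_gradient_exists[of j a] by blast
      \<comment> \<open>The weak derivative is -G / \<open>ceta\<close>, and D_j is 1/i times it;
        since -1/i = i, the representing function is (i / \<open>ceta\<close>) G.\<close>
      define h where "h = (\<lambda>x. (\<i> / of_real ceta) * G x)"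
      have hm: "h \<in> borel_measurable borel" "h \<in> borel_measurable lebesgue"
        unfolding h_def using G(1) by (auto intro!: measurable_completion)
      have "sqnorm h < \<infinity>" unfolding h_def using G(1,2) by (subst sqnorm_cmult) (auto simp: ennreal_mult_less_top)
      then have "h \<in> L2" using L2_iff_sqnorm[OF hm(2,1)] by simp
      moreover have "dist_D j (regular_dist (\<lambda>x. f x $ a)) \<phi> = regular_dist h \<phi>" if \<phi>: "\<phi> \<in> test_functions" for \<phi>
      proof -
        have m: "\<phi> \<in> borel_measurable borel" "D_op j \<phi> \<in> borel_measurable borel"
          unfolding D_op_def using test_function_props(2,3)[OF \<phi>]
          by (auto intro!: borel_measurable_continuous_onI continuous_intros)
        have "dist_D j (regular_dist (\<lambda>x. f x $ a)) \<phi> = - (LINT x|lborel. f' a x * D_op j \<phi> x)"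
          by (simp add: dist_D_def regular_dist_def integral_lebesgue_eq_lborel[OF fm f' m(2)])
        also have "(LINT x|lborel. f' a x * D_op j \<phi> x) = (LINT x|lborel. (1/\<i>) * (f' a x * partial_deriv j \<phi> x))"
          by (simp add: D_op_def mult_ac)
        also have "\<dots> = (1/\<i>) * (LINT x|lborel. f' a x * partial_deriv j \<phi> x)" by (rule integral_mult_right_zero)
        also have "- \<dots> = (\<i> / of_real ceta) * (LINT x|lborel. G x * \<phi> x)"
          using G(3)[OF test_function_props(1,3,4,5)[OF \<phi>]] ceta_pos by (simp add: field_simps)
        also have "\<dots> = (LINT x|lborel. (\<i> / of_real ceta) * (G x * \<phi> x))" by (rule integral_mult_right_zero[symmetric])
        also have "\<dots> = (LINT x|lborel. h x * \<phi> x)" by (simp add: h_def mult_ac)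
        also have "\<dots> = regular_dist h \<phi>"
          unfolding regular_dist_def by (rule integral_lebesgue_eq_lborel[symmetric]) (use hm m in auto)
        finally show ?thesis .
      qed
      ultimately show ?thesis by blast
    qed
    ultimately show ?thesis by (simp add: H1_def)
  qed
  then show ?thesis by (simp add: spinors_def)
qed

end
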